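(* Let $\varphi:G\to\mathrm{Homeo}(X)$ be an action of a discrete group $G$ on a locally compact Hausdorff space $X$, let $\alpha$ be the corresponding action on $C_0(X)$ and let $u\in Z^2(G,C_u(X))$ be a normalised $2$-cocycle. If the action $\varphi$ is amenable, then for any $p\in(1,\infty)$ the regular representation $\Lambda_p:F^p(\alpha,u)\to F^p_{\mathrm r}(\alpha,u)$ is isometric.
   Context: Setting: $\alpha_s(a)=a\circ\varphi_{s^{-1}}$ for $a\in C_0(X)$, and also for $a\in C_b(X)$. $C_u(X)=\{a\in C_b(X):|a(x)|=1\ \forall x\in X\}$. A normalised $2$-cocycle $u\in Z^2(G,C_u(X))$ is a map $u:G\times G\to C_u(X)$ with $\alpha_r(u(s,t))u(r,st)=u(r,s)u(rs,t)$ for all $r,s,t\in G$ and $u(1,1)=1$. $F(\alpha,u)=\ell^1(G,C_0(X))$ is the Banach algebra with norm $\|b\|_1=\sum_{g}\|b(g)\|_\infty$ and product $(a*b)(r)=\sum_{st=r}a(s)\alpha_s(b(t))u(s,t)$. A representation of a Banach algebra $B$ on a Banach space $E$ is a contractive homomorphism $\pi:B\to B(E)$ into the bounded operators; it is non-degenerate if $\overline{\pi(B)E}=E$ (closed linear span). An $L^p$-space is a Banach space isometrically isomorphic to $L^p(\mu)$ for some measure $\mu$. For $p\in[1,\infty)$, $F^p(\alpha,u)$ is the completion of $F(\alpha,u)$ in the norm $\|b\|_{L^p}=\sup\|\psi(b)\|$, the supremum being over all non-degenerate representations $\psi$ of $F(\alpha,u)$ on $L^p$-spaces. The formula $$\Lambda_p(b)\xi(x,t)=\sum_{s\in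 G}b(s)(x)\,u(s,s^{-1}t)(x)\,\xi(\varphi_{s^{-1}}(x),s^{-1}t)$$ defines an injective non-degenerate representation $\Lambda_p:F(\alpha,u)\to B(\ell^p(X\times G))$; $F^p_{\mathrm r}(\alpha,u)$ is the completion of $F(\alpha,u)$ in the norm $\|\Lambda_p(\cdot)\|$, i.e. $\overline{\Lambda_p(F(\alpha,u))}$. The regular representation $\Lambda_p:F^p(\alpha,u)\to F^p_{\mathrm r}(\alpha,u)$ is the continuous extension of $\Lambda_p$ (the identity on $F(\alpha,u)$). Amenability of $\varphi$: there is a net $(f_i)_{i\in I}$ of finitely supported functions $f_i:G\to C_c(X)^+$ such that $\sum_{t\in G}f_i(t)\to 1$ and, for every $s\in G$, $\sum_{t\in G}|\alpha_s(f_i(t))-f_i(st)|\to 0$, both uniformly on compact subsets of $X$. *)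

theory Defs
  imports "HOL-Analysis.Analysis"
begin

section \<open>Complex (semi)normed spaces on carrier sets\<close>

text \<open>
  The function spaces, their completions and the spaces on which they are represented depend on the
  data (action, cocycle, measure, exponent), so they are structures on carrier sets, not types.
\<close>

record 'v cspace =
  carr :: "'v set"
  zero_of :: "'v"
  add_of :: "'v \<Rightarrow> 'v \<Rightarrow> 'v"
  scale_of :: "complex \<Rightarrow> 'v \<Rightarrow> 'v"
  norm_of :: "'v \<Rightarrow> real"

record 'v calgebra = "'v cspace" +
  mult_of :: "'v \<Rightarrow> 'v \<Rightarrow> 'v"

definition diff_of :: "('v, 'z) cspace_scheme \<Rightarrow> 'v \<Rightarrow> 'v \<Rightarrow> 'v" where
  "diff_of V x y = add_of V x (scale_of V (-1) y)"

definition cauchy_in :: "('v, 'z) cspace_scheme \<Rightarrow> (nat \<Rightarrow> 'v) \<Rightarrow> bool" where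
  "cauchy_in V x \<longleftrightarrow> (\<forall>n. x n \<in> carr V) \<and>
     (\<forall>e>0. \<exists>N. \<forall>m\<ge>N. \<forall>n\<ge>N. norm_of V (diff_of V (x m) (x n)) < e)"

locale complex_normed_space =
  fixes V :: "('v, 'z) cspace_scheme"
  assumes zero_closed: "zero_of V \<in> carr V"
    and add_closed: "\<lbrakk>x \<in> carr V; y \<in> carr V\<rbrakk> \<Longrightarrow> add_of V x y \<in> carr V"
    and scale_closed: "x \<in> carr V \<Longrightarrow> scale_of V c x \<in> carr V"
    and add_assoc: "\<lbrakk>x \<in> carr V; y \<in> carr V; z \<in> carr V\<rbrakk> \<Longrightarrow>
          add_of V (add_of V x y) z = add_of V x (add_of V y z)"
    and add_comm: "\<lbrakk>x \<in> carr V; y \<in> carr V\<rbrakk> \<Longrightarrow> add_of V x y = add_of V y x"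
    and add_zero: "x \<in> carr V \<Longrightarrow> add_of V x (zero_of V) = x"
    and diff_self: "x \<in> carr V \<Longrightarrow> diff_of V x x = zero_of V"
    and scale_add: "\<lbrakk>x \<in> carr V; y \<in> carr V\<rbrakk> \<Longrightarrow>
          scale_of V c (add_of V x y) = add_of V (scale_of V c x) (scale_of V c y)"
    and add_scale: "x \<in> carr V \<Longrightarrow>
          scale_of V (c + d) x = add_of V (scale_of V c x) (scale_of V d x)"
    and scale_scale: "x \<in> carr V \<Longrightarrow> scale_of V c (scale_of V d x) = scale_of V (c * d) x"
    and scale_one: "x \<in> carr V \<Longrightarrow> scale_of V 1 x = x"
    and norm_eq_0: "x \<in> carr V \<Longrightarrow> norm_of V x = 0 \<longleftrightarrow> x = zero_of V"
    and norm_triangle: "\<lbrakk>x \<in> carr V; y \<in> carr V\<rbrakk> \<Longrightarrow>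
          norm_of V (add_of V x y) \<le> norm_of V x + norm_of V y"
    and norm_scale: "x \<in> carr V \<Longrightarrow> norm_of V (scale_of V c x) = norm c * norm_of V x"

locale complex_banach_space = complex_normed_space +
  assumes complete: "cauchy_in V x \<Longrightarrow>
    \<exists>l\<in>carr V. (\<lambda>n. norm_of V (diff_of V (x n) l)) \<longlonglongrightarrow> 0"

definition linear_map :: "('v, 'y) cspace_scheme \<Rightarrow> ('w, 'z) cspace_scheme \<Rightarrow> ('v \<Rightarrow> 'w) \<Rightarrow> bool" where
  "linear_map V W T \<longleftrightarrow> T \<in> carr V \<rightarrow> carr W \<and>
     (\<forall>x\<in>carr V. \<forall>y\<in>carr V. T (add_of V x y) = add_of W (T x) (T y)) \<and>
     (\<forall>c. \<forall>x\<in>carr V. T (scale_of V c x) = scale_of W c (T x))"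

definition linear_isometry ::
    "('v, 'y) cspace_scheme \<Rightarrow> ('w, 'z) cspace_scheme \<Rightarrow> ('v \<Rightarrow> 'w) \<Rightarrow> bool" where
  "linear_isometry V W T \<longleftrightarrow> linear_map V W T \<and> (\<forall>x\<in>carr V. norm_of W (T x) = norm_of V x)"

definition continuous_between ::
    "('v, 'y) cspace_scheme \<Rightarrow> ('w, 'z) cspace_scheme \<Rightarrow> ('v \<Rightarrow> 'w) \<Rightarrow> bool" where
  "continuous_between V W T \<longleftrightarrow> (\<forall>x\<in>carr V. \<forall>e>0. \<exists>d>0. \<forall>y\<in>carr V.
     norm_of V (diff_of V y x) < d \<longrightarrow> norm_of W (diff_of W (T y) (T x)) < e)"

inductive_set lin_span :: "('v, 'z) cspace_scheme \<Rightarrow> 'v set \<Rightarrow> 'v set"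
  for V :: "('v, 'z) cspace_scheme" and S :: "'v set" where
    "zero_of V \<in> lin_span V S"
  | "x \<in> S \<Longrightarrow> x \<in> lin_span V S"
  | "\<lbrakk>x \<in> lin_span V S; y \<in> lin_span V S\<rbrakk> \<Longrightarrow> add_of V x y \<in> lin_span V S"
  | "x \<in> lin_span V S \<Longrightarrow> scale_of V c x \<in> lin_span V S"

definition operator_norm :: "('v, 'z) cspace_scheme \<Rightarrow> ('v \<Rightarrow> 'v) \<Rightarrow> real" where
  "operator_norm V T = (SUP x\<in>{x \<in> carr V. norm_of V x \<le> 1}. norm_of V (T x))"

definition bounded_operators :: "('v, 'z) cspace_scheme \<Rightarrow> ('v \<Rightarrow> 'v) set" where
  "bounded_operators V = {T. linear_map V V T \<and>
     (\<exists>C. \<forall>x\<in>carr V. norm_of V (T x) \<le> C * norm_of V x)}"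

subsection \<open>Separated quotient and completion\<close>

definition null_class :: "('v, 'z) cspace_scheme \<Rightarrow> 'v \<Rightarrow> 'v set" where
  "null_class V x = {y \<in> carr V. norm_of V (diff_of V y x) = 0}"

text \<open>
  The normed space associated with a seminormed one. The unions below are unions of a single
  class each, and the seminorm is constant on every class.
\<close>

definition separated_quotient :: "('v, 'z) cspace_scheme \<Rightarrow> 'v set cspace" where
  "separated_quotient V = \<lparr>
     carr = null_class V ` carr V,
     zero_of = null_class V (zero_of V),
     add_of = (\<lambda>A B. \<Union>x\<in>A. \<Union>y\<in>B. null_class V (add_of V x y)),
     scale_of = (\<lambda>c A. \<Union>x\<in>A. null_class V (scale_of V c x)),
     norm_of = (\<lambda>A. the_elem (norm_of V ` A)) \<rparr>"

definition cauchy_sequences :: "('v, 'z) cspace_scheme \<Rightarrow> (nat \<Rightarrow> 'v) cspace" where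
  "cauchy_sequences V = \<lparr>
     carr = {x. cauchy_in V x},
     zero_of = (\<lambda>_. zero_of V),
     add_of = (\<lambda>x y n. add_of V (x n) (y n)),
     scale_of = (\<lambda>c x n. scale_of V c (x n)),
     norm_of = (\<lambda>x. lim (\<lambda>n. norm_of V (x n))) \<rparr>"

definition completion :: "('v, 'z) calgebra_scheme \<Rightarrow> (nat \<Rightarrow> 'v) set calgebra" where
  "completion A = cspace.extend (separated_quotient (cauchy_sequences A))
     (calgebra.fields
       (\<lambda>X Y. \<Union>x\<in>X. \<Union>y\<in>Y. null_class (cauchy_sequences A) (\<lambda>n. mult_of A (x n) (y n))))"

definition to_completion :: "('v, 'z) calgebra_scheme \<Rightarrow> 'v \<Rightarrow> (nat \<Rightarrow> 'v) set" where
  "to_completion A a = null_class (cauchy_sequences A) (\<lambda>_. a)"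

text \<open>
  The extension is required to be a function on the carrier only, which makes it unique.
\<close>

definition continuous_extension ::
    "('v, 'y) calgebra_scheme \<Rightarrow> ('w, 'z) calgebra_scheme \<Rightarrow> ('v \<Rightarrow> 'w) \<Rightarrow>
     (nat \<Rightarrow> 'v) set \<Rightarrow> (nat \<Rightarrow> 'w) set" where
  "continuous_extension A B f = (THE T.
     T \<in> carr (completion A) \<rightarrow>\<^sub>E carr (completion B) \<and>
     continuous_between (completion A) (completion B) T \<and>
     (\<forall>a\<in>carr A. T (to_completion A a) = to_completion B (f a)))"

subsection \<open>Representations\<close>

definition representation ::
    "('b, 'y) calgebra_scheme \<Rightarrow> ('e, 'z) cspace_scheme \<Rightarrow> ('b \<Rightarrow> 'e \<Rightarrow> 'e) \<Rightarrow> bool" where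
  "representation B E \<pi> \<longleftrightarrow>
     (\<forall>a\<in>carr B. \<pi> a \<in> bounded_operators E \<and> operator_norm E (\<pi> a) \<le> norm_of B a) \<and>
     (\<forall>a\<in>carr B. \<forall>b\<in>carr B. \<forall>\<xi>\<in>carr E.
        \<pi> (add_of B a b) \<xi> = add_of E (\<pi> a \<xi>) (\<pi> b \<xi>) \<and>
        \<pi> (mult_of B a b) \<xi> = \<pi> a (\<pi> b \<xi>)) \<and>
     (\<forall>c. \<forall>a\<in>carr B. \<forall>\<xi>\<in>carr E. \<pi> (scale_of B c a) \<xi> = scale_of E c (\<pi> a \<xi>))"

definition nondegenerate ::
    "('b, 'y) calgebra_scheme \<Rightarrow> ('e, 'z) cspace_scheme \<Rightarrow> ('b \<Rightarrow> 'e \<Rightarrow> 'e) \<Rightarrow> bool" where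
  "nondegenerate B E \<pi> \<longleftrightarrow> (\<forall>\<xi>\<in>carr E. \<forall>e>0.
     \<exists>\<eta>\<in>lin_span E {\<pi> b \<zeta> |b \<zeta>. b \<in> carr B \<and> \<zeta> \<in> carr E}. norm_of E (diff_of E \<eta> \<xi>) < e)"

subsection \<open>\<open>L\<^sup>p\<close>-spaces\<close>

definition Lp_functions :: "real \<Rightarrow> 'n measure \<Rightarrow> ('n \<Rightarrow> complex) cspace" where
  "Lp_functions p M = \<lparr>
     carr = {f \<in> borel_measurable M. integrable M (\<lambda>x. norm (f x) powr p)},
     zero_of = (\<lambda>_. 0),
     add_of = (\<lambda>f g x. f x + g x),
     scale_of = (\<lambda>c f x. c * f x),
     norm_of = (\<lambda>f. (\<integral>x. norm (f x) powr p \<partial>M) powr (1 / p)) \<rparr>"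

definition Lp :: "real \<Rightarrow> 'n measure \<Rightarrow> ('n \<Rightarrow> complex) set cspace" where
  "Lp p M = separated_quotient (Lp_functions p M)"

text \<open>
  For counting measure every null class is a singleton, so no quotient is taken.
\<close>

definition little_lp :: "real \<Rightarrow> ('n \<Rightarrow> complex) cspace" where
  "little_lp p = Lp_functions p (count_space UNIV)"

text \<open>
  HOL cannot quantify over types inside a definition, so the underlying set of the measure space
  lies in a type \<open>'n\<close> that is passed as a parameter; the measure may be carried by any
  subset of \<open>'n\<close>.
\<close>

definition Lp_space :: "'n itself \<Rightarrow> real \<Rightarrow> 'e cspace \<Rightarrow> bool" where
  "Lp_space N p E \<longleftrightarrow> complex_banach_space E \<and>
     (\<exists>(M :: 'n measure) J. bij_betw J (carr E) (carr (Lp p M)) \<and> linear_isometry E (Lp p M) J)"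

section \<open>Actions, cocycles and the twisted crossed products\<close>

text \<open>
  The discrete group is a type of class \<^class>\<open>group_add\<close>: it is written additively but is not
  assumed to be commutative. So \<open>s + t\<close>, \<open>- s\<close> and \<open>0\<close> are product, inverse and unit.
\<close>

definition homeo_action :: "('g::group_add \<Rightarrow> 'x::topological_space \<Rightarrow> 'x) \<Rightarrow> bool" where
  "homeo_action \<phi> \<longleftrightarrow> (\<forall>s. homeomorphic_map euclidean euclidean (\<phi> s)) \<and>
     (\<forall>s t. \<phi> (s + t) = \<phi> s \<circ> \<phi> t)"

definition \<alpha> :: "('g::group_add \<Rightarrow> 'x \<Rightarrow> 'x) \<Rightarrow> 'g \<Rightarrow> ('x \<Rightarrow> 'c) \<Rightarrow> 'x \<Rightarrow> 'c" where
  "\<alpha> \<phi> s a = a \<circ> \<phi> (- s)"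

definition C0 :: "('x::topological_space \<Rightarrow> complex) set" where
  "C0 = {a. continuous_on UNIV a \<and> (\<forall>e>0. \<exists>K. compact K \<and> (\<forall>x. x \<notin> K \<longrightarrow> norm (a x) < e))}"

definition Cu :: "('x::topological_space \<Rightarrow> complex) set" where
  "Cu = {a. continuous_on UNIV a \<and> (\<forall>x. norm (a x) = 1)}"

definition Cc_nonneg :: "('x::topological_space \<Rightarrow> real) set" where
  "Cc_nonneg = {a. continuous_on UNIV a \<and> (\<forall>x. 0 \<le> a x) \<and> compact (closure {x. a x \<noteq> 0})}"

definition sup_norm :: "('x \<Rightarrow> complex) \<Rightarrow> real" where
  "sup_norm a = (SUP x. norm (a x))"

definition normalised_2cocycle ::
    "('g::group_add \<Rightarrow> 'x::topological_space \<Rightarrow> 'x) \<Rightarrow> ('g \<Rightarrow> 'g \<Rightarrow> 'x \<Rightarrow> complex) \<Rightarrow> bool" where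
  "normalised_2cocycle \<phi> u \<longleftrightarrow> (\<forall>s t. u s t \<in> Cu) \<and>
     (\<forall>r s t x. \<alpha> \<phi> r (u s t) x * u r (s + t) x = u r s x * u (r + s) t x) \<and>
     u 0 0 = (\<lambda>_. 1)"

text \<open>The twisted convolution algebra \<open>F(\<alpha>,u) = \<ell>\<^sup>1(G, C\<^sub>0(X))\<close>.\<close>

definition F ::
    "('g::group_add \<Rightarrow> 'x::topological_space \<Rightarrow> 'x) \<Rightarrow> ('g \<Rightarrow> 'g \<Rightarrow> 'x \<Rightarrow> complex) \<Rightarrow>
     ('g \<Rightarrow> 'x \<Rightarrow> complex) calgebra" where
  "F \<phi> u = \<lparr>
     carr = {b. (\<forall>g. b g \<in> C0) \<and> (\<lambda>g. sup_norm (b g)) summable_on UNIV},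
     zero_of = (\<lambda>_ _. 0),
     add_of = (\<lambda>a b g x. a g x + b g x),
     scale_of = (\<lambda>c b g x. c * b g x),
     norm_of = (\<lambda>b. \<Sum>\<^sub>\<infinity>g\<in>UNIV. sup_norm (b g)),
     mult_of = (\<lambda>a b r x. \<Sum>\<^sub>\<infinity>(s, t)\<in>{(s, t). s + t = r}. a s x * \<alpha> \<phi> s (b t) x * u s t x) \<rparr>"

text \<open>
  The supremum runs over the representations on \<open>L\<^sup>p\<close>-spaces of measures on \<open>'n\<close>. It is used
  with \<open>'n = 'x \<times> 'g + 'm\<close> for an arbitrary type \<open>'m\<close>: the left summand makes room for
  \<open>\<ell>\<^sup>p(X \<times> G)\<close>, and every measure space lives on some \<open>'m\<close>, hence on the right summand. A
  statement for all \<open>'m\<close> therefore concerns every non-degenerate representation on every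
  \<open>L\<^sup>p\<close>-space, and for large enough \<open>'m\<close> the supremum is the one over all of them.
\<close>

definition full_norm ::
    "'n itself \<Rightarrow> real \<Rightarrow> ('g::group_add \<Rightarrow> 'x::topological_space \<Rightarrow> 'x) \<Rightarrow>
     ('g \<Rightarrow> 'g \<Rightarrow> 'x \<Rightarrow> complex) \<Rightarrow> ('g \<Rightarrow> 'x \<Rightarrow> complex) \<Rightarrow> real" where
  "full_norm N p \<phi> u b = Sup {operator_norm E (\<psi> b) |(E :: ('n \<Rightarrow> complex) set cspace) \<psi>.
     Lp_space N p E \<and> representation (F \<phi> u) E \<psi> \<and> nondegenerate (F \<phi> u) E \<psi>}"

definition \<Lambda> ::
    "('g::group_add \<Rightarrow> 'x \<Rightarrow> 'x) \<Rightarrow> ('g \<Rightarrow> 'g \<Rightarrow> 'x \<Rightarrow> complex) \<Rightarrow> ('g \<Rightarrow> 'x \<Rightarrow> complex) \<Rightarrow>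
     ('x \<times> 'g \<Rightarrow> complex) \<Rightarrow> ('x \<times> 'g \<Rightarrow> complex)" where
  "\<Lambda> \<phi> u b \<xi> = (\<lambda>(x, t). \<Sum>\<^sub>\<infinity>s\<in>UNIV. b s x * u s (- s + t) x * \<xi> (\<phi> (- s) x, - s + t))"

definition reduced_norm ::
    "real \<Rightarrow> ('g::group_add \<Rightarrow> 'x \<Rightarrow> 'x) \<Rightarrow> ('g \<Rightarrow> 'g \<Rightarrow> 'x \<Rightarrow> complex) \<Rightarrow>
     ('g \<Rightarrow> 'x \<Rightarrow> complex) \<Rightarrow> real" where
  "reduced_norm p \<phi> u b = operator_norm (little_lp p) (\<Lambda> \<phi> u b)"

definition F_full where
  "F_full N p \<phi> u = (F \<phi> u)\<lparr>norm_of := full_norm N p \<phi> u\<rparr>"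

definition F_red where
  "F_red p \<phi> u = (F \<phi> u)\<lparr>norm_of := reduced_norm p \<phi> u\<rparr>"

definition Fp ::
    "'n itself \<Rightarrow> real \<Rightarrow> ('g::group_add \<Rightarrow> 'x::topological_space \<Rightarrow> 'x) \<Rightarrow>
     ('g \<Rightarrow> 'g \<Rightarrow> 'x \<Rightarrow> complex) \<Rightarrow> (nat \<Rightarrow> 'g \<Rightarrow> 'x \<Rightarrow> complex) set calgebra" where
  "Fp N p \<phi> u = completion (F_full N p \<phi> u)"

definition Fp_red ::
    "real \<Rightarrow> ('g::group_add \<Rightarrow> 'x::topological_space \<Rightarrow> 'x) \<Rightarrow>
     ('g \<Rightarrow> 'g \<Rightarrow> 'x \<Rightarrow> complex) \<Rightarrow> (nat \<Rightarrow> 'g \<Rightarrow> 'x \<Rightarrow> complex) set calgebra" where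
  "Fp_red p \<phi> u = completion (F_red p \<phi> u)"

definition regular_representation ::
    "'n itself \<Rightarrow> real \<Rightarrow> ('g::group_add \<Rightarrow> 'x::topological_space \<Rightarrow> 'x) \<Rightarrow>
     ('g \<Rightarrow> 'g \<Rightarrow> 'x \<Rightarrow> complex) \<Rightarrow>
     (nat \<Rightarrow> 'g \<Rightarrow> 'x \<Rightarrow> complex) set \<Rightarrow> (nat \<Rightarrow> 'g \<Rightarrow> 'x \<Rightarrow> complex) set" where
  "regular_representation N p \<phi> u =
     continuous_extension (F_full N p \<phi> u) (F_red p \<phi> u) (\<lambda>b. b)"

section \<open>Amenable actions\<close>

definition directed_set :: "'i set \<Rightarrow> ('i \<Rightarrow> 'i \<Rightarrow> bool) \<Rightarrow> bool" where
  "directed_set I le \<longleftrightarrow> I \<noteq> {} \<and> (\<forall>i\<in>I. le i i) \<and>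
     (\<forall>i\<in>I. \<forall>j\<in>I. \<forall>k\<in>I. le i j \<longrightarrow> le j k \<longrightarrow> le i k) \<and>
     (\<forall>i\<in>I. \<forall>j\<in>I. \<exists>k\<in>I. le i k \<and> le j k)"

definition tails :: "'i set \<Rightarrow> ('i \<Rightarrow> 'i \<Rightarrow> bool) \<Rightarrow> 'i filter" where
  "tails I le = (INF i\<in>I. principal {j \<in> I. le i j})"

text \<open>
  The index set of the net lies in the parameter type \<open>'i\<close>. The sums over \<open>G\<close> have only finitely
  many nonzero terms.
\<close>

definition amenable_action ::
    "'i itself \<Rightarrow> ('g::group_add \<Rightarrow> 'x::topological_space \<Rightarrow> 'x) \<Rightarrow> bool" where
  "amenable_action T \<phi> \<longleftrightarrow> (\<exists>(I :: 'i set) le (f :: 'i \<Rightarrow> 'g \<Rightarrow> 'x \<Rightarrow> real).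
     directed_set I le \<and>
     (\<forall>i\<in>I. finite {t. f i t \<noteq> (\<lambda>_. 0)} \<and> (\<forall>t. f i t \<in> Cc_nonneg)) \<and>
     (\<forall>K. compact K \<longrightarrow>
        uniform_limit K (\<lambda>i x. \<Sum>\<^sub>\<infinity>t\<in>UNIV. f i t x) (\<lambda>_. 1) (tails I le)) \<and>
     (\<forall>s K. compact K \<longrightarrow>
        uniform_limit K (\<lambda>i x. \<Sum>\<^sub>\<infinity>t\<in>UNIV. \<bar>\<alpha> \<phi> s (f i t) x - f i (s + t) x\<bar>) (\<lambda>_. 0)
          (tails I le)))"

end

theory Submission
  imports Defs
begin

text \<open>
  Let \<open>\<psi>\<close> be a non-degenerate representation on \<open>L\<^sup>p(\<mu>)\<close>. For real \<open>h \<in> C\<^sub>0(X)\<close> the operators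
  \<open>\<psi>(exp(ish))\<close> are contractive, so \<open>\<psi>(h)\<close> is hermitian for the semi-inner product
  \<open>\<integral> g f\<^sup>*\<close>, \<open>f\<^sup>* = cnj f |f|\<^bsup>p-2\<^esup>\<close>. For \<open>p = 2\<close> this is self-adjointness; for \<open>p \<noteq> 2\<close>, testing
  with \<open>f + z g\<close> for disjoint \<open>f\<close>, \<open>g\<close> and using that \<open>(z g)\<^sup>*\<close> is homogeneous of degree \<open>p - 1 \<noteq> 1\<close>
  in \<open>|z|\<close> shows that \<open>\<psi>(h)\<close> does not enlarge supports. In both cases columns and rows of functions
  \<open>k\<^sub>t \<ge> 0\<close> with \<open>\<Sum> k\<^sub>t\<^sup>p \<le> 1\<close>, respectively \<open>\<Sum> k\<^sub>t\<^sup>q \<le> 1\<close>, act contractively between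
  \<open>L\<^sup>p(\<mu>)\<close> and \<open>\<ell>\<^sup>p(L\<^sup>p(\<mu>))\<close>.

  Given \<open>b \<in> F(\<alpha>,u)\<close>, choose normalised functions \<open>g\<^sub>t\<close> from amenability and a partition of unity
  \<open>h\<^sub>y\<close> on \<open>X\<close> subordinate to points \<open>y\<close>. The element
  \<open>\<Sum>\<^sub>y \<Sum>\<^sub>t\<^sub>,\<^sub>r a\<^sub>y(t,r) d\<^sub>y\<^sub>,\<^sub>t c\<^sub>y\<^sub>,\<^sub>r\<close> with
  \<open>d\<^sub>y\<^sub>,\<^sub>t = g\<^sub>t\<^bsup>1/q\<^esup> \<delta>\<^sub>t h\<^sub>y\<^bsup>1/q\<^esup>\<close>, \<open>c\<^sub>y\<^sub>,\<^sub>r = h\<^sub>y\<^bsup>1/p\<^esup> \<delta>\<^sub>r\<^sup>-\<^sup>1 g\<^sub>r\<^bsup>1/p\<^esup>\<close> is \<open>\<ell>\<^sup>1\<close>-close to \<open>b\<close>,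
  where \<open>a\<^sub>y\<close> is the compression of \<open>\<Lambda>\<^sub>p(b)\<close> to the orbit points \<open>(\<phi>\<^sub>t(y), t)\<close>. Under \<open>\<psi>\<close> it
  factors as a row contraction, the matrices \<open>a\<^sub>y\<close> and a column contraction, so its norm is at most
  \<open>\<parallel>\<Lambda>\<^sub>p(b)\<parallel>\<close>. Thus the full and reduced norms agree, and the regular representation is
  the identity.
\<close>

section \<open>Seminormed spaces and completions\<close>

text \<open>An abstract representation on an L^p-space comes with no covariant pair and no spatial
  structure: only contractivity on \<open>F\<close> is given. For C_0(X) this is exploited through
  the functions exp(i h) alone, and it yields an inner-product argument for p = 2 but locality for p
  \<noteq> 2; hence both contraction lemmas are proved twice.

  The exponents 1/q on the left and 1/p on the right are forced: a row is contractive when the q-th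
  powers of its entries sum to at most 1, a column when the p-th powers do.

  Amenability by itself would compare \<open>b\<close> with a matrix whose entries are functions on
  X. The partition of unity freezes them into scalar matrices, and a scalar matrix acts on l^p(L^p)
  with no larger norm than on l^p, by integrating a pointwise inequality.

  The units delta_t need not lie in \<open>F\<close>, so cutoffs equal to 1 on the supports of the
  g_t stand in for them. The converse inequality holds because \<Lambda> itself is one of the
  representations over which the full norm is a supremum.\<close>

text \<open>Functions before passing to classes, Cauchy sequences, and \<open>F\<close> with the
  reduced norm all enter as seminormed spaces; \<open>separated_quotient\<close> makes normed spaces
  of them.\<close>

locale complex_seminormed_space =
  fixes V :: "('v, 'z) cspace_scheme"
  assumes zero_closed: "zero_of V \<in> carr V"
    and add_closed: "\<lbrakk>x \<in> carr V; y \<in> carr V\<rbrakk> \<Longrightarrow> add_of V x y \<in> carr V"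
    and scale_closed: "x \<in> carr V \<Longrightarrow> scale_of V c x \<in> carr V"
    and add_assoc: "\<lbrakk>x \<in> carr V; y \<in> carr V; z \<in> carr V\<rbrakk> \<Longrightarrow>
          add_of V (add_of V x y) z = add_of V x (add_of V y z)"
    and add_comm: "\<lbrakk>x \<in> carr V; y \<in> carr V\<rbrakk> \<Longrightarrow> add_of V x y = add_of V y x"
    and add_zero: "x \<in> carr V \<Longrightarrow> add_of V x (zero_of V) = x"
    and diff_self: "x \<in> carr V \<Longrightarrow> diff_of V x x = zero_of V"
    and scale_add: "\<lbrakk>x \<in> carr V; y \<in> carr V\<rbrakk> \<Longrightarrow>
          scale_of V c (add_of V x y) = add_of V (scale_of V c x) (scale_of V c y)"
    and add_scale: "x \<in> carr V \<Longrightarrow>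
          scale_of V (c + d) x = add_of V (scale_of V c x) (scale_of V d x)"
    and scale_scale: "x \<in> carr V \<Longrightarrow> scale_of V c (scale_of V d x) = scale_of V (c * d) x"
    and scale_one: "x \<in> carr V \<Longrightarrow> scale_of V 1 x = x"
    and norm_triangle: "\<lbrakk>x \<in> carr V; y \<in> carr V\<rbrakk> \<Longrightarrow>
          norm_of V (add_of V x y) \<le> norm_of V x + norm_of V y"
    and norm_scale: "x \<in> carr V \<Longrightarrow> norm_of V (scale_of V c x) = norm c * norm_of V x"

sublocale complex_normed_space \<subseteq> complex_seminormed_space
  by (rule complex_seminormed_space.intro)
    (fact zero_closed add_closed scale_closed add_assoc add_comm add_zero diff_self
      scale_add add_scale scale_scale scale_one norm_triangle norm_scale)+

context complex_seminormed_space
begin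

lemma add_left_comm: "\<lbrakk>x \<in> carr V; y \<in> carr V; z \<in> carr V\<rbrakk> \<Longrightarrow>
    add_of V x (add_of V y z) = add_of V y (add_of V x z)"
  by (metis add_assoc add_comm)

lemma diff_closed: "\<lbrakk>x \<in> carr V; y \<in> carr V\<rbrakk> \<Longrightarrow> diff_of V x y \<in> carr V"
  by (simp add: diff_of_def add_closed scale_closed)

lemma scale_zero: "x \<in> carr V \<Longrightarrow> scale_of V 0 x = zero_of V"
  using add_scale[of x 1 "-1"] diff_self[of x] by (simp add: scale_one diff_of_def)

lemma norm_zero: "norm_of V (zero_of V) = 0"
  using norm_scale[OF zero_closed, of 0] by (simp add: scale_zero zero_closed)

lemma norm_nonneg: assumes "x \<in> carr V" shows "0 \<le> norm_of V x"
proof -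
  have "norm_of V (diff_of V x x) \<le> norm_of V x + norm_of V (scale_of V (-1) x)"
    unfolding diff_of_def by (intro norm_triangle scale_closed assms)
  then show ?thesis by (simp add: diff_self norm_zero norm_scale assms)
qed

lemma zero_add: "x \<in> carr V \<Longrightarrow> add_of V (zero_of V) x = x"
  by (simp add: add_comm[OF zero_closed] add_zero)

lemma scale_diff: "\<lbrakk>x \<in> carr V; y \<in> carr V\<rbrakk> \<Longrightarrow>
    diff_of V (scale_of V c x) (scale_of V c y) = scale_of V c (diff_of V x y)"
  by (simp add: diff_of_def scale_add scale_closed scale_scale)

lemma diff_add_add:
  assumes "x \<in> carr V" "y \<in> carr V" "x' \<in> carr V" "y' \<in> carr V"
  shows "diff_of V (add_of V x y) (add_of V x' y') = add_of V (diff_of V x x') (diff_of V y y')"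
  using assms by (simp add: diff_of_def scale_add scale_closed add_closed add_assoc add_left_comm)

lemma add_diff_cancel:
  assumes x: "x \<in> carr V" and y: "y \<in> carr V" and z: "z \<in> carr V"
  shows "add_of V (diff_of V x y) (diff_of V y z) = diff_of V x z"
proof -
  have "add_of V (diff_of V x y) (diff_of V y z) = diff_of V (add_of V x y) (add_of V y z)"
    using diff_add_add[OF x y y z] by simp
  also have "\<dots> = diff_of V (add_of V y x) (add_of V y z)"
    by (simp add: add_comm x y)
  also have "\<dots> = add_of V (diff_of V y y) (diff_of V x z)"
    by (rule diff_add_add[OF y x y z])
  also have "\<dots> = diff_of V x z"
    by (simp add: diff_self y x z zero_add diff_closed)
  finally show ?thesis .
qed

lemma diff_zero: "x \<in> carr V \<Longrightarrow> diff_of V x (zero_of V) = x"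
  using add_diff_cancel[OF _ zero_closed zero_closed, of x]
  by (metis add_zero diff_of_def diff_self zero_add zero_closed scale_closed)

lemma diff_add_cancel: "\<lbrakk>x \<in> carr V; y \<in> carr V\<rbrakk> \<Longrightarrow> add_of V (diff_of V x y) y = x"
  using add_diff_cancel[OF _ _ zero_closed, of x y] by (simp add: diff_zero)

lemma norm_diff_comm:
  assumes "x \<in> carr V" "y \<in> carr V"
  shows "norm_of V (diff_of V x y) = norm_of V (diff_of V y x)"
proof -
  have "diff_of V y x = scale_of V (-1) (diff_of V x y)"
    using assms by (simp add: diff_of_def scale_add scale_closed scale_scale scale_one add_comm)
  then show ?thesis by (simp add: norm_scale diff_closed assms)
qed

lemma norm_diff_triangle:
  assumes "x \<in> carr V" "y \<in> carr V" "z \<in> carr V"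
  shows "norm_of V (diff_of V x z) \<le> norm_of V (diff_of V x y) + norm_of V (diff_of V y z)"
  using norm_triangle[of "diff_of V x y" "diff_of V y z"] assms
  by (simp add: add_diff_cancel diff_closed)

lemma abs_norm_diff_le:
  assumes "x \<in> carr V" "y \<in> carr V"
  shows "\<bar>norm_of V x - norm_of V y\<bar> \<le> norm_of V (diff_of V x y)"
proof -
  have "norm_of V a \<le> norm_of V (diff_of V a b) + norm_of V b"
    if "a \<in> carr V" "b \<in> carr V" for a b
    using norm_triangle[of "diff_of V a b" b] that by (simp add: diff_add_cancel diff_closed)
  from this[of x y] this[of y x] show ?thesis
    using assms by (simp add: norm_diff_comm[of y x])
qed

lemma null_class_refl: "x \<in> carr V \<Longrightarrow> x \<in> null_class V x"
  by (simp add: null_class_def diff_self norm_zero)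

lemma null_class_subset: "null_class V x \<subseteq> carr V"
  by (auto simp: null_class_def)

lemma null_class_eq_iff:
  assumes "x \<in> carr V" "y \<in> carr V"
  shows "null_class V x = null_class V y \<longleftrightarrow> norm_of V (diff_of V x y) = 0"
proof
  assume "null_class V x = null_class V y"
  then have "x \<in> null_class V y" using null_class_refl[OF assms(1)] by simp
  then show "norm_of V (diff_of V x y) = 0" by (simp add: null_class_def)
next
  assume d: "norm_of V (diff_of V x y) = 0"
  have "norm_of V (diff_of V z y) = 0 \<longleftrightarrow> norm_of V (diff_of V z x) = 0" if "z \<in> carr V" for z
    using norm_diff_triangle[of z x y] norm_diff_triangle[of z y x] norm_nonneg[of "diff_of V z x"]
      norm_nonneg[of "diff_of V z y"] norm_diff_comm[of x y] d assms that
    by (auto simp: diff_closed)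
  then show "null_class V x = null_class V y" by (auto simp: null_class_def)
qed

lemma norm_eq_of_null_diff:
  assumes "x \<in> carr V" "y \<in> carr V" "norm_of V (diff_of V x y) = 0"
  shows "norm_of V x = norm_of V y"
  using abs_norm_diff_le[of x y] assms by simp

lemma separated_quotient_add:
  assumes x: "x \<in> carr V" and y: "y \<in> carr V"
  shows "add_of (separated_quotient V) (null_class V x) (null_class V y) = null_class V (add_of V x y)"
proof -
  have "null_class V (add_of V a b) = null_class V (add_of V x y)"
    if "a \<in> null_class V x" "b \<in> null_class V y" for a b
  proof -
    have ab: "a \<in> carr V" "b \<in> carr V" "norm_of V (diff_of V a x) = 0" "norm_of V (diff_of V b y) = 0"
      using that by (auto simp: null_class_def)
    have "norm_of V (add_of V (diff_of V a x) (diff_of V b y)) \<le> 0"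
      using norm_triangle[of "diff_of V a x" "diff_of V b y"] ab x y by (simp add: diff_closed)
    then have "norm_of V (diff_of V (add_of V a b) (add_of V x y)) = 0"
      using norm_nonneg[of "add_of V (diff_of V a x) (diff_of V b y)"] ab x y
      by (simp add: diff_add_add diff_closed add_closed)
    then show ?thesis using ab x y by (simp add: null_class_eq_iff add_closed)
  qed
  then have "(\<Union>a\<in>null_class V x. \<Union>b\<in>null_class V y. null_class V (add_of V a b))
      = null_class V (add_of V x y)"
    using null_class_refl[OF x] null_class_refl[OF y] by blast
  then show ?thesis by (simp add: separated_quotient_def)
qed

lemma separated_quotient_scale:
  assumes x: "x \<in> carr V"
  shows "scale_of (separated_quotient V) c (null_class V x) = null_class V (scale_of V c x)"
proof -
  have "null_class V (scale_of V c a) = null_class V (scale_of V c x)" if "a \<in> null_class V x" for a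
  proof -
    have "a \<in> carr V" "norm_of V (diff_of V a x) = 0" using that by (auto simp: null_class_def)
    then show ?thesis using x by (simp add: null_class_eq_iff scale_closed scale_diff norm_scale diff_closed)
  qed
  then have "(\<Union>a\<in>null_class V x. null_class V (scale_of V c a)) = null_class V (scale_of V c x)"
    using null_class_refl[OF x] by blast
  then show ?thesis by (simp add: separated_quotient_def)
qed

lemma separated_quotient_norm:
  assumes x: "x \<in> carr V"
  shows "norm_of (separated_quotient V) (null_class V x) = norm_of V x"
proof -
  have "norm_of V ` null_class V x = {norm_of V x}"
  proof -
    have "norm_of V a = norm_of V x" if "a \<in> null_class V x" for a
      using that x by (intro norm_eq_of_null_diff) (auto simp: null_class_def)
    then show ?thesis using null_class_refl[OF x] by blast
  qed
  then show ?thesis by (simp add: separated_quotient_def)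
qed

lemma separated_quotient_carr: "carr (separated_quotient V) = null_class V ` carr V"
  and separated_quotient_zero: "zero_of (separated_quotient V) = null_class V (zero_of V)"
  by (simp_all add: separated_quotient_def)

lemma separated_quotient_diff:
  assumes "x \<in> carr V" "y \<in> carr V"
  shows "diff_of (separated_quotient V) (null_class V x) (null_class V y) = null_class V (diff_of V x y)"
  using assms
  by (simp add: diff_of_def[of "separated_quotient V"] separated_quotient_scale separated_quotient_add
      scale_closed) (simp add: diff_of_def)

lemmas separated_quotient_simps = separated_quotient_carr separated_quotient_zero
  separated_quotient_add separated_quotient_scale separated_quotient_norm separated_quotient_diff

lemma separated_quotient_normed: "complex_normed_space (separated_quotient V)"
proof
  note [simp] = separated_quotient_simps zero_closed add_closed scale_closed diff_closed
  let ?Q = "separated_quotient V"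
  show "zero_of ?Q \<in> carr ?Q" by simp
  fix A assume "A \<in> carr ?Q"
  then obtain x where x[simp]: "x \<in> carr V" and A: "A = null_class V x" by auto
  show "scale_of ?Q c A \<in> carr ?Q" for c by (simp add: A)
  show "add_of ?Q A (zero_of ?Q) = A" by (simp add: A add_zero)
  show "diff_of ?Q A A = zero_of ?Q" by (simp add: A diff_self)
  show "scale_of ?Q (c + d) A = add_of ?Q (scale_of ?Q c A) (scale_of ?Q d A)" for c d
    by (simp add: A add_scale)
  show "scale_of ?Q c (scale_of ?Q d A) = scale_of ?Q (c * d) A" for c d
    by (simp add: A scale_scale)
  show "scale_of ?Q 1 A = A" by (simp add: A scale_one)
  show "norm_of ?Q A = 0 \<longleftrightarrow> A = zero_of ?Q"
    by (simp add: A null_class_eq_iff diff_zero)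
  show "norm_of ?Q (scale_of ?Q c A) = norm c * norm_of ?Q A" for c
    by (simp add: A norm_scale)
  fix B assume "B \<in> carr ?Q"
  then obtain y where y[simp]: "y \<in> carr V" and B: "B = null_class V y" by auto
  show "add_of ?Q A B \<in> carr ?Q" by (simp add: A B)
  show "add_of ?Q A B = add_of ?Q B A" by (simp add: A B add_comm)
  show "scale_of ?Q c (add_of ?Q A B) = add_of ?Q (scale_of ?Q c A) (scale_of ?Q c B)" for c
    by (simp add: A B scale_add)
  show "norm_of ?Q (add_of ?Q A B) \<le> norm_of ?Q A + norm_of ?Q B"
    by (simp add: A B norm_triangle)
  fix C assume "C \<in> carr ?Q"
  then obtain z where z[simp]: "z \<in> carr V" and C: "C = null_class V z" by auto
  show "add_of ?Q (add_of ?Q A B) C = add_of ?Q A (add_of ?Q B C)"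
    by (simp add: A B C add_assoc)
qed

lemma separated_quotient_banach:
  assumes complete: "\<And>x. cauchy_in V x \<Longrightarrow>
    \<exists>l\<in>carr V. (\<lambda>n. norm_of V (diff_of V (x n) l)) \<longlonglongrightarrow> 0"
  shows "complex_banach_space (separated_quotient V)"
proof -
  interpret Q: complex_normed_space "separated_quotient V" by (rule separated_quotient_normed)
  show ?thesis
  proof
    fix X assume X: "cauchy_in (separated_quotient V) X"
    then have "\<forall>n. \<exists>x. x \<in> carr V \<and> X n = null_class V x"
      unfolding cauchy_in_def separated_quotient_carr by blast
    then obtain x where x: "\<And>n. x n \<in> carr V" and Xx: "\<And>n. X n = null_class V (x n)" by metis
    have "cauchy_in V x"
      using X by (simp add: cauchy_in_def Xx x separated_quotient_simps diff_closed)
    then obtain l where l: "l \<in> carr V" "(\<lambda>n. norm_of V (diff_of V (x n) l)) \<longlonglongrightarrow> 0"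
      using complete by blast
    then show "\<exists>L\<in>carr (separated_quotient V).
        (\<lambda>n. norm_of (separated_quotient V) (diff_of (separated_quotient V) (X n) L)) \<longlonglongrightarrow> 0"
      by (intro bexI[of _ "null_class V l"]) (simp_all add: Xx x separated_quotient_simps diff_closed)
  qed
qed

lemma norm_tendsto_cauchy_in:
  assumes "cauchy_in V x"
  shows "(\<lambda>n. norm_of V (x n)) \<longlonglongrightarrow> lim (\<lambda>n. norm_of V (x n))"
proof -
  have "Cauchy (\<lambda>n. norm_of V (x n))"
  proof (rule CauchyI)
    fix e :: real assume "0 < e"
    then obtain N where "\<forall>m\<ge>N. \<forall>n\<ge>N. norm_of V (diff_of V (x m) (x n)) < e"
      using assms unfolding cauchy_in_def by blast
    moreover have "\<bar>norm_of V (x m) - norm_of V (x n)\<bar> \<le> norm_of V (diff_of V (x m) (x n))" for m n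
      using assms by (intro abs_norm_diff_le) (auto simp: cauchy_in_def)
    ultimately show "\<exists>N. \<forall>m\<ge>N. \<forall>n\<ge>N. norm (norm_of V (x m) - norm_of V (x n)) < e"
      by (metis le_less_trans real_norm_def)
  qed
  then show ?thesis using Cauchy_convergent convergent_LIMSEQ_iff by blast
qed

lemma cauchy_in_const: "a \<in> carr V \<Longrightarrow> cauchy_in V (\<lambda>_. a)"
  by (simp add: cauchy_in_def diff_self norm_zero)

lemma cauchy_in_add:
  assumes "cauchy_in V x" "cauchy_in V y"
  shows "cauchy_in V (\<lambda>n. add_of V (x n) (y n))"
proof -
  have xy: "x n \<in> carr V" "y n \<in> carr V" for n using assms by (auto simp: cauchy_in_def)
  show ?thesis unfolding cauchy_in_def
  proof (intro conjI allI impI)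
    fix n show "add_of V (x n) (y n) \<in> carr V" by (simp add: xy add_closed)
  next
    fix e :: real assume "0 < e"
    then have "0 < e / 2" by simp
    obtain N where N: "\<forall>m\<ge>N. \<forall>n\<ge>N. norm_of V (diff_of V (x m) (x n)) < e / 2"
      using assms(1) \<open>0 < e / 2\<close> unfolding cauchy_in_def by blast
    obtain N' where N': "\<forall>m\<ge>N'. \<forall>n\<ge>N'. norm_of V (diff_of V (y m) (y n)) < e / 2"
      using assms(2) \<open>0 < e / 2\<close> unfolding cauchy_in_def by blast
    have "norm_of V (diff_of V (add_of V (x m) (y m)) (add_of V (x n) (y n))) < e"
      if "m \<ge> max N N'" "n \<ge> max N N'" for m n
    proof -
      have "norm_of V (diff_of V (x m) (x n)) < e / 2" "norm_of V (diff_of V (y m) (y n)) < e / 2"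
        using N N' that by auto
      then show ?thesis
        using norm_triangle[of "diff_of V (x m) (x n)" "diff_of V (y m) (y n)"]
        by (simp add: diff_add_add xy diff_closed)
    qed
    then show "\<exists>N. \<forall>m\<ge>N. \<forall>n\<ge>N.
        norm_of V (diff_of V (add_of V (x m) (y m)) (add_of V (x n) (y n))) < e" by blast
  qed
qed

lemma cauchy_in_scale:
  assumes "cauchy_in V x"
  shows "cauchy_in V (\<lambda>n. scale_of V c (x n))"
proof -
  have x: "x n \<in> carr V" for n using assms by (auto simp: cauchy_in_def)
  show ?thesis unfolding cauchy_in_def
  proof (intro conjI allI impI)
    fix n show "scale_of V c (x n) \<in> carr V" by (simp add: x scale_closed)
  next
    fix e :: real assume "0 < e"
    then have "0 < e / (norm c + 1)" by (simp add: add_nonneg_pos)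
    then obtain N where N: "\<forall>m\<ge>N. \<forall>n\<ge>N. norm_of V (diff_of V (x m) (x n)) < e / (norm c + 1)"
      using assms unfolding cauchy_in_def by blast
    have "norm_of V (diff_of V (scale_of V c (x m)) (scale_of V c (x n))) < e"
      if "m \<ge> N" "n \<ge> N" for m n
    proof -
      have "norm c * norm_of V (diff_of V (x m) (x n)) \<le> (norm c + 1) * norm_of V (diff_of V (x m) (x n))"
        by (intro mult_right_mono norm_nonneg diff_closed x) simp
      also have "\<dots> < e"
        using N that by (simp add: pos_less_divide_eq add_nonneg_pos mult.commute)
      finally show ?thesis by (simp add: scale_diff x norm_scale diff_closed)
    qed
    then show "\<exists>N. \<forall>m\<ge>N. \<forall>n\<ge>N.
        norm_of V (diff_of V (scale_of V c (x m)) (scale_of V c (x n))) < e" by blast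
  qed
qed

lemma cauchy_sequences_seminormed: "complex_seminormed_space (cauchy_sequences V)"
proof
  let ?C = "cauchy_sequences V"
  note [simp] = cauchy_sequences_def
  show "zero_of ?C \<in> carr ?C" by (simp add: cauchy_in_const zero_closed)
  fix x assume "x \<in> carr ?C"
  then have x: "cauchy_in V x" and xc[simp]: "\<And>n. x n \<in> carr V" by (auto simp: cauchy_in_def)
  show "scale_of ?C c x \<in> carr ?C" for c by (simp add: cauchy_in_scale x)
  show "add_of ?C x (zero_of ?C) = x" by (simp add: add_zero)
  show "diff_of ?C x x = zero_of ?C"
    using diff_self by (simp add: diff_of_def)
  show "scale_of ?C (c + d) x = add_of ?C (scale_of ?C c x) (scale_of ?C d x)" for c d
    by (simp add: add_scale)
  show "scale_of ?C c (scale_of ?C d x) = scale_of ?C (c * d) x" for c d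
    by (simp add: scale_scale)
  show "scale_of ?C 1 x = x" by (simp add: scale_one)
  show "norm_of ?C (scale_of ?C c x) = norm c * norm_of ?C x" for c
    using tendsto_mult[OF tendsto_const[of "norm c"] norm_tendsto_cauchy_in[OF x]]
    by (simp add: norm_scale limI)
  fix y assume "y \<in> carr ?C"
  then have y: "cauchy_in V y" and yc[simp]: "\<And>n. y n \<in> carr V" by (auto simp: cauchy_in_def)
  show "add_of ?C x y \<in> carr ?C" by (simp add: cauchy_in_add x y)
  show "add_of ?C x y = add_of ?C y x" using add_comm by auto
  show "scale_of ?C c (add_of ?C x y) = add_of ?C (scale_of ?C c x) (scale_of ?C c y)" for c
    by (simp add: scale_add)
  have "lim (\<lambda>n. norm_of V (add_of V (x n) (y n)))
      \<le> lim (\<lambda>n. norm_of V (x n)) + lim (\<lambda>n. norm_of V (y n))"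
    by (rule LIMSEQ_le[OF norm_tendsto_cauchy_in[OF cauchy_in_add[OF x y]]
          tendsto_add[OF norm_tendsto_cauchy_in[OF x] norm_tendsto_cauchy_in[OF y]]])
       (auto intro!: norm_triangle)
  then show "norm_of ?C (add_of ?C x y) \<le> norm_of ?C x + norm_of ?C y" by simp
  fix z assume "z \<in> carr ?C"
  then have zc: "\<And>n. z n \<in> carr V" by (auto simp: cauchy_in_def)
  show "add_of ?C (add_of ?C x y) z = add_of ?C x (add_of ?C y z)"
    by (simp add: add_assoc zc)
qed

end

lemma completion_simps:
  "carr (completion A) = carr (separated_quotient (cauchy_sequences A))"
  "zero_of (completion A) = zero_of (separated_quotient (cauchy_sequences A))"
  "add_of (completion A) = add_of (separated_quotient (cauchy_sequences A))"
  "scale_of (completion A) = scale_of (separated_quotient (cauchy_sequences A))"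
  "norm_of (completion A) = norm_of (separated_quotient (cauchy_sequences A))"
  "diff_of (completion A) = diff_of (separated_quotient (cauchy_sequences A))"
  by (simp_all add: completion_def cspace.extend_def calgebra.fields_def diff_of_def fun_eq_iff)

text \<open>Seminorms that agree on \<open>carr A\<close> have the same Cauchy sequences and null
  classes, so the two completions coincide and the restricted identity is isometric. It is the
  function selected by \<open>THE\<close> because classes of constant sequences are dense: a
  continuous map fixing them is the identity.\<close>

lemma linear_isometry_continuous_extension_id:
  fixes A :: "'v calgebra" and n1 n2 :: "'v \<Rightarrow> real"
  defines "V \<equiv> A\<lparr>norm_of := n1\<rparr>" and "W \<equiv> A\<lparr>norm_of := n2\<rparr>"
  assumes W: "complex_seminormed_space W"
    and norm_eq: "\<And>x. x \<in> carr A \<Longrightarrow> n1 x = n2 x"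
  shows "linear_isometry (completion V) (completion W) (continuous_extension V W (\<lambda>b. b))"
proof -
  interpret W: complex_seminormed_space W by (rule W)
  let ?CV = "cauchy_sequences V" and ?CW = "cauchy_sequences W"
  let ?QV = "separated_quotient ?CV" and ?QW = "separated_quotient ?CW"
  interpret CW: complex_seminormed_space ?CW by (rule W.cauchy_sequences_seminormed)
  interpret QW: complex_normed_space ?QW by (rule CW.separated_quotient_normed)
  have VW: "carr V = carr W" "add_of V = add_of W" "scale_of V = scale_of W" "zero_of V = zero_of W"
      "diff_of V = diff_of W"
    by (simp_all add: V_def W_def diff_of_def fun_eq_iff)
  have nVW: "norm_of V x = norm_of W x" if "x \<in> carr W" for x
    using that norm_eq by (simp add: V_def W_def)
  have cauchy: "cauchy_in V x = cauchy_in W x" for x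
    unfolding cauchy_in_def VW using nVW W.diff_closed by (metis (no_types, lifting))
  have CVW: "carr ?CV = carr ?CW" "add_of ?CV = add_of ?CW" "scale_of ?CV = scale_of ?CW"
      "zero_of ?CV = zero_of ?CW" "diff_of ?CV = diff_of ?CW"
    by (auto simp: cauchy_sequences_def VW cauchy diff_of_def fun_eq_iff)
  have carr_CW: "x n \<in> carr W" if "x \<in> carr ?CW" for x n
    using that by (simp add: cauchy_sequences_def cauchy_in_def)
  have nC: "norm_of ?CV x = norm_of ?CW x" if "x \<in> carr ?CW" for x
    using carr_CW[OF that] by (simp add: cauchy_sequences_def nVW)
  have nc: "null_class ?CV x = null_class ?CW x" if "x \<in> carr ?CW" for x
    unfolding null_class_def CVW using that by (auto simp: nC CW.diff_closed)
  have carr_Q: "carr ?QV = carr ?QW"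
    by (simp add: separated_quotient_def CVW nc)
  have sub: "X \<subseteq> carr ?CW" if "X \<in> carr ?QW" for X
    using that CW.null_class_subset by (auto simp: separated_quotient_def)
  have norm_Q: "norm_of ?QV X = norm_of ?QW X" if "X \<in> carr ?QW" for X
  proof -
    have "norm_of ?CV ` X = norm_of ?CW ` X" using sub[OF that] nC by (intro image_cong) auto
    then show ?thesis by (simp add: separated_quotient_def)
  qed
  have add_Q: "add_of ?QV X Y = add_of ?QW X Y" if "X \<in> carr ?QW" "Y \<in> carr ?QW" for X Y
  proof -
    have "null_class ?CV (add_of ?CW x y) = null_class ?CW (add_of ?CW x y)" if "x \<in> X" "y \<in> Y" for x y
      using that sub[OF \<open>X \<in> carr ?QW\<close>] sub[OF \<open>Y \<in> carr ?QW\<close>]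
      by (intro nc CW.add_closed) auto
    then show ?thesis by (auto simp: separated_quotient_def CVW)
  qed
  have scale_Q: "scale_of ?QV c X = scale_of ?QW c X" if "X \<in> carr ?QW" for X c
  proof -
    have "null_class ?CV (scale_of ?CW c x) = null_class ?CW (scale_of ?CW c x)" if "x \<in> X" for x
      using that sub[OF \<open>X \<in> carr ?QW\<close>] by (intro nc CW.scale_closed) auto
    then show ?thesis by (auto simp: separated_quotient_def CVW)
  qed
  have diff_Q: "diff_of ?QV X Y = diff_of ?QW X Y" if "X \<in> carr ?QW" "Y \<in> carr ?QW" for X Y
    using that by (simp add: diff_of_def scale_Q add_Q QW.scale_closed)
  have tc: "to_completion V a = null_class ?CW (\<lambda>_. a)" "to_completion W a = null_class ?CW (\<lambda>_. a)"
      "(\<lambda>_. a) \<in> carr ?CW" if "a \<in> carr W" for a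
    using nc[of "\<lambda>_. a"] W.cauchy_in_const[OF that]
    by (simp_all add: to_completion_def) (simp_all add: cauchy_sequences_def)
  define T where "T = restrict (\<lambda>X. X) (carr ?QW)"
  have ext: "continuous_extension V W (\<lambda>b. b) = T"
    unfolding continuous_extension_def completion_simps carr_Q
  proof (rule the_equality)
    show "T \<in> carr ?QW \<rightarrow>\<^sub>E carr ?QW \<and> continuous_between (completion V) (completion W) T \<and>
        (\<forall>a\<in>carr V. T (to_completion V a) = to_completion W a)"
    proof (intro conjI ballI)
      show "T \<in> carr ?QW \<rightarrow>\<^sub>E carr ?QW" by (auto simp: T_def)
      show "continuous_between (completion V) (completion W) T"
        unfolding continuous_between_def completion_simps carr_Q
      proof (intro ballI allI impI)
        fix X e assume X: "X \<in> carr ?QW" and "(0::real) < e"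
        have "norm_of ?QW (diff_of ?QW (T Y) (T X)) < e"
          if "Y \<in> carr ?QW" "norm_of ?QV (diff_of ?QV Y X) < e" for Y
          using that X by (simp add: T_def diff_Q norm_Q QW.diff_closed)
        then show "\<exists>d>0. \<forall>Y\<in>carr ?QW. norm_of ?QV (diff_of ?QV Y X) < d \<longrightarrow>
            norm_of ?QW (diff_of ?QW (T Y) (T X)) < e"
          using \<open>0 < e\<close> by blast
      qed
      fix a assume "a \<in> carr V"
      then show "T (to_completion V a) = to_completion W a"
        using tc[of a] by (simp add: T_def VW separated_quotient_def)
    qed
  next
    fix S assume S: "S \<in> carr ?QW \<rightarrow>\<^sub>E carr ?QW \<and> continuous_between (completion V) (completion W) S \<and>
        (\<forall>a\<in>carr V. S (to_completion V a) = to_completion W a)"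
    show "S = T"
    proof
      fix X
      show "S X = T X"
      proof (cases "X \<in> carr ?QW")
        case False
        then show ?thesis using S by (auto simp: T_def PiE_def extensional_def)
      next
        case X: True
        then obtain x where x: "x \<in> carr ?CW" and Xx: "X = null_class ?CW x"
          by (auto simp: separated_quotient_def)
        have SX: "S X \<in> carr ?QW" using S X by auto
        \<comment> \<open>The distance from \<open>S X\<close> to \<open>X\<close> is split at the
          class \<open>Y\<close> of a constant sequence, with value taken from a representative of
          \<open>X\<close>; \<open>S\<close> fixes \<open>Y\<close> and is continuous at
          \<open>X\<close>.\<close>
        define D where "D = norm_of ?QW (diff_of ?QW (S X) X)"
        have "D \<le> e" if "0 < e" for e
        proof -
          have e2: "0 < e / 2" using that by simp
          have "\<exists>d>0. \<forall>Y\<in>carr ?QW. norm_of ?QV (diff_of ?QV Y X) < d \<longrightarrow>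
              norm_of ?QW (diff_of ?QW (S Y) (S X)) < e / 2"
            using S X e2 unfolding continuous_between_def completion_simps carr_Q by blast
          then obtain d where d: "d > 0" and dS: "\<And>Y. Y \<in> carr ?QW \<Longrightarrow>
              norm_of ?QW (diff_of ?QW Y X) < d \<Longrightarrow> norm_of ?QW (diff_of ?QW (S Y) (S X)) < e / 2"
            using X by (auto simp: diff_Q norm_Q QW.diff_closed)
          \<comment> \<open>The limit of distances is only known to be at most \<open>d'\<close>;
            the extra factor 1/2 makes it strictly smaller than both \<open>d\<close> and
            \<open>e / 2\<close>.\<close>
          define d' where "d' = min d (e / 2) / 2"
          have d': "d' > 0" "d' < d" "d' < e / 2" using d that by (auto simp: d'_def min_def)
          have "\<exists>N. \<forall>m\<ge>N. \<forall>n\<ge>N. norm_of W (diff_of W (x m) (x n)) < d'"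
            using x d'(1) by (simp add: cauchy_sequences_def cauchy_in_def)
          then obtain N where N: "\<And>m n. m \<ge> N \<Longrightarrow> n \<ge> N \<Longrightarrow> norm_of W (diff_of W (x m) (x n)) < d'"
            by blast
          define Y where "Y = null_class ?CW (\<lambda>_. x N)"
          have xN: "x N \<in> carr W" by (rule carr_CW[OF x])
          have Y: "Y \<in> carr ?QW" using tc(3)[OF xN] by (simp add: Y_def separated_quotient_def)
          have "S Y = Y" using S tc[OF xN] xN by (auto simp: Y_def VW)
          have diff_in: "diff_of ?CW (\<lambda>_. x N) x \<in> carr ?CW"
            by (intro CW.diff_closed tc(3) xN x)
          have "norm_of ?QW (diff_of ?QW Y X) = norm_of ?CW (diff_of ?CW (\<lambda>_. x N) x)"
            by (simp add: Y_def Xx CW.separated_quotient_simps tc(3) xN x diff_in)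
          also have "\<dots> = lim (\<lambda>n. norm_of W (diff_of W (x N) (x n)))"
            by (simp add: cauchy_sequences_def diff_of_def)
          also have "\<dots> \<le> d'"
          proof (rule LIMSEQ_le_const2)
            show "(\<lambda>n. norm_of W (diff_of W (x N) (x n))) \<longlonglongrightarrow> lim (\<lambda>n. norm_of W (diff_of W (x N) (x n)))"
              using W.norm_tendsto_cauchy_in[of "diff_of ?CW (\<lambda>_. x N) x"] diff_in
              by (simp add: cauchy_sequences_def diff_of_def)
            show "\<exists>M. \<forall>n\<ge>M. norm_of W (diff_of W (x N) (x n)) \<le> d'"
              using N by (intro exI[of _ N]) (auto intro: less_imp_le)
          qed
          finally have YX: "norm_of ?QW (diff_of ?QW Y X) \<le> d'" .
          then have "norm_of ?QW (diff_of ?QW (S Y) (S X)) < e / 2"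
            using dS[OF Y] d' by simp
          then show "D \<le> e"
            using QW.norm_diff_triangle[OF SX Y X] QW.norm_diff_comm[OF SX Y] YX d' \<open>S Y = Y\<close>
            by (simp add: D_def)
        qed
        then have "D \<le> 0" by (rule field_le_epsilon[of D 0, simplified])
        then have "D = 0" using QW.norm_nonneg[OF QW.diff_closed[OF SX X]] by (simp add: D_def)
        then have "diff_of ?QW (S X) X = zero_of ?QW"
          using QW.norm_eq_0[OF QW.diff_closed[OF SX X]] by (simp add: D_def)
        then have "S X = X"
          using QW.diff_add_cancel[OF SX X] QW.zero_add[OF X] by simp
        then show ?thesis by (simp add: T_def X)
      qed
    qed
  qed
  show ?thesis
    unfolding ext linear_isometry_def linear_map_def completion_simps carr_Q
    by (auto simp: T_def add_Q scale_Q norm_Q QW.add_closed QW.scale_closed)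
qed

section \<open>\<open>L\<^sup>p\<close>-functions\<close>

lemma Lp_functions_simps [simp]:
  "zero_of (Lp_functions p M) = (\<lambda>_. 0)"
  "add_of (Lp_functions p M) f g = (\<lambda>x. f x + g x)"
  "scale_of (Lp_functions p M) c f = (\<lambda>x. c * f x)"
  "diff_of (Lp_functions p M) f g = (\<lambda>x. f x - g x)"
  by (simp_all add: Lp_functions_def diff_of_def)

lemma Lp_functions_carr:
  "f \<in> carr (Lp_functions p M) \<longleftrightarrow>
    f \<in> borel_measurable M \<and> integrable M (\<lambda>x. norm (f x) powr p)"
  by (simp add: Lp_functions_def)

lemma Lp_functions_measurable: "f \<in> carr (Lp_functions p M) \<Longrightarrow> f \<in> borel_measurable M"
  and Lp_functions_integrable: "f \<in> carr (Lp_functions p M) \<Longrightarrow> integrable M (\<lambda>x. norm (f x) powr p)"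
  by (simp_all add: Lp_functions_carr)

lemma Lp_functions_norm:
  "norm_of (Lp_functions p M) f = (\<integral>x. norm (f x) powr p \<partial>M) powr (1 / p)"
  by (simp add: Lp_functions_def)

lemma Lp_functions_norm_powr:
  "0 < p \<Longrightarrow> norm_of (Lp_functions p M) f powr p = (\<integral>x. norm (f x) powr p \<partial>M)"
  by (simp add: Lp_functions_norm powr_powr)

lemma Lp_functions_norm_nonneg: "0 \<le> norm_of (Lp_functions p M) f"
  by (simp add: Lp_functions_norm)

lemma powr_le_imp_le:
  fixes a b p :: real
  assumes "a powr p \<le> b powr p" "0 < p" "0 \<le> b"
  shows "a \<le> b"
  using powr_less_mono2[of p b a] assms by linarith

lemma Lp_functions_norm_le_iff:
  assumes "0 < p" "0 \<le> B"
  shows "norm_of (Lp_functions p M) f \<le> B \<longleftrightarrow> (\<integral>x. norm (f x) powr p \<partial>M) \<le> B powr p"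
  unfolding Lp_functions_norm_powr[OF assms(1), symmetric]
  using assms powr_le_imp_le[of "norm_of (Lp_functions p M) f" p B]
    powr_mono2[of p "norm_of (Lp_functions p M) f" B] Lp_functions_norm_nonneg[of p M f]
  by auto

text \<open>If one endpoint is 0, convexity reduces to \<open>t powr p \<le> t\<close> on the unit
  interval; otherwise it is convexity on the positive reals.\<close>

lemma convex_on_powr_nonneg:
  fixes p :: real
  assumes "1 \<le> p"
  shows "convex_on {0..} (\<lambda>x. x powr p)"
proof (rule convex_onI)
  fix t x y :: real
  assume t: "0 < t" "t < 1" and xy: "x \<in> {0..}" "y \<in> {0..}"
  have small: "t powr p \<le> t" "(1 - t) powr p \<le> 1 - t"
    using powr_mono'[of 1 p t] powr_mono'[of 1 p "1 - t"] t assms by auto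
  consider "x = 0" | "y = 0" | "0 < x" "0 < y" using xy by force
  then show "((1 - t) *\<^sub>R x + t *\<^sub>R y) powr p \<le> (1 - t) * x powr p + t * y powr p"
  proof cases
    case 1
    then show ?thesis using small xy t by (auto simp: powr_mult intro!: mult_right_mono)
  next
    case 2
    then show ?thesis using small xy t by (auto simp: powr_mult intro!: mult_right_mono)
  next
    case 3
    then show ?thesis using convex_onD[OF powr_convex[OF assms], of t x y] t by simp
  qed
qed simp

text \<open>Jensen's inequality: \<open>(a + b) / (A + B)\<close> is the convex combination of
  \<open>a / A\<close> and \<open>b / B\<close> with weights \<open>A / (A + B)\<close> and
  \<open>B / (A + B)\<close>.\<close>

lemma powr_add_le_weighted:
  fixes a b A B p :: real
  assumes "1 \<le> p" "0 \<le> a" "0 \<le> b" "0 < A" "0 < B"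
  shows "(a + b) powr p \<le>
    (A + B) powr p * (A / (A + B) * (a powr p / A powr p) + B / (A + B) * (b powr p / B powr p))"
proof -
  have t: "0 \<le> B / (A + B)" "B / (A + B) \<le> 1" "1 - B / (A + B) = A / (A + B)"
    using assms by (auto simp: field_simps)
  have "(A / (A + B) * (a / A) + B / (A + B) * (b / B)) powr p
      \<le> A / (A + B) * (a / A) powr p + B / (A + B) * (b / B) powr p"
    using convex_onD[OF convex_on_powr_nonneg[OF assms(1)], of "B / (A + B)" "a / A" "b / B"] t assms
    by simp
  moreover have "(a + b) powr p
      = (A + B) powr p * (A / (A + B) * (a / A) + B / (A + B) * (b / B)) powr p"
  proof -
    have "a + b = (A + B) * (A / (A + B) * (a / A) + B / (A + B) * (b / B))"
      using assms by (simp add: add_divide_distrib[symmetric])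
    then show ?thesis using assms by
      (metis add_nonneg_nonneg divide_nonneg_pos less_imp_le mult_nonneg_nonneg add_pos_pos powr_mult)
  qed
  ultimately show ?thesis
    using assms by (simp add: powr_divide mult_left_mono)
qed

lemma Lp_functions_scale_closed:
  "f \<in> carr (Lp_functions p M) \<Longrightarrow> (\<lambda>x. c * f x) \<in> carr (Lp_functions p M)"
  by (auto simp: Lp_functions_carr norm_mult powr_mult)

lemma Lp_functions_dominated:
  assumes "g \<in> borel_measurable M" "integrable M h" "\<And>x. x \<in> space M \<Longrightarrow> norm (g x) powr p \<le> h x"
  shows "g \<in> carr (Lp_functions p M)"
  unfolding Lp_functions_carr
proof
  show "integrable M (\<lambda>x. norm (g x) powr p)"
    by (rule Bochner_Integration.integrable_bound[OF assms(2)])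
       (use assms in \<open>auto intro!: AE_I2 order_trans[OF assms(3)]\<close>)
qed (rule assms)

lemma Lp_functions_add_closed:
  assumes "1 \<le> p" and f: "f \<in> carr (Lp_functions p M)" and g: "g \<in> carr (Lp_functions p M)"
  shows "(\<lambda>x. f x + g x) \<in> carr (Lp_functions p M)"
proof (rule Lp_functions_dominated)
  show "(\<lambda>x. f x + g x) \<in> borel_measurable M"
    using f g by (auto simp: Lp_functions_carr)
  show "integrable M (\<lambda>x. 2 powr p * (1/2 * norm (f x) powr p + 1/2 * norm (g x) powr p))"
    using f g by (auto simp: Lp_functions_carr)
  fix x
  have "norm (f x + g x) powr p \<le> (norm (f x) + norm (g x)) powr p"
    using assms by (intro powr_mono2) (auto intro: norm_triangle_ineq)
  also have "\<dots> \<le> 2 powr p * (1/2 * norm (f x) powr p + 1/2 * norm (g x) powr p)"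
    using powr_add_le_weighted[of p "norm (f x)" "norm (g x)" 1 1] assms by simp
  finally show "norm (f x + g x) powr p \<le> \<dots>" .
qed

lemma Lp_functions_diff_closed:
  assumes "1 \<le> p" "f \<in> carr (Lp_functions p M)" "g \<in> carr (Lp_functions p M)"
  shows "(\<lambda>x. f x - g x) \<in> carr (Lp_functions p M)"
  using Lp_functions_add_closed[OF assms(1,2) Lp_functions_scale_closed[OF assms(3), of "-1"]] by simp

lemma Lp_functions_zero_closed: "(\<lambda>_. 0) \<in> carr (Lp_functions p M)"
  by (simp add: Lp_functions_carr)

lemma Lp_functions_sum_closed:
  assumes "1 \<le> p" "\<And>i. i \<in> I \<Longrightarrow> f i \<in> carr (Lp_functions p M)"
  shows "(\<lambda>x. \<Sum>i\<in>I. f i x) \<in> carr (Lp_functions p M)"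
  using assms(2)
  by (induction I rule: infinite_finite_induct)
     (simp_all add: Lp_functions_zero_closed Lp_functions_add_closed[OF assms(1)])

text \<open>
  By convexity with weights \<open>A/(A+B)\<close>, \<open>B/(A+B)\<close> for numbers \<open>A\<close>, \<open>B\<close> slightly larger than
  the two norms, which avoids dividing by zero.
\<close>

lemma Minkowski_inequality:
  assumes p: "1 \<le> p" and f: "f \<in> carr (Lp_functions p M)" and g: "g \<in> carr (Lp_functions p M)"
  shows "norm_of (Lp_functions p M) (\<lambda>x. f x + g x)
    \<le> norm_of (Lp_functions p M) f + norm_of (Lp_functions p M) g"
proof (rule field_le_epsilon)
  fix e :: real assume e: "0 < e"
  define A where "A = norm_of (Lp_functions p M) f + e / 2"
  define B where "B = norm_of (Lp_functions p M) g + e / 2"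
  have AB: "0 < A" "0 < B"
    using e Lp_functions_norm_nonneg[of p M f] Lp_functions_norm_nonneg[of p M g]
    by (auto simp: A_def B_def)
  have If: "(\<integral>x. norm (f x) powr p \<partial>M) \<le> A powr p" "(\<integral>x. norm (g x) powr p \<partial>M) \<le> B powr p"
    using p e AB Lp_functions_norm_le_iff[of p A M f] Lp_functions_norm_le_iff[of p B M g]
    by (auto simp: A_def B_def)
  have "(\<integral>x. norm (f x + g x) powr p \<partial>M)
      \<le> (\<integral>x. (A + B) powr p * (A / (A + B) * (norm (f x) powr p / A powr p)
            + B / (A + B) * (norm (g x) powr p / B powr p)) \<partial>M)"
  proof (rule integral_mono)
    show "integrable M (\<lambda>x. norm (f x + g x) powr p)"
      using Lp_functions_add_closed[OF p f g] by (simp add: Lp_functions_carr)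
    show "integrable M (\<lambda>x. (A + B) powr p * (A / (A + B) * (norm (f x) powr p / A powr p)
            + B / (A + B) * (norm (g x) powr p / B powr p)))"
      using f g by (auto simp: Lp_functions_carr)
    fix x
    have "norm (f x + g x) powr p \<le> (norm (f x) + norm (g x)) powr p"
      using p by (intro powr_mono2) (auto intro: norm_triangle_ineq)
    also note powr_add_le_weighted[OF p norm_ge_zero norm_ge_zero AB]
    finally show "norm (f x + g x) powr p \<le> (A + B) powr p * (A / (A + B) * (norm (f x) powr p / A powr p)
            + B / (A + B) * (norm (g x) powr p / B powr p))" .
  qed
  also have "\<dots> = (A + B) powr p * (A / (A + B) * ((\<integral>x. norm (f x) powr p \<partial>M) / A powr p)
            + B / (A + B) * ((\<integral>x. norm (g x) powr p \<partial>M) / B powr p))"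
    using f g by (subst integral_mult_right_zero, subst Bochner_Integration.integral_add)
      (auto simp: Lp_functions_carr)
  also have "\<dots> \<le> (A + B) powr p * (A / (A + B) * 1 + B / (A + B) * 1)"
    using If AB by (intro mult_left_mono add_mono) auto
  also have "\<dots> = (A + B) powr p"
    using AB by (simp add: add_divide_distrib[symmetric])
  finally have "norm_of (Lp_functions p M) (\<lambda>x. f x + g x) \<le> A + B"
    using p AB by (subst Lp_functions_norm_le_iff) auto
  then show "norm_of (Lp_functions p M) (\<lambda>x. f x + g x)
      \<le> norm_of (Lp_functions p M) f + norm_of (Lp_functions p M) g + e"
    by (simp add: A_def B_def)
qed

lemma Lp_functions_norm_scale:
  "0 < p \<Longrightarrow> norm_of (Lp_functions p M) (\<lambda>x. c * f x) = norm c * norm_of (Lp_functions p M) f"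
  by (simp add: Lp_functions_norm norm_mult powr_mult powr_powr)

lemma Lp_functions_seminormed:
  assumes "1 \<le> p" shows "complex_seminormed_space (Lp_functions p M)"
  using assms
  by unfold_locales
    (simp_all add: Lp_functions_zero_closed Lp_functions_add_closed Lp_functions_scale_closed
      Minkowski_inequality Lp_functions_norm_scale algebra_simps)

lemma Lp_functions_norm_eq_0_iff:
  assumes "0 < p" "f \<in> carr (Lp_functions p M)"
  shows "norm_of (Lp_functions p M) f = 0 \<longleftrightarrow> (AE x in M. f x = 0)"
proof -
  have "norm_of (Lp_functions p M) f = 0 \<longleftrightarrow> (\<integral>x. norm (f x) powr p \<partial>M) = 0"
    using assms by (simp add: Lp_functions_norm)
  also have "\<dots> \<longleftrightarrow> (AE x in M. norm (f x) powr p = 0)"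
    using assms by (intro integral_nonneg_eq_0_iff_AE) (auto simp: Lp_functions_carr)
  finally show ?thesis by simp
qed

lemma Lp_functions_norm_cong_AE:
  assumes "f \<in> borel_measurable M" "g \<in> borel_measurable M" "AE x in M. f x = g x"
  shows "norm_of (Lp_functions p M) f = norm_of (Lp_functions p M) g"
  unfolding Lp_functions_norm
  by (rule arg_cong[of _ _ "\<lambda>z. z powr (1 / p)"], rule integral_cong_AE) (use assms in auto)

section \<open>Counting measure: finite partial sums and completeness\<close>

lemma count_space_nonneg:
  fixes g :: "'a \<Rightarrow> real"
  assumes "\<And>x. 0 \<le> g x"
  shows "integrable (count_space A) g \<longleftrightarrow> g summable_on A"
    and "g summable_on A \<Longrightarrow> integral\<^sup>L (count_space A) g = infsum g A"
proof -
  have eq: "integrable (count_space A) g \<longleftrightarrow> Infinite_Sum.abs_summable_on g A"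
    using abs_summable_equivalent[of g A] by (simp only: Infinite_Set_Sum.abs_summable_on_def)
  also have "\<dots> \<longleftrightarrow> g summable_on A"
    using assms by simp
  finally show "integrable (count_space A) g \<longleftrightarrow> g summable_on A" .
  assume "g summable_on A"
  then have "Infinite_Sum.abs_summable_on g A"
    using assms by simp
  then show "integral\<^sup>L (count_space A) g = infsum g A"
    using infsetsum_infsum[of g A] abs_summable_equivalent[of g A] by (simp only: infsetsum_def)
qed

lemma lp_count_carr:
  "f \<in> carr (Lp_functions p (count_space A)) \<longleftrightarrow> (\<lambda>x. norm (f x) powr p) summable_on A"
  by (simp add: Lp_functions_carr count_space_nonneg(1))

lemma lp_count_norm_powr:
  assumes "0 < p" "f \<in> carr (Lp_functions p (count_space A))"
  shows "norm_of (Lp_functions p (count_space A)) f powr p = (\<Sum>\<^sub>\<infinity>x\<in>A. norm (f x) powr p)"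
  using assms by (simp add: Lp_functions_norm_powr count_space_nonneg(2) lp_count_carr)

lemma lp_count_finite_sum_le:
  assumes "0 < p" "f \<in> carr (Lp_functions p (count_space A))" "finite S" "S \<subseteq> A"
  shows "(\<Sum>x\<in>S. norm (f x) powr p) \<le> norm_of (Lp_functions p (count_space A)) f powr p"
  unfolding lp_count_norm_powr[OF assms(1,2)]
  by (rule finite_sum_le_infsum) (use assms in \<open>auto simp: lp_count_carr\<close>)

text \<open>Uniform bounds on finite partial sums give summability and the norm bound at once, so
  later estimates on \<open>X \<times> G\<close> can stay with finite sets.\<close>

lemma lp_count_norm_leI:
  assumes "0 < p" "0 \<le> B"
    and *: "\<And>S. finite S \<Longrightarrow> S \<subseteq> A \<Longrightarrow> (\<Sum>x\<in>S. norm (f x) powr p) \<le> B powr p"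
  shows "f \<in> carr (Lp_functions p (count_space A))"
    and "norm_of (Lp_functions p (count_space A)) f \<le> B"
proof -
  have s: "(\<lambda>x. norm (f x) powr p) summable_on A"
    by (rule nonneg_bdd_above_summable_on) (auto intro!: bdd_aboveI[of _ "B powr p"] *)
  then show f: "f \<in> carr (Lp_functions p (count_space A))" by (simp add: lp_count_carr)
  have "(\<Sum>\<^sub>\<infinity>x\<in>A. norm (f x) powr p) \<le> B powr p"
    by (rule infsum_le_finite_sums[OF s]) (use * in auto)
  then show "norm_of (Lp_functions p (count_space A)) f \<le> B"
    using powr_le_imp_le assms lp_count_norm_powr[OF assms(1) f] by metis
qed

lemma lp_count_pointwise_le:
  assumes "0 < p" "f \<in> carr (Lp_functions p (count_space A))" "x \<in> A"
  shows "norm (f x) \<le> norm_of (Lp_functions p (count_space A)) f"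
  using lp_count_finite_sum_le[OF assms(1,2), of "{x}"] assms
  by (intro powr_le_imp_le[OF _ assms(1) Lp_functions_norm_nonneg]) auto

text \<open>Evaluation at a point is contractive, so pointwise limits exist. On a finite set the
  p-th powers converge, hence the Cauchy bound passes to the limit there, and then to the full
  norm.\<close>

lemma lp_count_complete:
  fixes p :: real
  defines "V \<equiv> (\<lambda>A. Lp_functions p (count_space A))"
  assumes p: "1 \<le> p" and X: "cauchy_in (V A) X"
  shows "\<exists>l\<in>carr (V A). (\<lambda>n. norm_of (V A) (diff_of (V A) (X n) l)) \<longlonglongrightarrow> 0"
proof -
  have Xc: "X n \<in> carr (V A)" for n using X by (simp add: cauchy_in_def)
  have Xd: "(\<lambda>x. X m x - X n x) \<in> carr (V A)" for m n
    using Lp_functions_diff_closed[OF p Xc[unfolded V_def] Xc[unfolded V_def]] by (simp add: V_def)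
  have C: "\<exists>N. \<forall>m\<ge>N. \<forall>n\<ge>N. norm_of (V A) (\<lambda>x. X m x - X n x) < e" if "0 < e" for e
    using X that by (simp add: cauchy_in_def V_def)
  have "convergent (\<lambda>n. X n x)" if "x \<in> A" for x
    unfolding Cauchy_convergent_iff[symmetric]
  proof (rule CauchyI)
    fix e :: real assume "0 < e"
    then obtain N where "\<forall>m\<ge>N. \<forall>n\<ge>N. norm_of (V A) (\<lambda>x. X m x - X n x) < e" using C by blast
    moreover have "norm (X m x - X n x) \<le> norm_of (V A) (\<lambda>x. X m x - X n x)" for m n
      using lp_count_pointwise_le[of p "\<lambda>x. X m x - X n x" A x] Xd p that by (simp add: V_def)
    ultimately show "\<exists>N. \<forall>m\<ge>N. \<forall>n\<ge>N. norm (X m x - X n x) < e"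
      by (meson le_less_trans)
  qed
  then have lim: "(\<lambda>n. X n x) \<longlonglongrightarrow> lim (\<lambda>n. X n x)" if "x \<in> A" for x
    using that by (simp add: convergent_LIMSEQ_iff)
  define l where "l = (\<lambda>x. lim (\<lambda>n. X n x))"
  have close: "(\<lambda>x. X m x - l x) \<in> carr (V A) \<and> norm_of (V A) (\<lambda>x. X m x - l x) \<le> e"
    if e: "0 < e" and N: "\<forall>m\<ge>N. \<forall>n\<ge>N. norm_of (V A) (\<lambda>x. X m x - X n x) < e" and m: "m \<ge> N" for e N m
  proof -
    have "(\<Sum>x\<in>S. norm (X m x - l x) powr p) \<le> e powr p" if S: "finite S" "S \<subseteq> A" for S
    proof (rule LIMSEQ_le_const2)
      show "(\<lambda>n. \<Sum>x\<in>S. norm (X m x - X n x) powr p) \<longlonglongrightarrow> (\<Sum>x\<in>S. norm (X m x - l x) powr p)"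
        using S p lim unfolding l_def
        by (intro tendsto_sum tendsto_powr' tendsto_norm tendsto_diff tendsto_const) auto
      have "(\<Sum>x\<in>S. norm (X m x - X n x) powr p) \<le> e powr p" if "n \<ge> N" for n
      proof -
        have "(\<Sum>x\<in>S. norm (X m x - X n x) powr p) \<le> norm_of (V A) (\<lambda>x. X m x - X n x) powr p"
          using lp_count_finite_sum_le[of p "\<lambda>x. X m x - X n x" A S] Xd[of m n] p S by (simp add: V_def)
        also have "\<dots> \<le> e powr p"
          using N m that p Lp_functions_norm_nonneg[of p "count_space A"]
          by (intro powr_mono2) (auto simp: V_def less_imp_le)
        finally show ?thesis .
      qed
      then show "\<exists>N. \<forall>n\<ge>N. (\<Sum>x\<in>S. norm (X m x - X n x) powr p) \<le> e powr p" by blast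
    qed
    then show ?thesis
      using lp_count_norm_leI[of p e A "\<lambda>x. X m x - l x"] p e by (auto simp: V_def)
  qed
  obtain N1 where "\<forall>m\<ge>N1. \<forall>n\<ge>N1. norm_of (V A) (\<lambda>x. X m x - X n x) < 1" using C[of 1] by auto
  then have "(\<lambda>x. X N1 x - l x) \<in> carr (V A)" using close[of 1 N1 N1] by simp
  then have "(\<lambda>x. X N1 x - (X N1 x - l x)) \<in> carr (V A)"
    using Lp_functions_diff_closed[OF p] Xc unfolding V_def by blast
  then have l: "l \<in> carr (V A)" by simp
  have "(\<lambda>n. norm_of (V A) (\<lambda>x. X n x - l x)) \<longlonglongrightarrow> 0"
  proof (rule LIMSEQ_I)
    fix e :: real assume e: "0 < e"
    then obtain N where N: "\<forall>m\<ge>N. \<forall>n\<ge>N. norm_of (V A) (\<lambda>x. X m x - X n x) < e / 2"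
      using C[of "e / 2"] by auto
    have "norm (norm_of (V A) (\<lambda>x. X n x - l x) - 0) < e" if "n \<ge> N" for n
      using close[OF _ N that] e Lp_functions_norm_nonneg[of p "count_space A"] by (simp add: V_def)
    then show "\<exists>N. \<forall>n\<ge>N. norm (norm_of (V A) (\<lambda>x. X n x - l x) - 0) < e" by blast
  qed
  then show ?thesis using l by (intro bexI[of _ l]) (simp_all add: V_def)
qed

section \<open>Operator norms and representations\<close>

context complex_seminormed_space
begin

lemma bounded_operators_bdd:
  assumes "T \<in> bounded_operators V"
  shows "bdd_above ((\<lambda>x. norm_of V (T x)) ` {x \<in> carr V. norm_of V x \<le> 1})"
proof -
  obtain C where C: "\<And>x. x \<in> carr V \<Longrightarrow> norm_of V (T x) \<le> C * norm_of V x"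
    using assms by (auto simp: bounded_operators_def)
  have "norm_of V (T x) \<le> \<bar>C\<bar>" if "x \<in> carr V" "norm_of V x \<le> 1" for x
  proof -
    have "norm_of V (T x) \<le> \<bar>C\<bar> * norm_of V x"
      using C[OF that(1)] norm_nonneg[OF that(1)] by (smt (verit) mult_right_mono)
    also have "\<dots> \<le> \<bar>C\<bar> * 1" using that norm_nonneg[OF that(1)] by (intro mult_left_mono) auto
    finally show ?thesis by simp
  qed
  then show ?thesis by (intro bdd_aboveI[of _ "\<bar>C\<bar>"]) auto
qed

lemma operator_norm_nonneg:
  assumes "T \<in> bounded_operators V" shows "0 \<le> operator_norm V T"
proof -
  have "T (zero_of V) \<in> carr V"
    using assms zero_closed by (auto simp: bounded_operators_def linear_map_def)
  then have "0 \<le> norm_of V (T (zero_of V))" by (rule norm_nonneg)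
  also have "\<dots> \<le> operator_norm V T" unfolding operator_norm_def
    by (rule cSUP_upper[OF _ bounded_operators_bdd[OF assms]]) (simp add: zero_closed norm_zero)
  finally show ?thesis .
qed

lemma operator_norm_apply:
  assumes T: "T \<in> bounded_operators V" and x: "x \<in> carr V"
  shows "norm_of V (T x) \<le> operator_norm V T * norm_of V x"
\<comment> \<open>A nonzero vector of seminorm 0 cannot be rescaled to the unit ball; there
  boundedness of \<open>T\<close> gives the claim directly.\<close>
proof (cases "norm_of V x = 0")
  case True
  obtain C where "norm_of V (T x) \<le> C * norm_of V x"
    using T x by (auto simp: bounded_operators_def)
  then show ?thesis using True by simp
next
  case False
  then have pos: "norm_of V x > 0" using norm_nonneg[OF x] by simp
  let ?c = "complex_of_real (1 / norm_of V x)"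
  have lin: "T (scale_of V ?c x) = scale_of V ?c (T x)" and Tx: "T x \<in> carr V"
    using T x by (auto simp: bounded_operators_def linear_map_def)
  have "norm_of V (T (scale_of V ?c x)) \<le> operator_norm V T" unfolding operator_norm_def
    using pos x by (intro cSUP_upper[OF _ bounded_operators_bdd[OF T]]) (simp add: norm_scale scale_closed norm_divide)
  then have "1 / norm_of V x * norm_of V (T x) \<le> operator_norm V T"
    unfolding lin using pos by (simp add: norm_scale Tx norm_divide)
  then show ?thesis using pos by (simp add: field_simps)
qed

lemma operator_norm_le:
  assumes "0 \<le> C" "\<And>x. x \<in> carr V \<Longrightarrow> norm_of V (T x) \<le> C * norm_of V x"
  shows "operator_norm V T \<le> C"
  unfolding operator_norm_def
proof (rule cSUP_least)
  show "{x \<in> carr V. norm_of V x \<le> 1} \<noteq> {}" using zero_closed norm_zero by force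
  fix x assume x: "x \<in> {x \<in> carr V. norm_of V x \<le> 1}"
  have "C * norm_of V x \<le> C * 1" using x assms(1) by (intro mult_left_mono) auto
  then show "norm_of V (T x) \<le> C" using assms(2)[of x] x by simp
qed

end

lemma representation_closed:
  "\<lbrakk>representation B E \<pi>; a \<in> carr B; \<zeta> \<in> carr E\<rbrakk> \<Longrightarrow> \<pi> a \<zeta> \<in> carr E"
  by (auto simp: representation_def bounded_operators_def linear_map_def)

lemma representation_linear:
  assumes "representation B E \<pi>" "a \<in> carr B" "\<zeta> \<in> carr E"
  shows "\<eta> \<in> carr E \<Longrightarrow> \<pi> a (add_of E \<zeta> \<eta>) = add_of E (\<pi> a \<zeta>) (\<pi> a \<eta>)"
    and "\<pi> a (scale_of E c \<zeta>) = scale_of E c (\<pi> a \<zeta>)"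
  using assms by (auto simp: representation_def bounded_operators_def linear_map_def)

lemma (in complex_seminormed_space) representation_norm_le:
  assumes "representation B V \<pi>" "a \<in> carr B" "\<zeta> \<in> carr V"
  shows "norm_of V (\<pi> a \<zeta>) \<le> norm_of B a * norm_of V \<zeta>"
proof -
  have "\<pi> a \<in> bounded_operators V" "operator_norm V (\<pi> a) \<le> norm_of B a"
    using assms(1,2) by (auto simp: representation_def)
  then show ?thesis
    using operator_norm_apply[of "\<pi> a" \<zeta>] mult_right_mono[of _ _ "norm_of V \<zeta>"] norm_nonneg[OF assms(3)]
      assms(3) by fastforce
qed

lemma Lp_functions_norm_sum_le:
  assumes "1 \<le> p" "\<And>i. i \<in> I \<Longrightarrow> f i \<in> carr (Lp_functions p M)"
  shows "norm_of (Lp_functions p M) (\<lambda>x. \<Sum>i\<in>I. f i x) \<le> (\<Sum>i\<in>I. norm_of (Lp_functions p M) (f i))"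
  using assms(2)
proof (induction I rule: infinite_finite_induct)
  case (insert i I)
  then have "norm_of (Lp_functions p M) (\<lambda>x. f i x + (\<Sum>i\<in>I. f i x))
      \<le> norm_of (Lp_functions p M) (f i) + norm_of (Lp_functions p M) (\<lambda>x. \<Sum>i\<in>I. f i x)"
    using assms(1) by (intro Minkowski_inequality Lp_functions_sum_closed) auto
  then show ?case using insert by (simp add: order_trans)
qed (simp_all add: Lp_functions_norm)

section \<open>The twisted convolution algebra and its regular representation\<close>

lemma C0_cutoff:
  assumes "a \<in> C0" "0 < e"
  obtains K where "compact K" "\<And>x. x \<notin> K \<Longrightarrow> norm (a x) < e"
  using assms unfolding C0_def by blast

lemma C0_continuous: "a \<in> C0 \<Longrightarrow> continuous_on UNIV a"
  by (simp add: C0_def)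

lemma C0_bdd: assumes "a \<in> C0" shows "bdd_above (range (\<lambda>x. norm (a x)))"
proof -
  obtain K where K: "compact K" "\<And>x. x \<notin> K \<Longrightarrow> norm (a x) < 1"
    using C0_cutoff[OF assms zero_less_one] by blast
  have "compact (a ` K)"
    using K(1) C0_continuous[OF assms] by (intro compact_continuous_image) (auto intro: continuous_on_subset)
  then have "bounded (a ` K)" by (rule compact_imp_bounded)
  then obtain B where B: "\<And>x. x \<in> K \<Longrightarrow> norm (a x) \<le> B"
    by (auto simp: bounded_iff)
  have "norm (a x) \<le> max B 1" for x
    using B[of x] K(2)[of x] by (cases "x \<in> K") auto
  then show ?thesis by (intro bdd_aboveI[of _ "max B 1"]) auto
qed

lemma sup_norm_upper: "a \<in> C0 \<Longrightarrow> norm (a x) \<le> sup_norm a"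
  unfolding sup_norm_def by (rule cSUP_upper[OF _ C0_bdd]) auto

lemma sup_norm_least: "(\<And>x. norm (a x) \<le> B) \<Longrightarrow> sup_norm a \<le> B"
  unfolding sup_norm_def by (rule cSUP_least) auto

lemma sup_norm_nonneg: "a \<in> C0 \<Longrightarrow> 0 \<le> sup_norm a"
  using sup_norm_upper norm_ge_zero order_trans by metis

lemma sup_norm_zero [simp]: "sup_norm (\<lambda>_. 0) = 0"
  by (simp add: sup_norm_def)

lemma C0_compact_support:
  assumes "continuous_on UNIV a" "compact K" "\<And>x. x \<notin> K \<Longrightarrow> a x = 0"
  shows "a \<in> C0"
  using assms unfolding C0_def by (auto intro!: exI[of _ K])

lemma C0_zero: "(\<lambda>_. 0) \<in> C0"
  by (rule C0_compact_support[of _ "{}"]) auto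

text \<open>The intended application is exp(i h) - 1, which is dominated by |h| although exp(i h)
  itself has modulus 1 everywhere.\<close>

lemma C0_bounded_image:
  assumes "a \<in> C0" "continuous_on UNIV c" "\<And>x. norm (c x) \<le> B * norm (a x)"
  shows "c \<in> C0"
  unfolding C0_def
proof (intro CollectI conjI allI impI assms(2))
  fix e :: real assume e: "0 < e"
  have "0 < e / (\<bar>B\<bar> + 1)" using e by (simp add: add_nonneg_pos)
  then obtain K where K: "compact K" "\<And>x. x \<notin> K \<Longrightarrow> norm (a x) < e / (\<bar>B\<bar> + 1)"
    using C0_cutoff[OF assms(1)] by blast
  have "norm (c x) < e" if "x \<notin> K" for x
  proof -
    have "norm (c x) \<le> (\<bar>B\<bar> + 1) * norm (a x)"
      using assms(3)[of x] norm_ge_zero[of "a x"] by (smt (verit) mult_right_mono)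
    also have "\<dots> < e" using K(2)[OF that] by (simp add: pos_less_divide_eq add_nonneg_pos mult.commute)
    finally show ?thesis .
  qed
  then show "\<exists>K. compact K \<and> (\<forall>x. x \<notin> K \<longrightarrow> norm (c x) < e)" using K(1) by blast
qed

lemma C0_mult_bounded:
  assumes "a \<in> C0" "continuous_on UNIV c" "\<And>x. norm (c x) \<le> B"
  shows "(\<lambda>x. a x * c x) \<in> C0"
proof (rule C0_bounded_image[OF assms(1)])
  show "continuous_on UNIV (\<lambda>x. a x * c x)"
    using assms C0_continuous by (intro continuous_on_mult) auto
  show "norm (a x * c x) \<le> B * norm (a x)" for x
    using mult_right_mono[OF assms(3), of "norm (a x)"] by (simp add: norm_mult mult.commute)
qed

lemma C0_mult: "a \<in> C0 \<Longrightarrow> c \<in> C0 \<Longrightarrow> (\<lambda>x. a x * c x) \<in> C0"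
  by (rule C0_mult_bounded[of _ _ "sup_norm c"]) (auto intro: sup_norm_upper C0_continuous)

lemma C0_scale: "a \<in> C0 \<Longrightarrow> (\<lambda>x. c * a x) \<in> C0"
  using C0_mult_bounded[of a "\<lambda>_. c" "norm c"] by (simp add: mult.commute)

lemma C0_add:
  assumes "a \<in> C0" "b \<in> C0" shows "(\<lambda>x. a x + b x) \<in> C0"
  unfolding C0_def
proof (intro CollectI conjI allI impI)
  show "continuous_on UNIV (\<lambda>x. a x + b x)"
    using assms C0_continuous by (intro continuous_on_add) auto
  fix e :: real assume "0 < e"
  then have e2: "0 < e / 2" by simp
  obtain K where K: "compact K" "\<And>x. x \<notin> K \<Longrightarrow> norm (a x) < e / 2"
    using C0_cutoff[OF assms(1) e2] by blast
  obtain L where L: "compact L" "\<And>x. x \<notin> L \<Longrightarrow> norm (b x) < e / 2"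
    using C0_cutoff[OF assms(2) e2] by blast
  have "norm (a x + b x) < e" if "x \<notin> K \<union> L" for x
    using K(2)[of x] L(2)[of x] norm_triangle_ineq[of "a x" "b x"] that by auto
  then show "\<exists>K. compact K \<and> (\<forall>x. x \<notin> K \<longrightarrow> norm (a x + b x) < e)"
    using compact_Un[OF K(1) L(1)] by blast
qed

lemma C0_sum: "(\<And>i. i \<in> I \<Longrightarrow> a i \<in> C0) \<Longrightarrow> (\<lambda>x. \<Sum>i\<in>I. a i x) \<in> C0"
  by (induction I rule: infinite_finite_induct) (simp_all add: C0_zero C0_add)

lemma sup_norm_add_le:
  "a \<in> C0 \<Longrightarrow> b \<in> C0 \<Longrightarrow> sup_norm (\<lambda>x. a x + b x) \<le> sup_norm a + sup_norm b"
  by (intro sup_norm_least order_trans[OF norm_triangle_ineq] add_mono sup_norm_upper)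

lemma sup_norm_scale_le: "a \<in> C0 \<Longrightarrow> sup_norm (\<lambda>x. c * a x) \<le> norm c * sup_norm a"
  by (intro sup_norm_least) (auto simp: norm_mult intro!: mult_left_mono sup_norm_upper)

lemma F_simps:
  "carr (F \<phi> u) = {b. (\<forall>g. b g \<in> C0) \<and> (\<lambda>g. sup_norm (b g)) summable_on UNIV}"
  "zero_of (F \<phi> u) = (\<lambda>_ _. 0)"
  "add_of (F \<phi> u) = (\<lambda>a b g x. a g x + b g x)"
  "scale_of (F \<phi> u) = (\<lambda>c b g x. c * b g x)"
  "norm_of (F \<phi> u) b = (\<Sum>\<^sub>\<infinity>g\<in>UNIV. sup_norm (b g))"
  "mult_of (F \<phi> u) a b = (\<lambda>r x. \<Sum>\<^sub>\<infinity>(s, t)\<in>{(s, t). s + t = r}. a s x * \<alpha> \<phi> s (b t) x * u s t x)"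
  by (simp_all add: F_def)

lemma F_carrD: "b \<in> carr (F \<phi> u) \<Longrightarrow> b g \<in> C0"
  and F_summable: "b \<in> carr (F \<phi> u) \<Longrightarrow> (\<lambda>g. sup_norm (b g)) summable_on UNIV"
  by (simp_all add: F_simps)

lemma F_zero_closed: "(\<lambda>_ _. 0) \<in> carr (F \<phi> u)"
  by (simp add: F_simps C0_zero)

lemma F_add_closed:
  assumes "a \<in> carr (F \<phi> u)" "b \<in> carr (F \<phi> u)"
  shows "(\<lambda>g x. a g x + b g x) \<in> carr (F \<phi> u)"
proof -
  have "(\<lambda>g. sup_norm (\<lambda>x. a g x + b g x)) summable_on UNIV"
    by (rule summable_on_comparison_test[OF summable_on_add[OF F_summable[OF assms(1)] F_summable[OF assms(2)]]])
       (use assms in \<open>auto intro: sup_norm_add_le sup_norm_nonneg C0_add dest: F_carrD\<close>)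
  then show ?thesis using assms by (simp add: F_simps C0_add)
qed

lemma F_scale_closed:
  assumes "b \<in> carr (F \<phi> u)"
  shows "(\<lambda>g x. c * b g x) \<in> carr (F \<phi> u)"
proof -
  have "(\<lambda>g. sup_norm (\<lambda>x. c * b g x)) summable_on UNIV"
    by (rule summable_on_comparison_test[OF summable_on_cmult_right[OF F_summable[OF assms]]])
       (use assms in \<open>auto intro: sup_norm_scale_le sup_norm_nonneg C0_scale dest: F_carrD\<close>)
  then show ?thesis using assms by (simp add: F_simps C0_scale)
qed

lemma F_sum_closed:
  assumes "\<And>i. i \<in> I \<Longrightarrow> b i \<in> carr (F \<phi> u)"
  shows "(\<lambda>g x. \<Sum>i\<in>I. b i g x) \<in> carr (F \<phi> u)"
  using assms by (induction I rule: infinite_finite_induct) (simp_all add: F_zero_closed F_add_closed)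

lemma F_norm_nonneg: "b \<in> carr (F \<phi> u) \<Longrightarrow> 0 \<le> norm_of (F \<phi> u) b"
  by (auto simp: F_simps intro!: infsum_nonneg sup_norm_nonneg)

lemma F_sum_Diff_le:
  assumes b: "b \<in> carr (F \<phi> u)" and "finite U" "finite S"
  shows "(\<Sum>s\<in>U - S. sup_norm (b s)) \<le> norm_of (F \<phi> u) b - (\<Sum>s\<in>S. sup_norm (b s))"
proof -
  have "(\<Sum>s\<in>U - S. sup_norm (b s)) + (\<Sum>s\<in>S. sup_norm (b s)) = (\<Sum>s\<in>U \<union> S. sup_norm (b s))"
    using assms sum.subset_diff[of S "U \<union> S" "\<lambda>s. sup_norm (b s)"] by (simp add: Un_Diff)
  also have "\<dots> \<le> norm_of (F \<phi> u) b"
    using assms sup_norm_nonneg[OF F_carrD[OF b]] finite_sum_le_infsum[OF F_summable[OF b], of "U \<union> S"]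
    by (auto simp: F_simps)
  finally show ?thesis by simp
qed

section \<open>Action, cocycle and boundedness of \<open>\<Lambda>\<close>\<close>

locale twisted_action =
  fixes \<phi> :: "'g::group_add \<Rightarrow> 'x::t2_space \<Rightarrow> 'x"
    and u :: "'g \<Rightarrow> 'g \<Rightarrow> 'x \<Rightarrow> complex"
  assumes action: "homeo_action \<phi>"
    and cocycle: "normalised_2cocycle \<phi> u"
begin

lemma phi_add: "\<phi> (s + t) x = \<phi> s (\<phi> t x)"
  using action by (simp add: homeo_action_def)

lemma phi_homeo: "homeomorphic_map euclidean euclidean (\<phi> s)"
  using action by (simp add: homeo_action_def)

lemma phi_continuous: "continuous_on A (\<phi> s)"
  using homeomorphic_imp_continuous_map[OF phi_homeo[of s]]
  by (auto intro: continuous_on_subset)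

text \<open>\<open>homeo_action\<close> does not postulate that the unit acts trivially; this
  follows because \<open>\<phi> 0\<close> is an injective idempotent.\<close>

lemma phi_zero [simp]: "\<phi> 0 x = x"
proof -
  have "inj (\<phi> 0)" using homeomorphic_imp_injective_map[OF phi_homeo[of 0]] by simp
  moreover have "\<phi> 0 (\<phi> 0 x) = \<phi> 0 x" using phi_add[of 0 0 x] by simp
  ultimately show ?thesis by (simp add: inj_eq)
qed

lemma phi_cancel [simp]: "\<phi> (- s) (\<phi> s x) = x" "\<phi> s (\<phi> (- s) x) = x"
  using phi_add[of "- s" s x] phi_add[of s "- s" x] by simp_all

lemma norm_u [simp]: "norm (u s t x) = 1"
  and u_continuous: "continuous_on UNIV (u s t)"
  using cocycle by (auto simp: normalised_2cocycle_def Cu_def)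

lemma u_nonzero [simp]: "u s t x \<noteq> 0"
  using norm_u[of s t x] by fastforce

lemma u_cocycle: "u s t (\<phi> (- r) x) * u r (s + t) x = u r s x * u (r + s) t x"
  using cocycle by (simp add: normalised_2cocycle_def \<alpha>_def)

text \<open>Only \<open>u 0 0\<close> is prescribed. The cocycle identity at the triples (0,0,t) and
  (s,0,0) spreads the normalisation, after cancelling a nonzero value.\<close>

lemma u_zero [simp]: "u 0 t x = 1" "u s 0 x = 1"
proof -
  have u00: "u 0 0 y = 1" for y using cocycle by (simp add: normalised_2cocycle_def)
  show "u 0 t x = 1" using u_cocycle[of 0 t 0 x] by (simp add: u00)
  show "u s 0 x = 1" using u_cocycle[of 0 0 s x] by (simp add: u00)
qed

lemma C0_translate:
  assumes "a \<in> C0" shows "(\<lambda>x. a (\<phi> s x)) \<in> C0"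
  unfolding C0_def
proof (intro CollectI conjI allI impI)
  show "continuous_on UNIV (\<lambda>x. a (\<phi> s x))"
    by (intro continuous_on_compose2[OF C0_continuous[OF assms] phi_continuous]) auto
  fix e :: real assume "0 < e"
  then obtain K where K: "compact K" "\<And>x. x \<notin> K \<Longrightarrow> norm (a x) < e"
    using C0_cutoff[OF assms] by blast
  have "norm (a (\<phi> s x)) < e" if "x \<notin> \<phi> (- s) ` K" for x
    using that K(2)[of "\<phi> s x"] by (metis image_eqI phi_cancel(1))
  then show "\<exists>K. compact K \<and> (\<forall>x. x \<notin> K \<longrightarrow> norm (a (\<phi> s x)) < e)"
    using compact_continuous_image[OF phi_continuous K(1)] by blast
qed

lemma translate_inj: "inj (\<lambda>(x, t). (\<phi> s x, s + t))"
  by (auto simp: inj_on_def dest: arg_cong[of _ _ "\<phi> (- s)"])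

lemma regular_summable:
  assumes p: "1 \<le> p" and b: "b \<in> carr (F \<phi> u)" and \<xi>: "\<xi> \<in> carr (little_lp p)"
  shows "(\<lambda>s. norm (b s x * u s (- s + t) x * \<xi> (\<phi> (- s) x, - s + t))) summable_on UNIV"
proof (rule summable_on_comparison_test)
  show "(\<lambda>s. sup_norm (b s) * norm_of (little_lp p) \<xi>) summable_on UNIV"
    by (rule summable_on_cmult_left[OF F_summable[OF b]])
  fix s
  have "norm (\<xi> y) \<le> norm_of (little_lp p) \<xi>" for y
    using lp_count_pointwise_le[of p \<xi> UNIV] p \<xi> by (simp add: little_lp_def)
  then show "norm (b s x * u s (- s + t) x * \<xi> (\<phi> (- s) x, - s + t)) \<le> sup_norm (b s) * norm_of (little_lp p) \<xi>"
    using sup_norm_upper[OF F_carrD[OF b]] sup_norm_nonneg[OF F_carrD[OF b]]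
    by (auto simp: norm_mult intro!: mult_mono)
qed simp

text \<open>A single group element contributes an injective relabelling of the points of
  \<open>X \<times> G\<close>, multiplied by scalars of modulus at most
  \<open>sup_norm a\<close>.\<close>

lemma regular_term:
  assumes p: "1 \<le> p" and a: "a \<in> C0" and \<xi>: "\<xi> \<in> carr (little_lp p)"
  shows "(\<lambda>(x, t). a x * u s (- s + t) x * \<xi> (\<phi> (- s) x, - s + t)) \<in> carr (little_lp p)" (is "?f \<in> _")
    and "norm_of (little_lp p) (\<lambda>(x, t). a x * u s (- s + t) x * \<xi> (\<phi> (- s) x, - s + t))
      \<le> sup_norm a * norm_of (little_lp p) \<xi>"
proof -
  have "(\<Sum>z\<in>S. norm (?f z) powr p) \<le> (sup_norm a * norm_of (little_lp p) \<xi>) powr p"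
    if S: "finite S" for S
  proof -
    let ?j = "\<lambda>(x, t). (\<phi> (- s) x, - s + t)"
    have "(\<Sum>z\<in>S. norm (?f z) powr p) \<le> (\<Sum>z\<in>S. sup_norm a powr p * norm (\<xi> (?j z)) powr p)"
    proof (rule sum_mono, clarsimp)
      fix x t
      have "norm (a x * u s (- s + t) x * \<xi> (\<phi> (- s) x, - s + t)) powr p
          \<le> (sup_norm a * norm (\<xi> (\<phi> (- s) x, - s + t))) powr p"
        using p sup_norm_upper[OF a] by (intro powr_mono2) (auto simp: norm_mult intro!: mult_right_mono)
      then show "norm (a x * u s (- s + t) x * \<xi> (\<phi> (- s) x, - s + t)) powr p
          \<le> sup_norm a powr p * norm (\<xi> (\<phi> (- s) x, - s + t)) powr p"
        using sup_norm_nonneg[OF a] by (simp add: powr_mult)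
    qed
    also have "\<dots> = sup_norm a powr p * (\<Sum>z\<in>?j ` S. norm (\<xi> z) powr p)"
      using inj_on_subset[OF translate_inj[of "- s"], of S]
      by (subst sum.reindex) (auto simp: sum_distrib_left o_def)
    also have "\<dots> \<le> sup_norm a powr p * norm_of (little_lp p) \<xi> powr p"
      using lp_count_finite_sum_le[of p \<xi> UNIV "?j ` S"] p \<xi> S
      by (intro mult_left_mono) (auto simp: little_lp_def)
    finally show ?thesis
      using sup_norm_nonneg[OF a] by (simp add: powr_mult little_lp_def Lp_functions_norm_nonneg)
  qed
  then show "?f \<in> carr (little_lp p)" "norm_of (little_lp p) ?f \<le> sup_norm a * norm_of (little_lp p) \<xi>"
    using lp_count_norm_leI[of p "sup_norm a * norm_of (little_lp p) \<xi>" UNIV ?f] p sup_norm_nonneg[OF a]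
    by (auto simp: little_lp_def Lp_functions_norm_nonneg)
qed

text \<open>Minkowski controls finite partial sums over \<open>s\<close> through
  \<open>regular_term\<close>; on each finite set of points the bound then passes to the infinite
  sum.\<close>

lemma regular_bound:
  assumes p: "1 \<le> p" and b: "b \<in> carr (F \<phi> u)" and \<xi>: "\<xi> \<in> carr (little_lp p)"
  shows "\<Lambda> \<phi> u b \<xi> \<in> carr (little_lp p)"
    and "norm_of (little_lp p) (\<Lambda> \<phi> u b \<xi>) \<le> norm_of (F \<phi> u) b * norm_of (little_lp p) \<xi>"
proof -
  let ?B = "norm_of (F \<phi> u) b * norm_of (little_lp p) \<xi>"
  let ?t = "\<lambda>s (x, t). b s x * u s (- s + t) x * \<xi> (\<phi> (- s) x, - s + t)"
  have fin: "(\<Sum>z\<in>S. norm (\<Sum>s\<in>T. ?t s z) powr p) \<le> ?B powr p" if "finite S" "finite T" for S T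
  proof -
    have c: "?t s \<in> carr (little_lp p)" for s by (rule regular_term(1)[OF p F_carrD[OF b] \<xi>])
    have "norm_of (little_lp p) (\<lambda>z. \<Sum>s\<in>T. ?t s z) \<le> (\<Sum>s\<in>T. norm_of (little_lp p) (?t s))"
      unfolding little_lp_def by (rule Lp_functions_norm_sum_le[OF p]) (use c in \<open>simp add: little_lp_def\<close>)
    also have "\<dots> \<le> (\<Sum>s\<in>T. sup_norm (b s) * norm_of (little_lp p) \<xi>)"
      by (intro sum_mono regular_term(2)[OF p F_carrD[OF b] \<xi>])
    also have "\<dots> = (\<Sum>s\<in>T. sup_norm (b s)) * norm_of (little_lp p) \<xi>"
      by (simp add: sum_distrib_right)
    also have "\<dots> \<le> ?B"
      using that finite_sum_le_infsum[OF F_summable[OF b], of T] sup_norm_nonneg[OF F_carrD[OF b]]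
      by (intro mult_right_mono) (auto simp: F_simps little_lp_def Lp_functions_norm_nonneg)
    finally have "norm_of (little_lp p) (\<lambda>z. \<Sum>s\<in>T. ?t s z) powr p \<le> ?B powr p"
      using p by (intro powr_mono2) (auto simp: little_lp_def Lp_functions_norm_nonneg)
    moreover have "(\<lambda>z. \<Sum>s\<in>T. ?t s z) \<in> carr (little_lp p)"
      unfolding little_lp_def by (rule Lp_functions_sum_closed[OF p]) (use c in \<open>simp add: little_lp_def\<close>)
    ultimately show ?thesis
      using lp_count_finite_sum_le[of p "\<lambda>z. \<Sum>s\<in>T. ?t s z" UNIV S] p that
      by (simp add: little_lp_def)
  qed
  have "(\<Sum>z\<in>S. norm (\<Lambda> \<phi> u b \<xi> z) powr p) \<le> ?B powr p" if S: "finite S" for S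
  \<comment> \<open>Since \<open>S\<close> is finite, pointwise convergence of the partial sums
    suffices.\<close>
  proof (rule tendsto_upperbound)
    have "((\<lambda>T. \<Sum>s\<in>T. ?t s z) \<longlongrightarrow> \<Lambda> \<phi> u b \<xi> z) (finite_subsets_at_top UNIV)" for z
    proof -
      obtain x t where z: "z = (x, t)" by (cases z)
      have "(\<lambda>s. ?t s z) summable_on UNIV"
        using regular_summable[OF p b \<xi>, of x t] by (auto simp: z intro: abs_summable_summable)
      then have "((\<lambda>s. ?t s z) has_sum \<Lambda> \<phi> u b \<xi> z) UNIV"
        using has_sum_infsum by (fastforce simp: \<Lambda>_def z)
      then show ?thesis by (simp add: has_sum_def)
    qed
    then show "((\<lambda>T. \<Sum>z\<in>S. norm (\<Sum>s\<in>T. ?t s z) powr p) \<longlongrightarrow> (\<Sum>z\<in>S. norm (\<Lambda> \<phi> u b \<xi> z) powr p))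
        (finite_subsets_at_top UNIV)"
      using p by (intro tendsto_sum tendsto_powr' tendsto_norm tendsto_const) auto
    show "\<forall>\<^sub>F T in finite_subsets_at_top UNIV. (\<Sum>z\<in>S. norm (\<Sum>s\<in>T. ?t s z) powr p) \<le> ?B powr p"
      using fin[OF S] by (intro eventually_finite_subsets_at_top_weakI)
  qed simp
  then show "\<Lambda> \<phi> u b \<xi> \<in> carr (little_lp p)" "norm_of (little_lp p) (\<Lambda> \<phi> u b \<xi>) \<le> ?B"
    using lp_count_norm_leI[of p ?B UNIV "\<Lambda> \<phi> u b \<xi>"] p F_norm_nonneg[OF b]
    by (auto simp: little_lp_def Lp_functions_norm_nonneg)
qed

lemma regular_apply_summable:
  assumes "1 \<le> p" "b \<in> carr (F \<phi> u)" "\<xi> \<in> carr (little_lp p)"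
  shows "(\<lambda>s. b s x * u s (- s + t) x * \<xi> (\<phi> (- s) x, - s + t)) summable_on UNIV"
  by (rule abs_summable_summable[OF regular_summable[OF assms]])

lemma regular_linear:
  assumes p: "1 \<le> p" and b: "b \<in> carr (F \<phi> u)" and \<xi>: "\<xi> \<in> carr (little_lp p)"
  shows "\<eta> \<in> carr (little_lp p) \<Longrightarrow> \<Lambda> \<phi> u b (\<lambda>z. \<xi> z + \<eta> z) = (\<lambda>z. \<Lambda> \<phi> u b \<xi> z + \<Lambda> \<phi> u b \<eta> z)"
    and "\<Lambda> \<phi> u b (\<lambda>z. c * \<xi> z) = (\<lambda>z. c * \<Lambda> \<phi> u b \<xi> z)"
    and "a \<in> carr (F \<phi> u) \<Longrightarrow> \<Lambda> \<phi> u (\<lambda>g x. a g x + b g x) \<xi> = (\<lambda>z. \<Lambda> \<phi> u a \<xi> z + \<Lambda> \<phi> u b \<xi> z)"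
    and "\<Lambda> \<phi> u (\<lambda>g x. c * b g x) \<xi> = (\<lambda>z. c * \<Lambda> \<phi> u b \<xi> z)"
proof -
  note s = regular_apply_summable[OF p]
  show "\<Lambda> \<phi> u b (\<lambda>z. \<xi> z + \<eta> z) = (\<lambda>z. \<Lambda> \<phi> u b \<xi> z + \<Lambda> \<phi> u b \<eta> z)" if "\<eta> \<in> carr (little_lp p)"
    by (auto simp: \<Lambda>_def ring_distribs infsum_add[OF s[OF b \<xi>] s[OF b that]])
  show "\<Lambda> \<phi> u (\<lambda>g x. a g x + b g x) \<xi> = (\<lambda>z. \<Lambda> \<phi> u a \<xi> z + \<Lambda> \<phi> u b \<xi> z)" if "a \<in> carr (F \<phi> u)"
    by (auto simp: \<Lambda>_def ring_distribs infsum_add[OF s[OF that \<xi>] s[OF b \<xi>]])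
qed (auto simp: \<Lambda>_def mult.assoc mult.left_commute[of _ c] simp flip: infsum_cmult_right')

lemma regular_bounded_operator:
  assumes p: "1 \<le> p" and b: "b \<in> carr (F \<phi> u)"
  shows "\<Lambda> \<phi> u b \<in> bounded_operators (little_lp p)"
proof -
  have "linear_map (little_lp p) (little_lp p) (\<Lambda> \<phi> u b)"
    unfolding linear_map_def
    using regular_bound(1)[OF p b] regular_linear(1,2)[OF p b] by (auto simp: little_lp_def)
  then show ?thesis
    using regular_bound(2)[OF p b] by (auto simp: bounded_operators_def)
qed

text \<open>Both sides are iterated sums of one absolutely summable double family. After the
  substitution r = s + t and an interchange of sums, the cocycle identity matches the scalar
  factors.\<close>

lemma regular_mult:
  assumes p: "1 \<le> p" and a: "a \<in> carr (F \<phi> u)" and b: "b \<in> carr (F \<phi> u)" and \<xi>: "\<xi> \<in> carr (little_lp p)"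
  shows "\<Lambda> \<phi> u (mult_of (F \<phi> u) a b) \<xi> = \<Lambda> \<phi> u a (\<Lambda> \<phi> u b \<xi>)"
proof
  fix z :: "'x \<times> 'g"
  obtain x k where z: "z = (x, k)" by (cases z)
  \<comment> \<open>The summand on the left-hand side, indexed by the two factors \<open>s\<close>,
    \<open>t\<close> instead of their product.\<close>
  define T where "T = (\<lambda>s t. a s x * b t (\<phi> (- s) x) * u s t x * u (s + t) (- (s + t) + k) x
      * \<xi> (\<phi> (- (s + t)) x, - (s + t) + k))"
  have bound: "norm (\<xi> y) \<le> norm_of (little_lp p) \<xi>" for y
    using lp_count_pointwise_le[of p \<xi> UNIV] p \<xi> by (simp add: little_lp_def)
  have sT: "(\<lambda>(s, t). T s t) summable_on UNIV \<times> UNIV"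
  proof (rule abs_summable_summable, rule summable_on_comparison_test)
    let ?N = "norm_of (little_lp p) \<xi>"
    have "(\<lambda>s. sup_norm (b s) * ?N) summable_on UNIV"
      by (rule summable_on_cmult_left[OF F_summable[OF b]])
    have "(\<lambda>(s, t). sup_norm (a s) * (sup_norm (b t) * ?N)) summable_on UNIV \<times> UNIV"
    proof (rule summable_on_SigmaI)
      show "((\<lambda>t. case (s, t) of (s, t) \<Rightarrow> sup_norm (a s) * (sup_norm (b t) * ?N)) has_sum
          sup_norm (a s) * (\<Sum>\<^sub>\<infinity>t. sup_norm (b t) * ?N)) UNIV" for s
        using has_sum_cmult_right[OF has_sum_infsum[OF \<open>(\<lambda>s. sup_norm (b s) * ?N) summable_on UNIV\<close>]]
        by simp
      show "(\<lambda>s. sup_norm (a s) * (\<Sum>\<^sub>\<infinity>t. sup_norm (b t) * ?N)) summable_on UNIV"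
        by (rule summable_on_cmult_left[OF F_summable[OF a]])
      show "0 \<le> (case (s, t) of (s, t) \<Rightarrow> sup_norm (a s) * (sup_norm (b t) * ?N))" for s t
        using sup_norm_nonneg[OF F_carrD[OF a]] sup_norm_nonneg[OF F_carrD[OF b]]
        by (simp add: little_lp_def Lp_functions_norm_nonneg)
    qed
    then show "(\<lambda>(s, t). sup_norm (a s) * (sup_norm (b t) * ?N)) summable_on UNIV \<times> UNIV" .
    fix st :: "'g \<times> 'g"
    show "norm (case st of (s, t) \<Rightarrow> T s t) \<le> (case st of (s, t) \<Rightarrow> sup_norm (a s) * (sup_norm (b t) * ?N))"
      using sup_norm_upper[OF F_carrD[OF a]] sup_norm_upper[OF F_carrD[OF b]] bound
        sup_norm_nonneg[OF F_carrD[OF a]] sup_norm_nonneg[OF F_carrD[OF b]]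
      by (cases st) (auto simp: T_def norm_mult mult.assoc little_lp_def Lp_functions_norm_nonneg intro!: mult_mono)
  qed auto
  have shift: "bij_betw (\<lambda>t. s + t) UNIV UNIV" for s :: 'g
    by (rule bij_betwI[of _ _ _ "\<lambda>t. - s + t"]) (auto simp: add.assoc[symmetric])
  have sT': "(\<lambda>(r, s). T s (- s + r)) summable_on UNIV \<times> UNIV"
  proof -
    have "bij_betw (\<lambda>(r, s). (s, - s + r)) (UNIV \<times> UNIV) (UNIV \<times> (UNIV :: 'g set))"
      by (rule bij_betwI[of _ _ _ "\<lambda>(s, t). (s + t, s)"]) (auto simp: add.assoc[symmetric])
    from summable_on_reindex_bij_betw[OF this, of "\<lambda>(s, t). T s t"] sT show ?thesis
      by (simp add: case_prod_unfold)
  qed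
  have "\<Lambda> \<phi> u (mult_of (F \<phi> u) a b) \<xi> (x, k) = (\<Sum>\<^sub>\<infinity>r. \<Sum>\<^sub>\<infinity>s. T s (- s + r))"
  proof -
    have "(\<Sum>\<^sub>\<infinity>(s, t)\<in>{(s, t). s + t = r}. a s x * \<alpha> \<phi> s (b t) x * u s t x) * u r (- r + k) x * \<xi> (\<phi> (- r) x, - r + k)
        = (\<Sum>\<^sub>\<infinity>s. T s (- s + r))" for r
    proof -
      have bij: "bij_betw (\<lambda>s. (s, - s + r)) UNIV {(s, t). s + t = r}"
        by (rule bij_betwI[of _ _ _ fst]) (auto simp: add.assoc[symmetric])
      show ?thesis
        unfolding infsum_reindex_bij_betw[OF bij, symmetric] infsum_cmult_left'[symmetric]
        by (simp add: T_def \<alpha>_def add.assoc[symmetric])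
    qed
    then show ?thesis by (simp add: \<Lambda>_def F_simps)
  qed
  also have "\<dots> = (\<Sum>\<^sub>\<infinity>s. \<Sum>\<^sub>\<infinity>r. T s (- s + r))"
    using infsum_swap_banach[OF sT'] by simp
  also have "\<dots> = (\<Sum>\<^sub>\<infinity>s. \<Sum>\<^sub>\<infinity>t. T s t)"
  proof (rule infsum_cong)
    fix s
    show "(\<Sum>\<^sub>\<infinity>r. T s (- s + r)) = (\<Sum>\<^sub>\<infinity>t. T s t)"
      using infsum_reindex_bij_betw[OF shift[of "- s"], of "T s"] by simp
  qed
  also have "\<dots> = \<Lambda> \<phi> u a (\<Lambda> \<phi> u b \<xi>) (x, k)"
  proof -
    have uc: "u s t x * u (s + t) (- t - s + k) x = u s (- s + k) x * u t (- t - s + k) (\<phi> (- s) x)" for s t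
    proof -
      have "t + (- t - s + k) = - s + k"
        by (simp only: diff_conv_add_uminus add.assoc[symmetric] right_minus add_0_left)
      then show ?thesis using u_cocycle[of t "- t - s + k" s x] by (metis mult.commute)
    qed
    have "T s t = a s x * u s (- s + k) x * (b t (\<phi> (- s) x) * u t (- t + (- s + k)) (\<phi> (- s) x)
        * \<xi> (\<phi> (- t) (\<phi> (- s) x), - t + (- s + k)))" for s t
      using uc[of s t]
      by (simp add: T_def minus_add add.assoc phi_add[symmetric])
        (simp add: add.assoc[symmetric] mult.assoc mult.left_commute)
    then show ?thesis by (simp add: \<Lambda>_def infsum_cmult_right')
  qed
  finally show "\<Lambda> \<phi> u (mult_of (F \<phi> u) a b) \<xi> z = \<Lambda> \<phi> u a (\<Lambda> \<phi> u b \<xi>) z" by (simp add: z)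
qed

lemma reduced_norm_le:
  "1 \<le> p \<Longrightarrow> b \<in> carr (F \<phi> u) \<Longrightarrow> reduced_norm p \<phi> u b \<le> norm_of (F \<phi> u) b"
  unfolding reduced_norm_def
  by (rule complex_seminormed_space.operator_norm_le)
     (auto simp: F_norm_nonneg regular_bound intro: Lp_functions_seminormed[of p "count_space UNIV", folded little_lp_def])

lemma reduced_norm_nonneg:
  "1 \<le> p \<Longrightarrow> b \<in> carr (F \<phi> u) \<Longrightarrow> 0 \<le> reduced_norm p \<phi> u b"
  unfolding reduced_norm_def
  by (rule complex_seminormed_space.operator_norm_nonneg[OF _ regular_bounded_operator])
     (auto intro: Lp_functions_seminormed[of p "count_space UNIV", folded little_lp_def])

lemma reduced_norm_apply:
  assumes "1 \<le> p" "b \<in> carr (F \<phi> u)" "\<xi> \<in> carr (little_lp p)"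
  shows "norm_of (little_lp p) (\<Lambda> \<phi> u b \<xi>) \<le> reduced_norm p \<phi> u b * norm_of (little_lp p) \<xi>"
  unfolding reduced_norm_def
  by (rule complex_seminormed_space.operator_norm_apply[OF _ regular_bounded_operator])
     (use assms in \<open>auto intro: Lp_functions_seminormed[of p "count_space UNIV", folded little_lp_def]\<close>)

lemma F_red_seminormed:
  assumes p: "1 \<le> p"
  shows "complex_seminormed_space (F_red p \<phi> u)"
proof -
  interpret L: complex_seminormed_space "little_lp p :: ('x \<times> 'g \<Rightarrow> complex) cspace"
    unfolding little_lp_def by (rule Lp_functions_seminormed[OF p])
  have [simp]: "carr (F_red p \<phi> u) = carr (F \<phi> u)" "zero_of (F_red p \<phi> u) = (\<lambda>_ _. 0)"
    "add_of (F_red p \<phi> u) = (\<lambda>a b g x. a g x + b g x)" "scale_of (F_red p \<phi> u) = (\<lambda>c b g x. c * b g x)"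
    "norm_of (F_red p \<phi> u) = reduced_norm p \<phi> u"
    by (simp_all add: F_red_def F_simps)
  have tri: "reduced_norm p \<phi> u (\<lambda>g x. a g x + b g x) \<le> reduced_norm p \<phi> u a + reduced_norm p \<phi> u b"
    if "a \<in> carr (F \<phi> u)" "b \<in> carr (F \<phi> u)" for a b
    unfolding reduced_norm_def[of p \<phi> u "\<lambda>g x. a g x + b g x"]
  proof (rule L.operator_norm_le)
    show "0 \<le> reduced_norm p \<phi> u a + reduced_norm p \<phi> u b"
      using reduced_norm_nonneg[OF p] that by (intro add_nonneg_nonneg) auto
    fix \<xi> assume \<xi>: "\<xi> \<in> carr (little_lp p :: ('x \<times> 'g \<Rightarrow> complex) cspace)"
    have "norm_of (little_lp p) (\<lambda>z. \<Lambda> \<phi> u a \<xi> z + \<Lambda> \<phi> u b \<xi> z)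
        \<le> norm_of (little_lp p) (\<Lambda> \<phi> u a \<xi>) + norm_of (little_lp p) (\<Lambda> \<phi> u b \<xi>)"
      using L.norm_triangle[OF regular_bound(1)[OF p that(1) \<xi>] regular_bound(1)[OF p that(2) \<xi>]]
      by (simp add: little_lp_def)
    also have "\<dots> \<le> (reduced_norm p \<phi> u a + reduced_norm p \<phi> u b) * norm_of (little_lp p) \<xi>"
      using reduced_norm_apply[OF p that(1) \<xi>] reduced_norm_apply[OF p that(2) \<xi>] by (simp add: ring_distribs)
    finally show "norm_of (little_lp p) (\<Lambda> \<phi> u (\<lambda>g x. a g x + b g x) \<xi>)
        \<le> (reduced_norm p \<phi> u a + reduced_norm p \<phi> u b) * norm_of (little_lp p) \<xi>"
      by (simp add: regular_linear(3)[OF p that(2) \<xi> that(1)])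
  qed
  have scale_le: "reduced_norm p \<phi> u (\<lambda>g x. c * b g x) \<le> norm c * reduced_norm p \<phi> u b"
    if b: "b \<in> carr (F \<phi> u)" for b c
    unfolding reduced_norm_def[of p \<phi> u "\<lambda>g x. c * b g x"]
  proof (rule L.operator_norm_le)
    show "0 \<le> norm c * reduced_norm p \<phi> u b"
      using reduced_norm_nonneg[OF p b] by simp
    fix \<xi> assume \<xi>: "\<xi> \<in> carr (little_lp p :: ('x \<times> 'g \<Rightarrow> complex) cspace)"
    show "norm_of (little_lp p) (\<Lambda> \<phi> u (\<lambda>g x. c * b g x) \<xi>)
        \<le> norm c * reduced_norm p \<phi> u b * norm_of (little_lp p) \<xi>"
      using reduced_norm_apply[OF p b \<xi>] L.norm_scale[OF regular_bound(1)[OF p b \<xi>], of c]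
      by (simp add: regular_linear(4)[OF p b \<xi>] mult.assoc mult_left_mono little_lp_def)
  qed
  have scale: "reduced_norm p \<phi> u (\<lambda>g x. c * b g x) = norm c * reduced_norm p \<phi> u b"
    if b: "b \<in> carr (F \<phi> u)" for b c
  proof (cases "c = 0")
    case True
    then show ?thesis
      using scale_le[OF b, of 0] reduced_norm_nonneg[OF p F_zero_closed] by simp
  next
    case False
    \<comment> \<open>The inequality already proved, applied to the factor \<open>1 / c\<close>,
      reverses itself.\<close>
    have "reduced_norm p \<phi> u b \<le> norm (1 / c) * reduced_norm p \<phi> u (\<lambda>g x. c * b g x)"
      using scale_le[OF F_scale_closed[OF b, of c], of "1 / c"] False by simp
    then have "norm c * reduced_norm p \<phi> u b \<le> reduced_norm p \<phi> u (\<lambda>g x. c * b g x)"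
      using False by (simp add: norm_divide field_simps)
    then show ?thesis using scale_le[OF b, of c] by simp
  qed
  show ?thesis
    by unfold_locales
      (simp_all add: F_zero_closed F_add_closed F_scale_closed tri scale diff_of_def algebra_simps)
qed

end

section \<open>Amenability\<close>

text \<open>Directedness makes the tails a filter base, so one tail decides whether a property holds
  eventually.\<close>

lemma eventually_tails:
  assumes "directed_set I le"
  shows "eventually P (tails I le) \<longleftrightarrow> (\<exists>i\<in>I. \<forall>j\<in>I. le i j \<longrightarrow> P j)"
proof -
  have "eventually P (tails I le) \<longleftrightarrow> (\<exists>i\<in>I. eventually P (principal {j \<in> I. le i j}))"
    unfolding tails_def
  proof (rule eventually_INF_base)
    show "I \<noteq> {}" using assms by (simp add: directed_set_def)
    fix i j assume ij: "i \<in> I" "j \<in> I"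
    then obtain k where k: "k \<in> I" "le i k" "le j k" using assms unfolding directed_set_def by blast
    then have "{l \<in> I. le k l} \<subseteq> {l \<in> I. le i l} \<inter> {l \<in> I. le j l}"
      using assms ij unfolding directed_set_def by blast
    then show "\<exists>x\<in>I. principal {j \<in> I. le x j} \<le> inf (principal {j \<in> I. le i j}) (principal {l \<in> I. le j l})"
      using k(1) by (intro bexI[of _ k]) (auto simp: inf_principal)
  qed
  then show ?thesis by (auto simp: eventually_principal)
qed

lemma eventually_tails_obtain:
  assumes "directed_set I le" "eventually P (tails I le)"
  obtains i where "i \<in> I" "P i"
proof -
  obtain i where "i \<in> I" "\<forall>j\<in>I. le i j \<longrightarrow> P j" using assms by (auto simp: eventually_tails)
  moreover have "le i i" using assms(1) \<open>i \<in> I\<close> by (simp add: directed_set_def)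
  ultimately show thesis using that by blast
qed

lemma infsum_finite_support:
  fixes f :: "'a \<Rightarrow> 'b::{t2_space, topological_comm_monoid_add}"
  assumes "finite S" "\<And>x. x \<notin> S \<Longrightarrow> f x = 0"
  shows "infsum f UNIV = sum f S"
  using infsum_cong_neutral[of S UNIV f f] assms by simp

lemma Cc_nonneg_zero_outside:
  assumes "a \<in> Cc_nonneg"
  obtains K where "compact K" "\<And>x. x \<notin> K \<Longrightarrow> a x = 0"
proof (rule that[of "closure {x. a x \<noteq> 0}"])
  show "compact (closure {x. a x \<noteq> 0})" using assms by (simp add: Cc_nonneg_def)
  show "a x = 0" if "x \<notin> closure {x. a x \<noteq> 0}" for x
    using that closure_subset[of "{x. a x \<noteq> 0}"] by auto
qed

context twisted_action
begin

text \<open>A single index of the net serves the finite set \<open>S\<close> and the compact set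
  \<open>K\<close> simultaneously, and all sums over the group become finite.\<close>

lemma amenable_approximation:
  assumes amen: "amenable_action TYPE('i) \<phi>" and S: "finite S" and K: "compact K" and e: "0 < e"
  obtains R and f :: "'g \<Rightarrow> 'x \<Rightarrow> real" where "finite R" "\<And>t. f t \<in> Cc_nonneg"
    "\<And>t x. t \<notin> R \<Longrightarrow> f t x = 0"
    "\<And>x. x \<in> K \<Longrightarrow> \<bar>(\<Sum>t\<in>R. f t x) - 1\<bar> < e"
    "\<And>x s. x \<in> K \<Longrightarrow> s \<in> S \<Longrightarrow> \<bar>(\<Sum>t\<in>R. f t (\<phi> (- s) x)) - 1\<bar> < e"
    "\<And>x s. x \<in> K \<Longrightarrow> s \<in> S \<Longrightarrow>
      (\<Sum>t\<in>R \<union> (\<lambda>t. - s + t) ` R. \<bar>f t (\<phi> (- s) x) - f (s + t) x\<bar>) < e"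
proof -
  obtain I :: "'i set" and le and f :: "'i \<Rightarrow> 'g \<Rightarrow> 'x \<Rightarrow> real" where dir: "directed_set I le"
    and finCc: "\<forall>i\<in>I. finite {t. f i t \<noteq> (\<lambda>_. 0)} \<and> (\<forall>t. f i t \<in> Cc_nonneg)"
    and one': "\<forall>K. compact K \<longrightarrow>
      uniform_limit K (\<lambda>i x. \<Sum>\<^sub>\<infinity>t\<in>UNIV. f i t x) (\<lambda>_. 1) (tails I le)"
    and inv': "\<forall>s K. compact K \<longrightarrow>
      uniform_limit K (\<lambda>i x. \<Sum>\<^sub>\<infinity>t\<in>UNIV. \<bar>\<alpha> \<phi> s (f i t) x - f i (s + t) x\<bar>) (\<lambda>_. 0) (tails I le)"
    using amen unfolding amenable_action_def by (elim exE conjE) (rule that; assumption)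
  note one = one'[rule_format] and inv = inv'[rule_format]
  \<comment> \<open>The total mass is also evaluated at the points \<open>\<phi> (- s) x\<close>, so
    it must be close to 1 on these translates too.\<close>
  let ?L = "K \<union> (\<Union>s\<in>S. \<phi> (- s) ` K)"
  have L: "compact ?L"
    using S K by (intro compact_Un compact_UN) (auto intro: compact_continuous_image phi_continuous)
  have "\<forall>\<^sub>F i in tails I le. \<forall>x\<in>?L. dist (\<Sum>\<^sub>\<infinity>t\<in>UNIV. f i t x) 1 < e"
    using one[OF L] e by (rule uniform_limitD)
  moreover have "\<forall>\<^sub>F i in tails I le. \<forall>s\<in>S. \<forall>x\<in>K.
      dist (\<Sum>\<^sub>\<infinity>t\<in>UNIV. \<bar>\<alpha> \<phi> s (f i t) x - f i (s + t) x\<bar>) 0 < e"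
    using inv[OF K] e by (intro eventually_ball_finite[OF S] ballI uniform_limitD)
  ultimately have ev: "\<forall>\<^sub>F i in tails I le. (\<forall>x\<in>?L. dist (\<Sum>\<^sub>\<infinity>t\<in>UNIV. f i t x) 1 < e)
      \<and> (\<forall>s\<in>S. \<forall>x\<in>K. dist (\<Sum>\<^sub>\<infinity>t\<in>UNIV. \<bar>\<alpha> \<phi> s (f i t) x - f i (s + t) x\<bar>) 0 < e)"
    by (rule eventually_conj)
  obtain i where i: "i \<in> I" and 1: "\<And>x. x \<in> ?L \<Longrightarrow> dist (\<Sum>\<^sub>\<infinity>t\<in>UNIV. f i t x) 1 < e"
    and 2: "\<And>s x. s \<in> S \<Longrightarrow> x \<in> K \<Longrightarrow> dist (\<Sum>\<^sub>\<infinity>t\<in>UNIV. \<bar>\<alpha> \<phi> s (f i t) x - f i (s + t) x\<bar>) 0 < e"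
    by (rule eventually_tails_obtain[OF dir ev]) blast
  define R where "R = {t. f i t \<noteq> (\<lambda>_. 0)}"
  have R: "finite R" "f i t x = 0" if "t \<notin> R" for t x
    using finCc i that by (auto simp: R_def)
  have fR: "finite R" using finCc i by (simp add: R_def)
  have sum1: "(\<Sum>\<^sub>\<infinity>t\<in>UNIV. f i t x) = (\<Sum>t\<in>R. f i t x)" for x
    using fR R by (intro infsum_finite_support) auto
  \<comment> \<open>The window contains every \<open>t\<close> for which \<open>f i t\<close> or
    \<open>f i (s + t)\<close> is not the zero function.\<close>
  have sum2: "(\<Sum>\<^sub>\<infinity>t\<in>UNIV. \<bar>\<alpha> \<phi> s (f i t) x - f i (s + t) x\<bar>)
      = (\<Sum>t\<in>R \<union> (\<lambda>t. - s + t) ` R. \<bar>f i t (\<phi> (- s) x) - f i (s + t) x\<bar>)" for s x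
  proof (subst infsum_finite_support[of "R \<union> (\<lambda>t. - s + t) ` R"])
    fix t assume t: "t \<notin> R \<union> (\<lambda>t. - s + t) ` R"
    have "s + t \<notin> R"
    proof
      assume "s + t \<in> R"
      then have "- s + (s + t) \<in> (\<lambda>t. - s + t) ` R" by blast
      then show False using t by (simp add: add.assoc[symmetric])
    qed
    then show "\<bar>\<alpha> \<phi> s (f i t) x - f i (s + t) x\<bar> = 0" using R(2) t by (simp add: \<alpha>_def)
  qed (use fR in \<open>auto simp: \<alpha>_def\<close>)
  show thesis
  proof (rule that[of R "f i"])
    show "(\<Sum>t\<in>R \<union> (\<lambda>t. - s + t) ` R. \<bar>f i t (\<phi> (- s) x) - f i (s + t) x\<bar>) < e"
      if "x \<in> K" "s \<in> S" for x s
      using 2[OF that(2,1)] unfolding sum2 by (simp add: dist_real_def)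
    show "\<bar>(\<Sum>t\<in>R. f i t (\<phi> (- s) x)) - 1\<bar> < e" if "x \<in> K" "s \<in> S" for x s
      using 1[of "\<phi> (- s) x"] that by (auto simp: sum1 dist_real_def)
  qed (use fR R finCc i 1 in \<open>auto simp: sum1 dist_real_def\<close>)
qed

text \<open>The cutoff is made from the amenability net: its total mass exceeds 1/2 on
  \<open>K\<close>, so doubling and truncating at 1 gives 1 there, with compact support.\<close>

lemma amenable_cutoff:
  assumes amen: "amenable_action TYPE('i) \<phi>" and K: "compact K"
  obtains c :: "'x \<Rightarrow> real" and K' where "continuous_on UNIV c" "\<And>x. 0 \<le> c x" "\<And>x. c x \<le> 1"
    "\<And>x. x \<in> K \<Longrightarrow> c x = 1" "compact K'" "\<And>x. x \<notin> K' \<Longrightarrow> c x = 0"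
proof -
  have half: "(0::real) < 1 / 2" by simp
  obtain R and f :: "'g \<Rightarrow> 'x \<Rightarrow> real" where R: "finite R" and Cc: "\<And>t. f t \<in> Cc_nonneg"
    and one: "\<And>x. x \<in> K \<Longrightarrow> \<bar>(\<Sum>t\<in>R. f t x) - 1\<bar> < 1 / 2"
    by (rule amenable_approximation[OF amen finite.emptyI K half]) blast
  have "\<forall>t. \<exists>L. compact L \<and> (\<forall>x. x \<notin> L \<longrightarrow> f t x = 0)"
    using Cc Cc_nonneg_zero_outside by metis
  then obtain L where L: "\<And>t. compact (L t)" "\<And>t x. x \<notin> L t \<Longrightarrow> f t x = 0" by metis
  have cont: "continuous_on UNIV (f t)" and nonneg: "0 \<le> f t x" for t x
    using Cc[of t] by (auto simp: Cc_nonneg_def)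
  show thesis
  proof (rule that[of "\<lambda>x. min 1 (2 * (\<Sum>t\<in>R. f t x))" "\<Union>t\<in>R. L t"])
    show "min 1 (2 * (\<Sum>t\<in>R. f t x)) = 1" if "x \<in> K" for x
      using one[OF that] by (auto simp: min_def abs_if split: if_splits)
  qed (use R L nonneg in \<open>auto intro!: continuous_intros cont compact_UN sum_nonneg\<close>)
qed

text \<open>Dividing by the maximum of 1 and the total mass bounds the sum by 1 everywhere and keeps
  continuity, while at the points concerned the divisor stays below \<open>1 + d\<close>. The
  overlap is measured by \<open>min\<close> because that bounds the geometric means used as
  coefficients from below.\<close>

lemma amenable_normalised:
  assumes amen: "amenable_action TYPE('i) \<phi>" and S: "finite S" and K: "compact K" and e: "0 < e"
  obtains R and g :: "'g \<Rightarrow> 'x \<Rightarrow> real" where "finite R" "\<And>t. g t \<in> Cc_nonneg"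
    "\<And>t x. t \<notin> R \<Longrightarrow> g t x = 0" "\<And>x. (\<Sum>t\<in>R. g t x) \<le> 1"
    "\<And>s x. s \<in> S \<Longrightarrow> x \<in> K \<Longrightarrow> 1 - e \<le> (\<Sum>r\<in>R. min (g (s + r) x) (g r (\<phi> (- s) x)))"
proof -
  \<comment> \<open>The overlap before normalisation is at least \<open>(2 - 3 * d) / 2\<close>;
    division by \<open>1 + d\<close> still leaves at least \<open>1 - 3 * d\<close>.\<close>
  define d where "d = e / 3"
  have d: "0 < d" using e by (simp add: d_def)
  obtain R and f :: "'g \<Rightarrow> 'x \<Rightarrow> real" where R: "finite R" and Cc: "\<And>t. f t \<in> Cc_nonneg"
    and fR: "\<And>t x. t \<notin> R \<Longrightarrow> f t x = 0"
    and one: "\<And>x. x \<in> K \<Longrightarrow> \<bar>(\<Sum>t\<in>R. f t x) - 1\<bar> < d"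
    and one': "\<And>x s. x \<in> K \<Longrightarrow> s \<in> S \<Longrightarrow> \<bar>(\<Sum>t\<in>R. f t (\<phi> (- s) x)) - 1\<bar> < d"
    and inv: "\<And>x s. x \<in> K \<Longrightarrow> s \<in> S \<Longrightarrow>
      (\<Sum>t\<in>R \<union> (\<lambda>t. - s + t) ` R. \<bar>f t (\<phi> (- s) x) - f (s + t) x\<bar>) < d"
    by (rule amenable_approximation[OF amen S K d]) blast
  have cont: "continuous_on UNIV (f t)" and nonneg: "0 \<le> f t x" for t x
    using Cc[of t] by (auto simp: Cc_nonneg_def)
  define \<sigma> where "\<sigma> = (\<lambda>x. \<Sum>t\<in>R. f t x)"
  define g where "g = (\<lambda>t x. f t x / max 1 (\<sigma> x))"
  show thesis
  proof (rule that[of R g])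
    show "finite R" by (rule R)
    show "g t x = 0" if "t \<notin> R" for t x using fR[OF that] by (simp add: g_def)
    show "g t \<in> Cc_nonneg" for t
    proof -
      have "{x. g t x \<noteq> 0} = {x. f t x \<noteq> 0}" by (auto simp: g_def max_def)
      moreover have "continuous_on UNIV (g t)" unfolding g_def \<sigma>_def
        by (intro continuous_intros cont) (auto simp: max_def)
      ultimately show ?thesis using Cc[of t] nonneg by (simp add: Cc_nonneg_def g_def)
    qed
    show "(\<Sum>t\<in>R. g t x) \<le> 1" for x
      unfolding g_def sum_divide_distrib[symmetric] by (simp add: \<sigma>_def)
    fix s x assume s: "s \<in> S" and x: "x \<in> K"
    define y where "y = \<phi> (- s) x"
    \<comment> \<open>A window on which both the sum of \<open>f (s + r) x\<close> and that of
      \<open>f r y\<close> are complete. The overlap then follows from min(a,b) = (a + b - |a - b|)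
      / 2.\<close>
    let ?R = "R \<union> (\<lambda>t. - s + t) ` R"
    have fin: "finite ?R" using R by simp
    have sx: "\<bar>\<sigma> x - 1\<bar> < d" "\<bar>\<sigma> y - 1\<bar> < d"
      using one[OF x] one'[OF x s] by (simp_all add: \<sigma>_def y_def)
    have "(\<Sum>r\<in>?R. f (s + r) x) = (\<Sum>r\<in>(\<lambda>r. s + r) ` ?R. f r x)"
      by (subst sum.reindex) (auto simp: inj_on_def)
    also have "\<dots> = (\<Sum>r\<in>R. f r x)"
    proof (rule sum.mono_neutral_right)
      have "r \<in> (\<lambda>r. s + r) ` ?R" if "r \<in> R" for r
        using that by (intro image_eqI[of _ _ "- s + r"]) (auto simp: add.assoc[symmetric])
      then show "R \<subseteq> (\<lambda>r. s + r) ` ?R" by blast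
    qed (use fin fR in auto)
    finally have A: "(\<Sum>r\<in>?R. f (s + r) x) = \<sigma> x" by (simp add: \<sigma>_def)
    have B: "(\<Sum>r\<in>?R. f r y) = \<sigma> y"
      unfolding \<sigma>_def using fin fR by (intro sum.mono_neutral_right) auto
    have "(\<Sum>r\<in>R. min (f (s + r) x) (f r y)) = (\<Sum>r\<in>?R. min (f (s + r) x) (f r y))"
      using fin fR nonneg by (intro sum.mono_neutral_left) (auto simp: min_def intro: antisym)
    also have "\<dots> = (\<Sum>r\<in>?R. (f (s + r) x + f r y - \<bar>f r y - f (s + r) x\<bar>) / 2)"
      by (intro sum.cong) (auto simp: min_def abs_if field_simps)
    also have "\<dots> = (\<sigma> x + \<sigma> y - (\<Sum>r\<in>?R. \<bar>f r y - f (s + r) x\<bar>)) / 2"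
      unfolding A[symmetric] B[symmetric] by (simp add: sum_divide_distrib[symmetric] sum.distrib sum_subtractf)
    also have "\<dots> \<ge> (2 - 3 * d) / 2"
      using inv[OF x s] sx by (simp add: y_def[symmetric] abs_less_iff)
    finally have m: "(2 - 3 * d) / 2 \<le> (\<Sum>r\<in>R. min (f (s + r) x) (f r y))" .
    have "1 - e \<le> (2 - 3 * d) / 2 / (1 + d)"
      using d by (simp add: pos_le_divide_eq) (simp add: d_def algebra_simps)
    also have "\<dots> \<le> (\<Sum>r\<in>R. min (f (s + r) x) (f r y)) / (1 + d)"
      using m d by (intro divide_right_mono) auto
    also have "\<dots> \<le> (\<Sum>r\<in>R. min (g (s + r) x) (g r y))"
      unfolding sum_divide_distrib
    proof (rule sum_mono)
      fix r
      have "min (f (s + r) x) (f r y) / (1 + d) \<le> f (s + r) x / max 1 (\<sigma> x)"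
        using sx nonneg d by (intro frac_le) (auto simp: abs_less_iff)
      moreover have "min (f (s + r) x) (f r y) / (1 + d) \<le> f r y / max 1 (\<sigma> y)"
        using sx nonneg d by (intro frac_le) (auto simp: abs_less_iff)
      ultimately show "min (f (s + r) x) (f r y) / (1 + d) \<le> min (g (s + r) x) (g r y)"
        by (simp add: g_def)
    qed
    finally show "1 - e \<le> (\<Sum>r\<in>R. min (g (s + r) x) (g r (\<phi> (- s) x)))" by (simp add: y_def)
  qed
qed

end

section \<open>A partition of unity adapted to finitely many functions\<close>

text \<open>The weights need not sum to 1: the remaining weight \<open>g0\<close> is positive only
  where all \<open>a i\<close> are small, so omitting it costs little. This is what makes finitely
  many compactly supported weights enough.\<close>

lemma C0_partition:
  fixes a :: "'i \<Rightarrow> 'x::t2_space \<Rightarrow> complex"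
  assumes I: "finite I" and a: "\<And>i. i \<in> I \<Longrightarrow> a i \<in> C0" and d: "0 < \<delta>"
  obtains J :: "'x set" and h :: "'x \<Rightarrow> 'x \<Rightarrow> real" and K where "finite J"
    "\<And>y. continuous_on UNIV (h y)" "\<And>y x. 0 \<le> h y x" "\<And>x. (\<Sum>y\<in>J. h y x) \<le> 1"
    "compact K" "\<And>y x. y \<in> J \<Longrightarrow> x \<notin> K \<Longrightarrow> h y x = 0"
    "\<And>i x. i \<in> I \<Longrightarrow> norm ((\<Sum>y\<in>J. h y x * a i y) - a i x) \<le> \<delta>"
proof -
  define \<epsilon> where "\<epsilon> = \<delta> / 2"
  have e: "0 < \<epsilon>" using d by (simp add: \<epsilon>_def)
  define N where "N = (\<lambda>x. \<Sum>i\<in>I. norm (a i x))"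
  define D where "D = (\<lambda>x y. \<Sum>i\<in>I. norm (a i x - a i y))"
  have contN: "continuous_on UNIV N" and contD: "continuous_on UNIV (\<lambda>x. D x y)" for y
    unfolding N_def D_def by (intro continuous_intros; simp add: a C0_continuous)+
  have ND: "N y \<le> N x + D x y" for x y
    unfolding N_def D_def sum.distrib[symmetric]
    by (rule sum_mono) (metis norm_minus_commute norm_triangle_sub)
  \<comment> \<open>With the divisor \<open>card I + 1\<close> the sum over \<open>I\<close> is
    strictly below \<open>\<epsilon>\<close>, and an empty \<open>I\<close> causes no division by
    zero.\<close>
  have "\<forall>i\<in>I. \<exists>K. compact K \<and> (\<forall>x. x \<notin> K \<longrightarrow> norm (a i x) < \<epsilon> / (card I + 1))"
  proof
    fix i assume "i \<in> I"
    have "0 < \<epsilon> / (card I + 1)" using e by simp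
    from C0_cutoff[OF a[OF \<open>i \<in> I\<close>] this]
    show "\<exists>K. compact K \<and> (\<forall>x. x \<notin> K \<longrightarrow> norm (a i x) < \<epsilon> / (card I + 1))" by metis
  qed
  then obtain L where L: "\<And>i. i \<in> I \<Longrightarrow> compact (L i)"
      "\<And>i x. i \<in> I \<Longrightarrow> x \<notin> L i \<Longrightarrow> norm (a i x) < \<epsilon> / (card I + 1)"
    by metis
  define K where "K = (\<Union>i\<in>I. L i)"
  have K: "compact K" unfolding K_def using I L by (intro compact_UN) auto
  have NK: "N x < \<epsilon>" if "x \<notin> K" for x
  proof -
    have "N x \<le> (\<Sum>i\<in>I. \<epsilon> / (card I + 1))"
      unfolding N_def using that L(2) by (intro sum_mono) (auto simp: K_def less_imp_le)
    also have "\<dots> < \<epsilon>" using e by (simp add: divide_less_eq algebra_simps)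
    finally show ?thesis .
  qed
  \<comment> \<open>The threshold is twice the bound for \<open>N\<close> outside \<open>K\<close>.
    The gap makes \<open>C\<close> a compact subset of \<open>K\<close> and later forces the weights
    to vanish outside \<open>K\<close>.\<close>
  define C where "C = {x. 2 * \<epsilon> \<le> N x}"
  have "closed C" unfolding C_def
    by (intro closed_Collect_le contN continuous_on_const)
  moreover have "C \<subseteq> K" using NK e unfolding C_def by (force simp: not_le)
  ultimately have "compact C" using K by (metis closed_Int_compact inf.absorb_iff1)
  moreover have "open {x. D x y < \<epsilon>}" for y
    by (intro open_Collect_less contD continuous_on_const)
  moreover have "C \<subseteq> (\<Union>y\<in>C. {x. D x y < \<epsilon>})"
    using e by (auto simp: D_def)
  ultimately obtain J where J: "J \<subseteq> C" "finite J" "C \<subseteq> (\<Union>y\<in>J. {x. D x y < \<epsilon>})"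
    using compactE_image[of C C "\<lambda>y. {x. D x y < \<epsilon>}"] by blast
  \<comment> \<open>Positive exactly off \<open>C\<close>; on \<open>C\<close> the finite cover
    supplies a positive \<open>g y\<close>. Hence the divisor \<open>\<sigma>\<close> never
    vanishes.\<close>
  define g0 where "g0 = (\<lambda>x. max 0 (2 * \<epsilon> - N x))"
  define g where "g = (\<lambda>y x. max 0 (\<epsilon> - D x y))"
  define \<sigma> where "\<sigma> = (\<lambda>x. g0 x + (\<Sum>y\<in>J. g y x))"
  have g: "0 \<le> g0 x" "0 \<le> g y x" for x y by (simp_all add: g0_def g_def)
  have pos: "0 < \<sigma> x" for x
  proof (cases "x \<in> C")
    case True
    then obtain y where y: "y \<in> J" "D x y < \<epsilon>" using J by auto
    have "0 < g y x" using y by (simp add: g_def)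
    also have "\<dots> \<le> (\<Sum>y\<in>J. g y x)" using y J g by (intro member_le_sum) auto
    finally show ?thesis using g(1)[of x] by (simp add: \<sigma>_def)
  next
    case False
    then have "0 < g0 x" by (simp add: C_def g0_def)
    moreover have "0 \<le> (\<Sum>y\<in>J. g y x)" using g by (intro sum_nonneg) auto
    ultimately show ?thesis by (simp add: \<sigma>_def)
  qed
  have contg: "continuous_on UNIV g0" "continuous_on UNIV (g y)" for y
    unfolding g0_def g_def by (intro continuous_intros contN contD)+
  define h where "h = (\<lambda>y x. g y x / \<sigma> x)"
  show thesis
  proof (rule that[of J h K])
    show "finite J" by (rule J)
    show "compact K" by (rule K)
    show "continuous_on UNIV (h y)" for y
      unfolding h_def \<sigma>_def using pos
      by (intro continuous_intros contg) (auto simp: \<sigma>_def less_le)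
    show "0 \<le> h y x" for x y using g pos[of x] by (simp add: h_def)
    have sumh: "(\<Sum>y\<in>J. h y x) + g0 x / \<sigma> x = 1" for x
      using pos[of x] by (simp add: h_def sum_divide_distrib[symmetric] add_divide_distrib[symmetric])
        (simp add: \<sigma>_def add.commute)
    moreover have "0 \<le> g0 x / \<sigma> x" for x using g pos[of x] by simp
    ultimately show "(\<Sum>y\<in>J. h y x) \<le> 1" for x
      by (metis add_increasing2 add_le_cancel_left order_refl add.commute le_add_same_cancel2)
    show "h y x = 0" if "y \<in> J" "x \<notin> K" for x y
    proof -
      have "2 * \<epsilon> \<le> N y" using J that by (auto simp: C_def)
      then have "\<epsilon> \<le> D x y" using ND[of y x] NK[OF that(2)] by simp
      then show ?thesis by (simp add: h_def g_def)
    qed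
    fix i x assume i: "i \<in> I"
    let ?S = "(\<Sum>y\<in>J. complex_of_real (h y x) * (a i y - a i x)) - complex_of_real (g0 x / \<sigma> x) * a i x"
    have "(\<Sum>y\<in>J. complex_of_real (h y x)) + complex_of_real (g0 x / \<sigma> x) = 1"
      using sumh[of x] by (metis of_real_1 of_real_add of_real_sum)
    then have one: "complex_of_real (g0 x / \<sigma> x) = 1 - (\<Sum>y\<in>J. complex_of_real (h y x))"
      by (simp add: algebra_simps)
    \<comment> \<open>The complementary weight \<open>g0 x / \<sigma> x\<close> is charged with the
      value 0 in place of \<open>a i x\<close>. Every term then has error at most
      \<open>2 * \<epsilon>\<close> times its weight, and all weights sum to 1.\<close>
    have "(\<Sum>y\<in>J. complex_of_real (h y x) * a i y) - a i x = ?S"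
      unfolding one by (simp add: algebra_simps sum_subtractf sum_distrib_right sum_distrib_left)
    moreover have "norm ?S \<le> (\<Sum>y\<in>J. h y x * (2 * \<epsilon>)) + g0 x / \<sigma> x * (2 * \<epsilon>)"
    proof (rule order_trans[OF norm_triangle_ineq4], rule add_mono)
      show "norm (\<Sum>y\<in>J. complex_of_real (h y x) * (a i y - a i x)) \<le> (\<Sum>y\<in>J. h y x * (2 * \<epsilon>))"
      proof (rule sum_norm_le)
        fix y
        show "norm (complex_of_real (h y x) * (a i y - a i x)) \<le> h y x * (2 * \<epsilon>)"
        proof (cases "D x y < \<epsilon>")
          case True
          have "norm (a i x - a i y) \<le> D x y"
            unfolding D_def using i I by (intro member_le_sum[of i I "\<lambda>i. norm (a i x - a i y)"]) auto
          then have "norm (a i y - a i x) \<le> 2 * \<epsilon>" using True e by (simp add: norm_minus_commute)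
          moreover have "0 \<le> h y x" using g pos[of x] by (simp add: h_def)
          ultimately show ?thesis by (simp add: norm_mult mult_left_mono)
        next
          case False
          then show ?thesis by (simp add: h_def g_def)
        qed
      qed
      show "norm (complex_of_real (g0 x / \<sigma> x) * a i x) \<le> g0 x / \<sigma> x * (2 * \<epsilon>)"
      proof (cases "N x < 2 * \<epsilon>")
        case True
        have "norm (a i x) \<le> N x"
          unfolding N_def using i I by (intro member_le_sum[of i I "\<lambda>i. norm (a i x)"]) auto
        then have "norm (a i x) \<le> 2 * \<epsilon>" using True by simp
        moreover have "0 \<le> g0 x / \<sigma> x" using g pos[of x] by simp
        ultimately show ?thesis using pos[of x] g by (simp add: norm_mult norm_divide mult_left_mono divide_right_mono)
      next
        case False
        then show ?thesis by (simp add: g0_def)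
      qed
    qed
    moreover have "(\<Sum>y\<in>J. h y x * (2 * \<epsilon>)) + g0 x / \<sigma> x * (2 * \<epsilon>) = \<delta>"
      using sumh[of x] unfolding sum_distrib_right[symmetric] distrib_right[symmetric] by (simp add: \<epsilon>_def)
    ultimately show "norm ((\<Sum>y\<in>J. complex_of_real (h y x) * a i y) - a i x) \<le> \<delta>" by simp
  qed
qed

section \<open>Point masses, and \<Lambda> as a competitor in the full norm\<close>

text \<open>The element usually written \<open>a \<delta>\<close> with index \<open>s\<close>. At
  \<open>s = 0\<close> it embeds C_0(X) as the coefficient algebra.\<close>

definition point_mass :: "('x \<Rightarrow> complex) \<Rightarrow> 'g \<Rightarrow> 'g \<Rightarrow> 'x \<Rightarrow> complex" where
  "point_mass a s = (\<lambda>g. if g = s then a else (\<lambda>_. 0))"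

lemma F_norm_finite_support:
  assumes "finite S" "\<And>g. g \<notin> S \<Longrightarrow> b g = (\<lambda>_. 0)"
  shows "norm_of (F \<phi> u) b = (\<Sum>g\<in>S. sup_norm (b g))"
  using assms by (simp add: F_simps infsum_finite_support[of S])

lemma F_finite_support:
  assumes "finite S" "\<And>g. g \<notin> S \<Longrightarrow> b g = (\<lambda>_. 0)" "\<And>g. b g \<in> C0"
  shows "b \<in> carr (F \<phi> u)"
proof -
  have "(\<lambda>g. sup_norm (b g)) summable_on UNIV"
    using assms summable_on_cong_neutral[of S UNIV "\<lambda>g. sup_norm (b g)" "\<lambda>g. sup_norm (b g)"] by simp
  then show ?thesis using assms by (simp add: F_simps)
qed

lemma point_mass_closed: "a \<in> C0 \<Longrightarrow> point_mass a s \<in> carr (F \<phi> u)"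
  by (rule F_finite_support[of "{s}"]) (auto simp: point_mass_def C0_zero)

lemma point_mass_norm: "norm_of (F \<phi> u) (point_mass a s) = sup_norm a"
  using F_norm_finite_support[of "{s}" "point_mass a s"] by (simp add: point_mass_def)

lemma point_mass_mult:
  fixes \<phi> :: "'g::group_add \<Rightarrow> 'x::t2_space \<Rightarrow> 'x"
  shows "mult_of (F \<phi> u) (point_mass a s) (point_mass b t)
    = point_mass (\<lambda>x. a x * b (\<phi> (- s) x) * u s t x) (s + t)"
proof (intro ext)
  fix r x
  let ?f = "\<lambda>(s', t'). point_mass a s s' x * \<alpha> \<phi> s' (point_mass b t t') x * u s' t' x"
  have "(\<Sum>\<^sub>\<infinity>z\<in>{(s', t'). s' + t' = r}. ?f z) = (\<Sum>\<^sub>\<infinity>z\<in>{(s, t)} \<inter> {(s', t'). s' + t' = r}. ?f z)"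
    by (rule infsum_cong_neutral) (auto simp: point_mass_def \<alpha>_def split: if_splits)
  also have "\<dots> = point_mass (\<lambda>x. a x * b (\<phi> (- s) x) * u s t x) (s + t) r x"
    by (cases "s + t = r") (auto simp: point_mass_def \<alpha>_def)
  finally show "mult_of (F \<phi> u) (point_mass a s) (point_mass b t) r x
      = point_mass (\<lambda>x. a x * b (\<phi> (- s) x) * u s t x) (s + t) r x"
    by (simp add: F_simps)
qed

context twisted_action
begin

lemma regular_point_mass:
  "\<Lambda> \<phi> u (point_mass a s) \<xi> (x, t) = a x * u s (- s + t) x * \<xi> (\<phi> (- s) x, - s + t)"
  unfolding \<Lambda>_def by (simp, subst infsum_finite_support[of "{s}"]) (auto simp: point_mass_def)

text \<open>A finite set \<open>S\<close> carries nearly all of the mass of \<xi>. Its projection to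
  X is compact, and a cutoff equal to 1 there changes \<xi> only off \<open>S\<close>.\<close>

lemma regular_nondegenerate:
  assumes amen: "amenable_action TYPE('i) \<phi>" and p: "1 \<le> p" and \<xi>: "\<xi> \<in> carr (little_lp p)" and e: "0 < e"
  obtains b where "b \<in> carr (F \<phi> u)" "norm_of (little_lp p) (\<lambda>z. \<Lambda> \<phi> u b \<xi> z - \<xi> z) < e"
proof -
  define w where "w = (\<lambda>z. norm (\<xi> z) powr p)"
  have w: "w summable_on UNIV" using \<xi> by (simp add: w_def little_lp_def lp_count_carr)
  have "(sum w \<longlongrightarrow> infsum w UNIV) (finite_subsets_at_top UNIV)"
    using has_sum_infsum[OF w] by (simp add: has_sum_def)
  then have "\<forall>\<^sub>F S in finite_subsets_at_top UNIV. dist (sum w S) (infsum w UNIV) < (e / 2) powr p"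
    using e by (intro tendstoD) auto
  then obtain S where S: "finite S" "dist (sum w S) (infsum w UNIV) < (e / 2) powr p"
    by (auto simp: eventually_finite_subsets_at_top)
  have "compact (fst ` S)" using S by (intro finite_imp_compact) auto
  from amenable_cutoff[OF amen this]
  obtain c :: "'x \<Rightarrow> real" and K where c: "continuous_on UNIV c" "\<And>x. 0 \<le> c x" "\<And>x. c x \<le> 1"
    "\<And>x. x \<in> fst ` S \<Longrightarrow> c x = 1" "compact K" "\<And>x. x \<notin> K \<Longrightarrow> c x = 0" by metis
  let ?c = "\<lambda>x. complex_of_real (c x)"
  have c0: "?c \<in> C0"
    by (rule C0_compact_support[of _ K]) (use c in \<open>auto intro: continuous_intros\<close>)
  define f where "f = (\<lambda>z. \<Lambda> \<phi> u (point_mass ?c 0) \<xi> z - \<xi> z)"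
  have f: "f z = complex_of_real (c (fst z) - 1) * \<xi> z" for z
    by (cases z) (simp add: f_def regular_point_mass algebra_simps)
  have fS: "f z = 0" if "z \<in> S" for z using c(4)[of "fst z"] that by (simp add: f)
  have "(\<Sum>z\<in>T. norm (f z) powr p) \<le> (e / 2) powr p" if T: "finite T" for T
  proof -
    have "(\<Sum>z\<in>T. norm (f z) powr p) = (\<Sum>z\<in>T - S. norm (f z) powr p)"
      by (rule sum.mono_neutral_right) (use T fS in auto)
    also have "\<dots> \<le> (\<Sum>z\<in>T - S. w z)"
    proof (rule sum_mono)
      fix z
      have "norm (f z) \<le> 1 * norm (\<xi> z)"
        unfolding f norm_mult norm_of_real using c(2,3)[of "fst z"]
        by (intro mult_right_mono) auto
      then show "norm (f z) powr p \<le> w z" unfolding w_def using p by (intro powr_mono2) auto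
    qed
    also have "\<dots> = sum w (T \<union> S) - sum w S"
      using T S sum.subset_diff[of S "T \<union> S" w] by (simp add: Un_Diff)
    also have "\<dots> \<le> infsum w UNIV - sum w S"
      using finite_sum_le_infsum[OF w, of "T \<union> S"] T S by (auto simp: w_def)
    also have "\<dots> \<le> (e / 2) powr p" using S by (simp add: dist_real_def abs_less_iff)
    finally show ?thesis .
  qed
  then have "norm_of (little_lp p) f \<le> e / 2"
    unfolding little_lp_def using p e by (intro lp_count_norm_leI(2)) auto
  then show thesis
    using that[OF point_mass_closed[OF c0, of 0]] e by (simp add: f_def)
qed

end

lemma lp_count_range_iff:
  assumes "inj j"
  shows "f \<in> carr (Lp_functions p (count_space (range j))) \<longleftrightarrow> f \<circ> j \<in> carr (little_lp p)"
    and "norm_of (Lp_functions p (count_space (range j))) f = norm_of (little_lp p) (f \<circ> j)"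
proof -
  have bij: "bij_betw j UNIV (range j)" using assms by (simp add: inj_on_imp_bij_betw)
  show "f \<in> carr (Lp_functions p (count_space (range j))) \<longleftrightarrow> f \<circ> j \<in> carr (little_lp p)"
    using integrable_bij_count_space[OF bij, of "\<lambda>x. norm (f x) powr p"]
    by (simp add: Lp_functions_carr little_lp_def)
  show "norm_of (Lp_functions p (count_space (range j))) f = norm_of (little_lp p) (f \<circ> j)"
    using integral_bij_count_space[OF bij, of "\<lambda>x. norm (f x) powr p"]
    by (simp add: Lp_functions_norm little_lp_def)
qed

lemma Lp_space_count_space:
  fixes A :: "'n set"
  assumes "1 \<le> p"
  shows "Lp_space TYPE('n) p (Lp p (count_space A))"
proof -
  interpret V: complex_seminormed_space "Lp_functions p (count_space A)"
    by (rule Lp_functions_seminormed[OF assms])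
  interpret Q: complex_normed_space "Lp p (count_space A)"
    unfolding Lp_def by (rule V.separated_quotient_normed)
  have "complex_banach_space (Lp p (count_space A))"
    unfolding Lp_def using lp_count_complete[OF assms] by (rule V.separated_quotient_banach)
  moreover have "linear_isometry (Lp p (count_space A)) (Lp p (count_space A)) (\<lambda>x. x)"
    by (simp add: linear_isometry_def linear_map_def)
  ultimately show ?thesis
    unfolding Lp_space_def using bij_betw_id[of "carr (Lp p (count_space A))"]
    by (intro conjI exI[of _ "count_space A"] exI[of _ "\<lambda>x. x"]) (auto simp: id_def)
qed

context twisted_action
begin

text \<open>\<Lambda> is carried to counting measure on the left summand, so that it becomes one of
  the representations over which the full norm is a supremum.\<close>

lemma regular_representation_on_Lp:
  assumes amen: "amenable_action TYPE('i) \<phi>" and p: "1 \<le> p"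
  obtains E :: "('x \<times> 'g + 'm \<Rightarrow> complex) set cspace" and \<psi> where
    "Lp_space TYPE('x \<times> 'g + 'm) p E" "representation (F \<phi> u) E \<psi>" "nondegenerate (F \<phi> u) E \<psi>"
    "\<And>b. b \<in> carr (F \<phi> u) \<Longrightarrow> operator_norm E (\<psi> b) = reduced_norm p \<phi> u b"
proof -
  let ?j = "Inl :: 'x \<times> 'g \<Rightarrow> 'x \<times> 'g + 'm"
  define V where "V = Lp_functions p (count_space (range ?j))"
  define E where "E = Lp p (count_space (range ?j))"
  have EV: "E = separated_quotient V" by (simp add: E_def V_def Lp_def)
  interpret V: complex_seminormed_space V
    unfolding V_def by (rule Lp_functions_seminormed[OF p])
  interpret E: complex_normed_space E
    unfolding EV by (rule V.separated_quotient_normed)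
  interpret L: complex_seminormed_space "little_lp p :: ('x \<times> 'g \<Rightarrow> complex) cspace"
    unfolding little_lp_def by (rule Lp_functions_seminormed[OF p])
  have carrV: "f \<in> carr V \<longleftrightarrow> f \<circ> ?j \<in> carr (little_lp p)"
    and normV: "norm_of V f = norm_of (little_lp p) (f \<circ> ?j)" for f
    unfolding V_def by (rule lp_count_range_iff; simp)+
  have opV [simp]: "add_of V f g = (\<lambda>x. f x + g x)" "scale_of V c f = (\<lambda>x. c * f x)"
    "diff_of V f g = (\<lambda>x. f x - g x)" for f g c
    by (simp_all add: V_def)
  have opL [simp]: "add_of (little_lp p) f g = (\<lambda>x. f x + g x)" "scale_of (little_lp p) c f = (\<lambda>x. c * f x)"
    "diff_of (little_lp p) f g = (\<lambda>x. f x - g x)" for f g :: "'x \<times> 'g \<Rightarrow> complex" and c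
    by (simp_all add: little_lp_def)
  \<comment> \<open>Elements of \<open>V\<close> are functions on the whole sum type, but the
    measure lives on the left summand. Null classes thus collect all extensions of one function, and
    the extension by 0 is a representative.\<close>
  define ext where "ext = (\<lambda>(\<eta> :: 'x \<times> 'g \<Rightarrow> complex) z. case z of Inl y \<Rightarrow> \<eta> y | Inr (_ :: 'm) \<Rightarrow> 0)"
  have ext_j [simp]: "ext \<eta> \<circ> ?j = \<eta>" "ext \<eta> (Inl y) = \<eta> y" for \<eta> y
    by (auto simp: ext_def)
  define T where "T = (\<lambda>b f. ext (\<Lambda> \<phi> u b (f \<circ> ?j)))"
  \<comment> \<open>The choice is harmless: \<open>T b\<close> depends only on the values on the
    left summand, which all members of a class share.\<close>
  define \<psi> where "\<psi> = (\<lambda>b C. null_class V (T b (SOME f. f \<in> C)))"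
  have null: "null_class V f = null_class V g" if "f \<in> carr V" "g \<in> carr V" "f \<circ> ?j = g \<circ> ?j" for f g
  proof -
    have "(\<lambda>z. f z - g z) \<circ> ?j = (\<lambda>_. 0)" using that(3) by (auto simp: fun_eq_iff)
    then show ?thesis using that by (simp add: V.null_class_eq_iff normV little_lp_def Lp_functions_norm)
  qed
  have TV: "T b f \<in> carr V" if "b \<in> carr (F \<phi> u)" "f \<in> carr V" for b f
    using regular_bound(1)[OF p that(1)] that(2) by (simp add: T_def carrV)
  have psi: "\<psi> b (null_class V f) = null_class V (T b f)" if f: "f \<in> carr V" for b f
  proof -
    have "(SOME g. g \<in> null_class V f) \<in> null_class V f"
      by (rule someI[of "\<lambda>g. g \<in> null_class V f" f]) (rule V.null_class_refl[OF f])
    then have g: "(SOME g. g \<in> null_class V f) \<in> carr V" "norm_of V (\<lambda>x. (SOME g. g \<in> null_class V f) x - f x) = 0"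
      by (auto simp: null_class_def)
    have "(\<lambda>x. (SOME g. g \<in> null_class V f) x - f x) \<in> carr V"
      using V.diff_closed[OF g(1) f] by simp
    then have "(SOME g. g \<in> null_class V f) (?j y) - f (?j y) = 0" for y
      using lp_count_pointwise_le[of p "\<lambda>x. (SOME g. g \<in> null_class V f) x - f x" "range ?j" "?j y"] g(2) p
      by (simp add: V_def)
    then have "(SOME g. g \<in> null_class V f) \<circ> ?j = f \<circ> ?j" by (auto simp: fun_eq_iff)
    then show ?thesis by (simp add: \<psi>_def T_def)
  qed
  note [simp] = V.separated_quotient_simps[folded EV]
  have bd: "norm_of V (T b f) \<le> reduced_norm p \<phi> u b * norm_of V f"
    if "b \<in> carr (F \<phi> u)" "f \<in> carr V" for b f
    using reduced_norm_apply[OF p that(1)] that(2) by (simp add: normV carrV T_def)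
  have bdE: "norm_of E (\<psi> b C) \<le> reduced_norm p \<phi> u b * norm_of E C"
    if b: "b \<in> carr (F \<phi> u)" and C: "C \<in> carr E" for b C
    using C bd[OF b] by (auto simp: psi TV[OF b])
  have lin: "linear_map E E (\<psi> b)" if b: "b \<in> carr (F \<phi> u)" for b
    unfolding linear_map_def
  proof (intro conjI funcsetI ballI allI)
    fix C assume "C \<in> carr E"
    then obtain f where f: "f \<in> carr V" "C = null_class V f" by auto
    show "\<psi> b C \<in> carr E" by (simp add: f psi TV[OF b])
    show "\<psi> b (scale_of E c C) = scale_of E c (\<psi> b C)" for c
    proof -
      have "null_class V (T b (\<lambda>x. c * f x)) = null_class V (\<lambda>x. c * T b f x)"
        using V.scale_closed[OF f(1), of c] V.scale_closed[OF TV[OF b f(1)], of c]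
          regular_linear(2)[OF p b, of "f \<circ> ?j" c] f(1)
        by (intro null) (auto simp: TV[OF b] T_def carrV o_def)
      then show ?thesis
        using V.scale_closed[OF f(1), of c] by (simp add: f psi TV[OF b])
    qed
    fix D assume "D \<in> carr E"
    then obtain g where g: "g \<in> carr V" "D = null_class V g" by auto
    have "null_class V (T b (\<lambda>x. f x + g x)) = null_class V (\<lambda>x. T b f x + T b g x)"
      using V.add_closed[OF f(1) g(1)] V.add_closed[OF TV[OF b f(1)] TV[OF b g(1)]]
        regular_linear(1)[OF p b, of "f \<circ> ?j" "g \<circ> ?j"] f(1) g(1)
      by (intro null) (auto simp: TV[OF b] T_def carrV o_def)
    then show "\<psi> b (add_of E C D) = add_of E (\<psi> b C) (\<psi> b D)"
      using V.add_closed[OF f(1) g(1)] by (simp add: f g psi TV[OF b])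
  qed
  have bo: "\<psi> b \<in> bounded_operators E" if b: "b \<in> carr (F \<phi> u)" for b
    unfolding bounded_operators_def using lin[OF b] bdE[OF b] by blast
  have norm_eq: "operator_norm E (\<psi> b) = reduced_norm p \<phi> u b" if b: "b \<in> carr (F \<phi> u)" for b
  proof (rule antisym)
    show "operator_norm E (\<psi> b) \<le> reduced_norm p \<phi> u b"
      using E.operator_norm_le[OF reduced_norm_nonneg[OF p b] bdE[OF b]] .
    show "reduced_norm p \<phi> u b \<le> operator_norm E (\<psi> b)"
      unfolding reduced_norm_def
    proof (rule L.operator_norm_le)
      show "0 \<le> operator_norm E (\<psi> b)" by (rule E.operator_norm_nonneg[OF bo[OF b]])
      fix \<eta> assume \<eta>: "\<eta> \<in> carr (little_lp p :: ('x \<times> 'g \<Rightarrow> complex) cspace)"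
      have eV: "ext \<eta> \<in> carr V" using \<eta> by (simp add: carrV)
      show "norm_of (little_lp p) (\<Lambda> \<phi> u b \<eta>) \<le> operator_norm E (\<psi> b) * norm_of (little_lp p) \<eta>"
        using E.operator_norm_apply[OF bo[OF b], of "null_class V (ext \<eta>)"] eV
        by (simp add: psi TV[OF b] normV T_def carrV regular_bound(1)[OF p b \<eta>])
    qed
  qed
  have rep: "representation (F \<phi> u) E \<psi>"
    unfolding representation_def
  proof (intro conjI ballI allI)
    fix a assume a: "a \<in> carr (F \<phi> u)"
    show "\<psi> a \<in> bounded_operators E" by (rule bo[OF a])
    show "operator_norm E (\<psi> a) \<le> norm_of (F \<phi> u) a"
      using reduced_norm_le[OF p a] by (simp add: norm_eq[OF a])
    fix C assume "C \<in> carr E"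
    then obtain f where f: "f \<in> carr V" "C = null_class V f" by auto
    show "\<psi> (scale_of (F \<phi> u) c a) C = scale_of E c (\<psi> a C)" for c
    proof -
      have "null_class V (T (\<lambda>g x. c * a g x) f) = null_class V (\<lambda>x. c * T a f x)"
        using V.scale_closed[OF TV[OF a f(1)], of c] regular_linear(4)[OF p a, of "f \<circ> ?j" c] f(1)
        by (intro null) (auto simp: TV[OF F_scale_closed[OF a]] T_def carrV o_def)
      then show ?thesis by (simp add: f psi TV[OF a] F_simps)
    qed
    fix b assume b: "b \<in> carr (F \<phi> u)"
    have "null_class V (T (\<lambda>g x. a g x + b g x) f) = null_class V (\<lambda>x. T a f x + T b f x)"
      using V.add_closed[OF TV[OF a f(1)] TV[OF b f(1)]] regular_linear(3)[OF p b _ a, of "f \<circ> ?j"] f(1)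
      by (intro null) (auto simp: TV[OF F_add_closed[OF a b]] T_def carrV o_def)
    then show "\<psi> (add_of (F \<phi> u) a b) C = add_of E (\<psi> a C) (\<psi> b C)"
      by (simp add: f psi TV[OF a] TV[OF b] F_simps)
    show "\<psi> (mult_of (F \<phi> u) a b) C = \<psi> a (\<psi> b C)"
      using regular_mult[OF p a b, of "f \<circ> ?j"] f(1)
      by (simp add: f(2) psi[OF f(1)] psi[OF TV[OF b f(1)]]) (simp add: T_def carrV)
  qed
  have nd: "nondegenerate (F \<phi> u) E \<psi>"
    unfolding nondegenerate_def
  proof (intro ballI allI impI)
    fix C and e :: real assume "C \<in> carr E" and e: "0 < e"
    then obtain f where f: "f \<in> carr V" "C = null_class V f" by auto
    obtain b where b: "b \<in> carr (F \<phi> u)"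
      and close: "norm_of (little_lp p) (\<lambda>z. \<Lambda> \<phi> u b (f \<circ> ?j) z - (f \<circ> ?j) z) < e"
      by (rule regular_nondegenerate[OF amen p _ e]) (use f carrV in auto)
    have "norm_of V (\<lambda>x. T b f x - f x) < e"
      using close by (simp add: normV T_def o_def)
    then have "norm_of E (diff_of E (\<psi> b C) C) < e"
      using V.diff_closed[OF TV[OF b f(1)] f(1)] by (simp add: f psi TV[OF b])
    moreover have "\<psi> b C \<in> lin_span E {\<psi> b \<zeta> |b \<zeta>. b \<in> carr (F \<phi> u) \<and> \<zeta> \<in> carr E}"
      using b \<open>C \<in> carr E\<close> by (intro lin_span.intros) auto
    ultimately show "\<exists>\<eta>\<in>lin_span E {\<psi> b \<zeta> |b \<zeta>. b \<in> carr (F \<phi> u) \<and> \<zeta> \<in> carr E}.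
        norm_of E (diff_of E \<eta> C) < e" by blast
  qed
  have "Lp_space TYPE('x \<times> 'g + 'm) p E" unfolding E_def by (rule Lp_space_count_space[OF p])
  then show thesis using rep nd norm_eq by (rule that)
qed

end

section \<open>Representations by hermitian operators on \<open>L\<^sup>p\<close>\<close>

text \<open>The scalar form of the duality map from L^p to L^q; it is homogeneous of degree p - 1 in
  the modulus. The factor \<open>cnj z\<close> gives the value 0 at 0 for every
  \<open>p\<close>.\<close>

definition dual_vector :: "real \<Rightarrow> complex \<Rightarrow> complex" where
  "dual_vector p z = cnj z * of_real (norm z powr (p - 2))"

lemma norm_dual_vector: "norm (dual_vector p z) = norm z powr (p - 1)"
proof (cases "z = 0")
  case False
  then have "norm z * norm z powr (p - 2) = norm z powr (1 + (p - 2))"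
    by (subst powr_add) simp
  then show ?thesis by (simp add: dual_vector_def norm_mult)
qed (simp add: dual_vector_def)

lemma mult_dual_vector: "z * dual_vector p z = of_real (norm z powr p)"
proof (cases "z = 0")
  case False
  have "z * dual_vector p z = of_real ((norm z)\<^sup>2 * norm z powr (p - 2))"
    by (simp add: dual_vector_def mult.assoc[symmetric] complex_norm_square[symmetric])
  also have "(norm z)\<^sup>2 * norm z powr (p - 2) = norm z powr (2 + (p - 2))"
    using False by (subst powr_add) simp
  finally show ?thesis by simp
qed (simp add: dual_vector_def)

lemma dual_vector_mult: "dual_vector p (c * z) = dual_vector p c * dual_vector p z"
  by (simp add: dual_vector_def norm_mult powr_mult)

lemma dual_vector_zero [simp]: "dual_vector p 0 = 0"
  by (simp add: dual_vector_def)

lemma dual_vector_2: "dual_vector 2 z = cnj z"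
  by (cases "z = 0") (simp_all add: dual_vector_def)

text \<open>One of the two summands is zero, so additivity is trivial and only the behaviour under
  the factor \<open>z\<close> remains.\<close>

lemma dual_vector_add_disjoint:
  "x * y = 0 \<Longrightarrow> dual_vector p (x + z * y) = dual_vector p x + dual_vector p z * dual_vector p y"
  by (auto simp: dual_vector_mult)

lemma dual_vector_measurable [measurable]:
  assumes [measurable]: "f \<in> borel_measurable M"
  shows "(\<lambda>x. dual_vector p (f x)) \<in> borel_measurable M"
proof -
  have "(\<lambda>x. cnj (f x)) \<in> borel_measurable M"
    by (rule measurable_compose[OF assms borel_measurable_continuous_onI])
      (intro continuous_intros)
  moreover have "(\<lambda>x. norm (f x) powr (p - 2)) \<in> borel_measurable M" by measurable
  then have "(\<lambda>x. complex_of_real (norm (f x) powr (p - 2))) \<in> borel_measurable M"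
    by (rule measurable_compose[OF _ borel_measurable_continuous_onI]) (intro continuous_intros)
  ultimately show ?thesis unfolding dual_vector_def by (rule borel_measurable_times)
qed

lemma Young_dual_vector:
  assumes p: "1 < p"
  shows "norm (w * dual_vector p z) \<le> norm w powr p / p + (1 - 1 / p) * norm z powr p"
proof -
  let ?q = "p / (p - 1)"
  have "norm w * norm z powr (p - 1) \<le> norm w powr p / p + (norm z powr (p - 1)) powr ?q / ?q"
    by (rule Youngs_inequality) (use p in \<open>auto simp: field_simps\<close>)
  also have "(norm z powr (p - 1)) powr ?q = norm z powr p" using p by (simp add: powr_powr)
  also have "norm z powr p / ?q = (1 - 1 / p) * norm z powr p" using p by (simp add: field_simps)
  finally show ?thesis by (simp add: norm_mult norm_dual_vector)
qed

lemma powr_norm_tangent: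
  assumes p: "1 < p"
  shows "norm z powr p + p * Re (w * dual_vector p z) \<le> norm (z + w) powr p"
proof -
  have "Re ((z + w) * dual_vector p z) \<le> norm (z + w) powr p / p + (1 - 1 / p) * norm z powr p"
    using Young_dual_vector[OF p, of "z + w" z] complex_Re_le_cmod order_trans by blast
  then have "norm z powr p + Re (w * dual_vector p z) \<le> norm (z + w) powr p / p + (1 - 1 / p) * norm z powr p"
    by (simp add: distrib_right mult_dual_vector)
  then show ?thesis using p by (simp add: field_simps)
qed

text \<open>With \<open>min_le_powr_mult\<close> this places a weighted geometric mean between the
  minimum and the weighted arithmetic mean, which confines the damping factor of the
  approximant.\<close>

lemma Young_powr_weighted:
  fixes A B p :: real
  assumes "1 < p" "0 \<le> A" "0 \<le> B"
  shows "A powr (1 - 1 / p) * B powr (1 / p) \<le> (1 - 1 / p) * A + 1 / p * B"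
proof (cases "A = 0 \<or> B = 0")
  case True then show ?thesis using assms by auto
next
  case False
  then show ?thesis using assms by (intro Youngs_inequality_0) auto
qed

lemma min_le_powr_mult:
  fixes A B p :: real
  assumes "1 < p" "0 \<le> A" "0 \<le> B"
  shows "min A B \<le> A powr (1 - 1 / p) * B powr (1 / p)"
proof -
  have "min A B = min A B powr (1 - 1 / p) * min A B powr (1 / p)"
    using assms by (simp add: powr_add[symmetric])
  also have "\<dots> \<le> A powr (1 - 1 / p) * B powr (1 / p)"
    using assms by (intro mult_mono powr_mono2) auto
  finally show ?thesis .
qed

lemma Holder_inequality_sum:
  fixes a b :: "'t \<Rightarrow> real"
  assumes p: "1 < p" and pq: "1 / p + 1 / q = 1" and T: "finite T"
    and ab: "\<And>t. t \<in> T \<Longrightarrow> 0 \<le> a t" "\<And>t. t \<in> T \<Longrightarrow> 0 \<le> b t"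
  shows "(\<Sum>t\<in>T. a t * b t) \<le> (\<Sum>t\<in>T. a t powr p) powr (1 / p) * (\<Sum>t\<in>T. b t powr q) powr (1 / q)"
proof -
  define A B where "A = (\<Sum>t\<in>T. a t powr p) powr (1 / p)" and "B = (\<Sum>t\<in>T. b t powr q) powr (1 / q)"
  have q: "1 < q"
  proof -
    have q_eq: "1 / q = 1 - 1 / p" using pq by simp
    then have "0 < 1 / q" "1 / q < 1" using p by auto
    then show ?thesis by (simp add: divide_less_eq split: if_splits)
  qed
  have AB: "0 \<le> A" "0 \<le> B" by (simp_all add: A_def B_def)
  have pos: "0 \<le> (\<Sum>t\<in>T. a t powr p)" "0 \<le> (\<Sum>t\<in>T. b t powr q)" by (auto intro: sum_nonneg)
  show ?thesis
  proof (cases "A = 0 \<or> B = 0")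
    case True
    have "a t * b t = 0" if t: "t \<in> T" for t
      using True
    proof
      assume "A = 0"
      then have "(\<Sum>t\<in>T. a t powr p) = 0" by (simp add: A_def)
      then show ?thesis using T t by (subst (asm) sum_nonneg_eq_0_iff) auto
    next
      assume "B = 0"
      then have "(\<Sum>t\<in>T. b t powr q) = 0" by (simp add: B_def)
      then show ?thesis using T t by (subst (asm) sum_nonneg_eq_0_iff) auto
    qed
    then have "(\<Sum>t\<in>T. a t * b t) = 0" by (intro sum.neutral) blast
    then show ?thesis using AB unfolding A_def B_def by simp
  next
    case False
    then have AB': "0 < A" "0 < B" using AB by auto
    have "(\<Sum>t\<in>T. a t / A * (b t / B)) \<le> (\<Sum>t\<in>T. (a t / A) powr p / p + (b t / B) powr q / q)"
      using AB' ab by (intro sum_mono Youngs_inequality p q pq) auto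
    also have "\<dots> = (\<Sum>t\<in>T. a t powr p) / A powr p / p + (\<Sum>t\<in>T. b t powr q) / B powr q / q"
      using AB' ab by (simp add: sum.distrib sum_divide_distrib powr_divide)
    also have "\<dots> = 1 / p + 1 / q"
    proof -
      have "A powr p = (\<Sum>t\<in>T. a t powr p)" "B powr q = (\<Sum>t\<in>T. b t powr q)"
        using p q pos by (simp_all add: A_def B_def powr_powr)
      moreover have "A powr p \<noteq> 0" "B powr q \<noteq> 0" using AB' by auto
      ultimately show ?thesis by simp
    qed
    finally have "(\<Sum>t\<in>T. a t * b t) / (A * B) \<le> 1"
      using pq by (simp add: sum_divide_distrib)
    then show ?thesis using AB' by (simp add: A_def[symmetric] B_def[symmetric] divide_le_eq)
  qed
qed

text \<open>Families outside \<open>T\<close> are made undefined, so a countable dense set of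
  scalars yields a countable set of families. Estimates for fixed coefficients, each with its own
  null set, can thereby be used together.\<close>

lemma countable_dense_families:
  assumes "finite T"
  obtains D :: "('t \<Rightarrow> complex) set" where "countable D"
    "\<And>l. \<exists>\<mu>. (\<forall>n::nat. \<mu> n \<in> D) \<and> (\<forall>t\<in>T. (\<lambda>n. \<mu> n t) \<longlonglongrightarrow> l t)"
proof -
  obtain Q :: "complex set" where Q: "countable Q" "\<And>X. open X \<Longrightarrow> X \<noteq> {} \<Longrightarrow> \<exists>d\<in>Q. d \<in> X"
    using countable_dense_exists by blast
  have "\<exists>\<mu>. (\<forall>n::nat. \<mu> n \<in> PiE T (\<lambda>_. Q)) \<and> (\<forall>t\<in>T. (\<lambda>n. \<mu> n t) \<longlonglongrightarrow> l t)" for l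
  proof -
    have "\<forall>t. \<exists>s. (\<forall>n. s n \<in> Q) \<and> s \<longlonglongrightarrow> l t"
    proof
      fix t
      have "l t \<in> closure Q"
        unfolding closure_approachable
      proof (intro allI impI)
        fix e :: real assume "0 < e"
        then obtain d where "d \<in> Q" "d \<in> ball (l t) e" using Q(2)[of "ball (l t) e"] by auto
        then show "\<exists>y\<in>Q. dist y (l t) < e" by (auto simp: dist_commute)
      qed
      then show "\<exists>s. (\<forall>n. s n \<in> Q) \<and> s \<longlonglongrightarrow> l t" by (simp add: closure_sequential)
    qed
    then obtain s where s: "\<And>t n. s t n \<in> Q" "\<And>t. s t \<longlonglongrightarrow> l t" by metis
    then show ?thesis
      by (intro exI[of _ "\<lambda>n. restrict (\<lambda>t. s t n) T"]) auto
  qed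
  with countable_PiE[OF assms Q(1)] show thesis by (rule that)
qed

lemma norm_exp_i_minus_1_le: "norm (exp (\<i> * of_real y) - 1) \<le> \<bar>y\<bar>"
  using dist_exp_i_1[of y] abs_sin_le_one abs_sin_x_le_abs_x[of "y / 2"]
  by (simp add: dist_norm)

lemma norm_exp_i_taylor: "norm (exp (\<i> * of_real y) - 1 - \<i> * of_real y) \<le> y\<^sup>2"
  using Taylor_exp[of "\<i> * of_real y" 1] by (simp add: norm_mult power2_eq_square algebra_simps)

lemma integrable_dual_vector:
  assumes p: "1 < p" and g: "g \<in> carr (Lp_functions p M)" and f: "f \<in> carr (Lp_functions p M)"
  shows "integrable M (\<lambda>x. g x * dual_vector p (f x))"
proof (rule Bochner_Integration.integrable_bound)
  show "integrable M (\<lambda>x. norm (g x) powr p / p + (1 - 1 / p) * norm (f x) powr p)"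
    using f g by (auto simp: Lp_functions_carr)
  show "(\<lambda>x. g x * dual_vector p (f x)) \<in> borel_measurable M"
    using f g by (auto simp: Lp_functions_carr)
  show "AE x in M. norm (g x * dual_vector p (f x)) \<le> norm (norm (g x) powr p / p + (1 - 1 / p) * norm (f x) powr p)"
    using Young_dual_vector[OF p] by (intro AE_I2) (simp add: order_trans[OF _ abs_ge_self])
qed

text \<open>
  A representation on \<open>L\<^sup>p(M)\<close>, described on functions instead of classes: \<open>\<Psi>\<close> picks representatives,
  so the algebraic identities hold only almost everywhere.
\<close>

locale lp_representation = twisted_action \<phi> u
  for \<phi> :: "'g::group_add \<Rightarrow> 'x::t2_space \<Rightarrow> 'x" and u :: "'g \<Rightarrow> 'g \<Rightarrow> 'x \<Rightarrow> complex" +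
  fixes p :: real and M :: "'n measure"
    and \<Psi> :: "('g \<Rightarrow> 'x \<Rightarrow> complex) \<Rightarrow> ('n \<Rightarrow> complex) \<Rightarrow> 'n \<Rightarrow> complex"
    and V :: "('n \<Rightarrow> complex) cspace"
  defines "V \<equiv> Lp_functions p M"
  assumes p: "1 < p"
    and rep_closed: "\<lbrakk>b \<in> carr (F \<phi> u); f \<in> carr V\<rbrakk> \<Longrightarrow> \<Psi> b f \<in> carr V"
    and rep_bound: "\<lbrakk>b \<in> carr (F \<phi> u); f \<in> carr V\<rbrakk> \<Longrightarrow> norm_of V (\<Psi> b f) \<le> norm_of (F \<phi> u) b * norm_of V f"
    and rep_add: "\<lbrakk>a \<in> carr (F \<phi> u); b \<in> carr (F \<phi> u); f \<in> carr V\<rbrakk> \<Longrightarrow>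
      AE x in M. \<Psi> (\<lambda>g x. a g x + b g x) f x = \<Psi> a f x + \<Psi> b f x"
    and rep_scale: "\<lbrakk>b \<in> carr (F \<phi> u); f \<in> carr V\<rbrakk> \<Longrightarrow>
      AE x in M. \<Psi> (\<lambda>g x. c * b g x) f x = c * \<Psi> b f x"
    and rep_mult: "\<lbrakk>a \<in> carr (F \<phi> u); b \<in> carr (F \<phi> u); f \<in> carr V\<rbrakk> \<Longrightarrow>
      AE x in M. \<Psi> (mult_of (F \<phi> u) a b) f x = \<Psi> a (\<Psi> b f) x"
    and rep_add_arg: "\<lbrakk>b \<in> carr (F \<phi> u); f \<in> carr V; g \<in> carr V\<rbrakk> \<Longrightarrow>
      AE x in M. \<Psi> b (\<lambda>x. f x + g x) x = \<Psi> b f x + \<Psi> b g x"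
    and rep_scale_arg: "\<lbrakk>b \<in> carr (F \<phi> u); f \<in> carr V\<rbrakk> \<Longrightarrow>
      AE x in M. \<Psi> b (\<lambda>x. c * f x) x = c * \<Psi> b f x"
    and approximate_unit: "\<lbrakk>f \<in> carr V; 0 < e\<rbrakk> \<Longrightarrow> \<exists>k :: 'x \<Rightarrow> real.
      (\<lambda>x. of_real (k x)) \<in> C0 \<and> (\<forall>x. 0 \<le> k x \<and> k x \<le> 1) \<and>
      norm_of V (\<lambda>x. \<Psi> (point_mass (\<lambda>x. of_real (k x)) 0) f x - f x) < e"
begin

lemmas V_add = Lp_functions_add_closed[of p _ M, folded V_def, OF less_imp_le[OF p]]
  and V_diff = Lp_functions_diff_closed[of p _ M, folded V_def, OF less_imp_le[OF p]]
  and V_scale = Lp_functions_scale_closed[of _ p M, folded V_def]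
  and V_sum = Lp_functions_sum_closed[of p _ _ M, folded V_def, OF less_imp_le[OF p]]
  and V_zero = Lp_functions_zero_closed[of p M, folded V_def]
  and V_measurable = Lp_functions_measurable[of _ p M, folded V_def]
  and V_integrable = Lp_functions_integrable[of _ p M, folded V_def]
  and V_norm_nonneg = Lp_functions_norm_nonneg[of p M, folded V_def]
  and V_triangle = Minkowski_inequality[of p _ M, folded V_def, OF less_imp_le[OF p]]

lemma V_norm_powr: "norm_of V f powr p = (\<integral>x. norm (f x) powr p \<partial>M)"
  unfolding V_def using p by (intro Lp_functions_norm_powr) simp

lemma V_norm_scale: "norm_of V (\<lambda>x. c * f x) = norm c * norm_of V f"
  unfolding V_def using p by (intro Lp_functions_norm_scale) simp

lemma V_norm_zero_iff: "f \<in> carr V \<Longrightarrow> norm_of V f = 0 \<longleftrightarrow> (AE x in M. f x = 0)"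
  unfolding V_def using p by (intro Lp_functions_norm_eq_0_iff) auto

lemma V_norm_cong: "\<lbrakk>f \<in> carr V; g \<in> carr V; AE x in M. f x = g x\<rbrakk> \<Longrightarrow> norm_of V f = norm_of V g"
  by (auto simp: V_def dest: Lp_functions_measurable intro: Lp_functions_norm_cong_AE)

lemma V_restrict: "\<lbrakk>f \<in> carr V; B \<in> sets M\<rbrakk> \<Longrightarrow> (\<lambda>x. indicator B x * f x) \<in> carr V"
  unfolding V_def
  by (rule Lp_functions_dominated[OF _ Lp_functions_integrable[of f p M]])
    (auto dest: Lp_functions_measurable split: split_indicator)

text \<open>Independence of the representative is derived: an almost everywhere vanishing difference
  has norm 0, and so has its image by \<open>rep_bound\<close>.\<close>

lemma rep_cong:
  assumes b: "b \<in> carr (F \<phi> u)" and f: "f \<in> carr V" and g: "g \<in> carr V" and eq: "AE x in M. f x = g x"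
  shows "AE x in M. \<Psi> b f x = \<Psi> b g x"
proof -
  let ?d = "\<lambda>x. f x + (-1) * g x"
  have d: "?d \<in> carr V" by (intro V_add f V_scale g)
  have "AE x in M. ?d x = 0" using eq by eventually_elim simp
  then have "norm_of V ?d = 0" using V_norm_zero_iff[OF d] by simp
  then have "norm_of V (\<Psi> b ?d) = 0"
    using rep_bound[OF b d] V_norm_nonneg[of "\<Psi> b ?d"] by simp
  then have "AE x in M. \<Psi> b ?d x = 0" using V_norm_zero_iff[OF rep_closed[OF b d]] by simp
  then show ?thesis
    using rep_add_arg[OF b f V_scale[OF g, of "-1"]] rep_scale_arg[OF b g, of "-1"]
    by eventually_elim simp
qed

lemma rep_zero: "f \<in> carr V \<Longrightarrow> AE x in M. \<Psi> (\<lambda>_ _. 0) f x = 0"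
  using rep_scale[OF F_zero_closed, of f 0] by simp

lemma rep_sum:
  assumes f: "f \<in> carr V" and b: "\<And>i. i \<in> I \<Longrightarrow> b i \<in> carr (F \<phi> u)"
  shows "AE x in M. \<Psi> (\<lambda>g x. \<Sum>i\<in>I. b i g x) f x = (\<Sum>i\<in>I. \<Psi> (b i) f x)"
  using b
proof (induction I rule: infinite_finite_induct)
  case (insert i I)
  then have "AE x in M. \<Psi> (\<lambda>g x. \<Sum>i\<in>I. b i g x) f x = (\<Sum>i\<in>I. \<Psi> (b i) f x)" by simp
  moreover have "AE x in M. \<Psi> (\<lambda>g x. b i g x + (\<Sum>i\<in>I. b i g x)) f x
      = \<Psi> (b i) f x + \<Psi> (\<lambda>g x. \<Sum>i\<in>I. b i g x) f x"
    using insert by (intro rep_add F_sum_closed f) auto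
  ultimately show ?case by eventually_elim (simp add: insert.hyps)
qed (simp_all add: rep_zero[OF f])

section \<open>The action of C_0(X) and its hermitian elements\<close>

text \<open>The restriction of the representation to C_0(X); it is multiplicative because
  \<open>u 0 0\<close> is 1.\<close>

definition mul :: "('x \<Rightarrow> complex) \<Rightarrow> ('n \<Rightarrow> complex) \<Rightarrow> 'n \<Rightarrow> complex" where
  "mul c = \<Psi> (point_mass c 0)"

lemma mul_closed: "\<lbrakk>c \<in> C0; f \<in> carr V\<rbrakk> \<Longrightarrow> mul c f \<in> carr V"
  unfolding mul_def by (intro rep_closed point_mass_closed)

lemma mul_bound: "\<lbrakk>c \<in> C0; f \<in> carr V\<rbrakk> \<Longrightarrow> norm_of V (mul c f) \<le> sup_norm c * norm_of V f"
  using rep_bound[OF point_mass_closed, of c f 0] by (simp add: mul_def point_mass_norm)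

lemma mul_bound_le:
  assumes "c \<in> C0" "f \<in> carr V" "\<And>x. norm (c x) \<le> B"
  shows "norm_of V (mul c f) \<le> B * norm_of V f"
  using mul_bound[OF assms(1,2)] mult_right_mono[OF sup_norm_least[of c B, OF assms(3)] V_norm_nonneg[of f]]
  by linarith

lemma mul_cong: "\<lbrakk>c \<in> C0; f \<in> carr V; g \<in> carr V; AE x in M. f x = g x\<rbrakk> \<Longrightarrow> AE x in M. mul c f x = mul c g x"
  unfolding mul_def by (intro rep_cong point_mass_closed)

lemma mul_add_arg: "\<lbrakk>c \<in> C0; f \<in> carr V; g \<in> carr V\<rbrakk> \<Longrightarrow>
    AE x in M. mul c (\<lambda>x. f x + g x) x = mul c f x + mul c g x"
  unfolding mul_def by (intro rep_add_arg point_mass_closed)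

lemma mul_scale_arg: "\<lbrakk>c \<in> C0; f \<in> carr V\<rbrakk> \<Longrightarrow> AE x in M. mul c (\<lambda>x. d * f x) x = d * mul c f x"
  unfolding mul_def by (intro rep_scale_arg point_mass_closed)

lemma mul_diff_arg:
  assumes c: "c \<in> C0" and f: "f \<in> carr V" and g: "g \<in> carr V"
  shows "AE x in M. mul c (\<lambda>x. f x - g x) x = mul c f x - mul c g x"
  using mul_add_arg[OF c f V_scale[OF g, of "-1"]] mul_scale_arg[OF c g, of "-1"]
  by eventually_elim simp

lemma mul_scale:
  assumes "c \<in> C0" "f \<in> carr V"
  shows "AE x in M. mul (\<lambda>x. d * c x) f x = d * mul c f x"
proof -
  have "point_mass (\<lambda>x. d * c x) (0::'g) = (\<lambda>g x. d * point_mass c 0 g x)"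
    by (auto simp: point_mass_def)
  then show ?thesis unfolding mul_def using rep_scale[OF point_mass_closed[OF assms(1)] assms(2)] by simp
qed

lemma mul_sum:
  assumes "\<And>i. i \<in> I \<Longrightarrow> c i \<in> C0" "f \<in> carr V"
  shows "AE x in M. mul (\<lambda>x. \<Sum>i\<in>I. c i x) f x = (\<Sum>i\<in>I. mul (c i) f x)"
proof -
  have "point_mass (\<lambda>x. \<Sum>i\<in>I. c i x) (0::'g) = (\<lambda>g x. \<Sum>i\<in>I. point_mass (c i) 0 g x)"
    by (auto simp: point_mass_def fun_eq_iff)
  then show ?thesis unfolding mul_def using rep_sum[OF assms(2) point_mass_closed[OF assms(1)]] by simp
qed

lemma mul_add:
  assumes "c \<in> C0" "d \<in> C0" "f \<in> carr V"
  shows "AE x in M. mul (\<lambda>x. c x + d x) f x = mul c f x + mul d f x"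
proof -
  have "point_mass (\<lambda>x. c x + d x) (0::'g) = (\<lambda>g x. point_mass c 0 g x + point_mass d 0 g x)"
    by (auto simp: point_mass_def fun_eq_iff)
  then show ?thesis unfolding mul_def
    using rep_add[OF point_mass_closed[OF assms(1)] point_mass_closed[OF assms(2)] assms(3)] by simp
qed

lemma mul_mult:
  assumes "c \<in> C0" "d \<in> C0" "f \<in> carr V"
  shows "AE x in M. mul (\<lambda>x. c x * d x) f x = mul c (mul d f) x"
  using rep_mult[OF point_mass_closed[OF assms(1)] point_mass_closed[OF assms(2)] assms(3), of 0 0]
  by (simp add: mul_def point_mass_mult)

text \<open>The function exp(i h) need not lie in C_0(X), so it is represented by 1 +
  \<open>mul\<close> of exp(i h) - 1. Contractivity is tested on f cut off by an approximate unit c,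
  where exp(i h) c is in C_0(X) with norm at most 1.\<close>

lemma mul_exp_contractive:
  fixes h :: "'x \<Rightarrow> real"
  assumes h: "(\<lambda>x. complex_of_real (h x)) \<in> C0" and f: "f \<in> carr V"
  shows "(\<lambda>x. exp (\<i> * of_real (h x)) - 1) \<in> C0" (is "?k \<in> C0")
    and "norm_of V (\<lambda>x. f x + mul (\<lambda>x. exp (\<i> * of_real (h x)) - 1) f x) \<le> norm_of V f"
proof -
  have hc: "continuous_on UNIV (\<lambda>x. complex_of_real (h x))" by (rule C0_continuous[OF h])
  show k: "?k \<in> C0"
    by (rule C0_bounded_image[OF h, of _ 1])
      (use norm_exp_i_minus_1_le in \<open>auto intro!: continuous_intros hc\<close>)
  have kf: "(\<lambda>x. f x + mul ?k f x) \<in> carr V" by (intro V_add f mul_closed k)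
  show "norm_of V (\<lambda>x. f x + mul ?k f x) \<le> norm_of V f"
  proof (rule field_le_epsilon)
    fix e :: real assume e: "0 < e"
    define B where "B = sup_norm ?k"
    have B: "0 \<le> B" unfolding B_def by (rule sup_norm_nonneg[OF k])
    \<comment> \<open>The part of f removed by the cutoff passes through an operator of norm at most
      \<open>1 + B\<close>.\<close>
    have "0 < e / (1 + B)" using e B by simp
    from approximate_unit[OF f this]
    obtain c :: "'x \<Rightarrow> real" where c: "(\<lambda>x. complex_of_real (c x)) \<in> C0" "\<And>x. 0 \<le> c x" "\<And>x. c x \<le> 1"
      and close: "norm_of V (\<lambda>x. mul (\<lambda>x. of_real (c x)) f x - f x) < e / (1 + B)"
      unfolding mul_def by blast
    let ?c = "\<lambda>x. complex_of_real (c x)"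
    have cf: "mul ?c f \<in> carr V" by (rule mul_closed[OF c(1) f])
    let ?r = "\<lambda>x. f x - mul ?c f x"
    have r: "?r \<in> carr V" by (intro V_diff f cf)
    have nr: "norm_of V ?r \<le> e / (1 + B)"
      using close V_norm_scale[of "-1" ?r] by simp
    have kc: "(\<lambda>x. ?k x * ?c x) \<in> C0" by (rule C0_mult[OF k c(1)])
    have sum: "(\<lambda>x. ?c x + ?k x * ?c x) \<in> C0" by (rule C0_add[OF c(1) kc])
    let ?m = "mul (\<lambda>x. ?c x + ?k x * ?c x) f"
    have m: "?m \<in> carr V" by (rule mul_closed[OF sum f])
    have rk: "(\<lambda>x. ?r x + mul ?k ?r x) \<in> carr V" by (intro V_add r mul_closed k)
    have "AE x in M. f x + mul ?k f x = ?m x + (?r x + mul ?k ?r x)"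
      using mul_add[OF c(1) kc f] mul_mult[OF k c(1) f] mul_diff_arg[OF k f cf]
      by eventually_elim simp
    then have "norm_of V (\<lambda>x. f x + mul ?k f x) = norm_of V (\<lambda>x. ?m x + (?r x + mul ?k ?r x))"
      by (intro V_norm_cong kf V_add m rk)
    also have "\<dots> \<le> norm_of V ?m + (norm_of V ?r + norm_of V (mul ?k ?r))"
      using V_triangle[OF m rk] V_triangle[OF r mul_closed[OF k r]] by simp
    also have "norm_of V ?m \<le> 1 * norm_of V f"
    proof (rule mul_bound_le[OF sum f])
      fix x
      have "?c x + ?k x * ?c x = exp (\<i> * of_real (h x)) * ?c x" by (simp add: algebra_simps)
      then show "norm (?c x + ?k x * ?c x) \<le> 1" using c(2,3)[of x] by (simp add: norm_mult)
    qed
    also have "norm_of V ?r + norm_of V (mul ?k ?r) \<le> (1 + B) * norm_of V ?r"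
      using mul_bound[OF k r] by (simp add: B_def algebra_simps)
    also have "\<dots> \<le> (1 + B) * (e / (1 + B))" using nr B by (intro mult_left_mono) auto
    also have "\<dots> = e" using B by simp
    finally show "norm_of V (\<lambda>x. f x + mul ?k f x) \<le> norm_of V f + e" by simp
  qed
qed

definition pairing :: "('n \<Rightarrow> complex) \<Rightarrow> ('n \<Rightarrow> complex) \<Rightarrow> complex" where
  "pairing g f = (\<integral>x. g x * dual_vector p (f x) \<partial>M)"

lemma pairing_integrable: "g \<in> carr V \<Longrightarrow> f \<in> carr V \<Longrightarrow> integrable M (\<lambda>x. g x * dual_vector p (f x))"
  unfolding V_def by (rule integrable_dual_vector[OF p])

lemma pairing_cong:
  assumes "f \<in> carr V" "g \<in> carr V" "h \<in> carr V" "AE x in M. g x = h x"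
  shows "pairing g f = pairing h f"
  unfolding pairing_def
  by (rule integral_cong_AE) (use assms V_measurable in \<open>auto elim: eventually_mono\<close>)

text \<open>
  \<open>\<parallel>f + is\<psi>(h)f\<parallel> \<le> \<parallel>f\<parallel> + O(s\<^sup>2)\<close>, while the tangent inequality bounds the \<open>p\<close>-th power of the left-hand
  side below by a function with derivative \<open>p Re(i\<langle>\<psi>(h)f, f\<rangle>)\<close> at \<open>s = 0\<close>.
\<close>

lemma hermitian:
  fixes h :: "'x \<Rightarrow> real"
  assumes h: "(\<lambda>x. complex_of_real (h x)) \<in> C0" and f: "f \<in> carr V"
  shows "Im (pairing (mul (\<lambda>x. of_real (h x)) f) f) = 0"
proof -
  let ?h = "\<lambda>x. complex_of_real (h x)"
  define H N where "H = sup_norm ?h" and "N = norm_of V f"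
  have H: "0 \<le> H" unfolding H_def by (rule sup_norm_nonneg[OF h])
  have hH: "\<bar>h x\<bar> \<le> H" for x using sup_norm_upper[OF h, of x] by (simp add: H_def)
  have N: "0 \<le> N" by (simp add: N_def V_norm_nonneg)
  define \<beta> where "\<beta> = Re (\<i> * pairing (mul ?h f) f)"
  have hf: "mul ?h f \<in> carr V" by (rule mul_closed[OF h f])
  have key: "N powr p + s * p * \<beta> \<le> (N + s\<^sup>2 * H\<^sup>2 * N) powr p" for s :: real
  proof -
    have sh: "(\<lambda>x. complex_of_real (s * h x)) \<in> C0" using C0_scale[OF h, of "of_real s"] by simp
    let ?k = "\<lambda>x. exp (\<i> * of_real (s * h x)) - 1"
    \<comment> \<open>The second-order Taylor remainder, so that 1 + i s \<open>mul ?h\<close> is a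
      contraction minus an operator of norm at most \<open>s^2 * H^2\<close>.\<close>
    let ?r = "\<lambda>x. ?k x + (- \<i> * of_real s) * ?h x"
    note k = mul_exp_contractive[OF sh f]
    have ish: "(\<lambda>x. (- \<i> * of_real s) * ?h x) \<in> C0" by (rule C0_scale[OF h])
    have r: "?r \<in> C0" by (rule C0_add[OF k(1) ish])
    have rb: "norm (?r x) \<le> s\<^sup>2 * H\<^sup>2" for x
    proof -
      have "norm (?r x) \<le> (s * h x)\<^sup>2"
        using norm_exp_i_taylor[of "s * h x"] by (simp add: algebra_simps)
      also have "\<dots> \<le> s\<^sup>2 * H\<^sup>2"
        unfolding power_mult_distrib using power_mono[OF hH[of x], of 2] by (intro mult_left_mono) auto
      finally show ?thesis .
    qed
    let ?w = "\<lambda>x. (\<i> * of_real s) * mul ?h f x"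
    have w: "?w \<in> carr V" by (intro V_scale hf)
    have "AE x in M. f x + ?w x = (f x + mul ?k f x) + (-1) * mul ?r f x"
      using mul_add[OF k(1) ish f] mul_scale[OF h f, of "- \<i> * of_real s"]
      by eventually_elim simp
    then have "norm_of V (\<lambda>x. f x + ?w x) = norm_of V (\<lambda>x. (f x + mul ?k f x) + (-1) * mul ?r f x)"
      by (intro V_norm_cong V_add V_scale mul_closed f hf k(1) r)
    also have "\<dots> \<le> norm_of V (\<lambda>x. f x + mul ?k f x) + norm_of V (\<lambda>x. (-1) * mul ?r f x)"
      by (intro V_triangle V_add V_scale mul_closed f k(1) r)
    also have "\<dots> \<le> N + s\<^sup>2 * H\<^sup>2 * N"
      using k(2) mul_bound_le[OF r f rb] V_norm_scale[of "-1"] by (simp add: N_def)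
    finally have le: "norm_of V (\<lambda>x. f x + ?w x) \<le> N + s\<^sup>2 * H\<^sup>2 * N" .
    define W where "W = (\<lambda>x. ?w x * dual_vector p (f x))"
    have int: "integrable M W" unfolding W_def by (rule pairing_integrable[OF w f])
    have fw: "(\<lambda>x. f x + ?w x) \<in> carr V" by (rule V_add[OF f w])
    have "N powr p + p * Re (\<integral>x. W x \<partial>M) = (\<integral>x. norm (f x) powr p + p * Re (W x) \<partial>M)"
      using V_integrable[OF f] int by (simp add: N_def V_norm_powr)
    also have "\<dots> \<le> (\<integral>x. norm (f x + ?w x) powr p \<partial>M)"
      using V_integrable[OF f] int V_integrable[OF fw] powr_norm_tangent[OF p]
      by (intro integral_mono) (auto simp: W_def simp del: times_complex.sel)
    also have "\<dots> \<le> (N + s\<^sup>2 * H\<^sup>2 * N) powr p"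
      unfolding V_norm_powr[symmetric] using le p V_norm_nonneg by (intro powr_mono2) auto
    finally show ?thesis
      by (simp add: W_def \<beta>_def pairing_def mult.assoc algebra_simps)
  qed
  \<comment> \<open>By \<open>key\<close>, \<open>G\<close> has a global minimum at 0; its
    derivative there, a multiple of \<open>\<beta>\<close>, must vanish, because the factor with
    \<open>s^2\<close> contributes nothing to first order.\<close>
  define G where "G = (\<lambda>s. (N powr p * (1 + s\<^sup>2 * H\<^sup>2) powr p) - s * p * \<beta>)"
  have "(G has_real_derivative - (p * \<beta>)) (at 0)"
    unfolding G_def by (auto intro!: derivative_eq_intros)
  moreover have "\<forall>s. \<bar>0 - s\<bar> < 1 \<longrightarrow> G 0 \<le> G s"
  proof (intro allI impI)
    fix s
    have "(N + s\<^sup>2 * H\<^sup>2 * N) powr p = (N * (1 + s\<^sup>2 * H\<^sup>2)) powr p" by (simp add: algebra_simps)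
    then show "G 0 \<le> G s" using key[of s] N by (simp add: G_def powr_mult)
  qed
  ultimately have "- (p * \<beta>) = 0" by (intro DERIV_local_min[of G _ 0 1]) auto
  then show ?thesis using p by (simp add: \<beta>_def)
qed

text \<open>Apply \<open>hermitian\<close> to f + z g: the diagonal terms are real in effect and
  drop out, leaving one linear condition on c and d for every scalar z. The additivity hypothesis
  holds for all pairs when p = 2 and for disjointly supported pairs in general.\<close>

lemma pairing_polar:
  fixes h :: "'x \<Rightarrow> real"
  assumes h: "(\<lambda>x. complex_of_real (h x)) \<in> C0" (is "?h \<in> C0") and f: "f \<in> carr V" and g: "g \<in> carr V"
    and add: "\<And>z x. dual_vector p (f x + z * g x) = dual_vector p (f x) + dual_vector p z * dual_vector p (g x)"
  shows "pairing (mul (\<lambda>x. of_real (h x)) g) f = cnj (pairing (mul (\<lambda>x. of_real (h x)) f) g)"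
    and "p \<noteq> 2 \<Longrightarrow> pairing (mul (\<lambda>x. of_real (h x)) f) g = 0"
proof -
  define c d where "c = pairing (mul ?h g) f" and "d = pairing (mul ?h f) g"
  have hf: "mul ?h f \<in> carr V" and hg: "mul ?h g \<in> carr V" by (intro mul_closed h f g)+
  have main: "Im (z * c + dual_vector p z * d) = 0" for z
  proof -
    have fg: "(\<lambda>x. f x + z * g x) \<in> carr V" by (intro V_add V_scale f g)
    have hfg: "(\<lambda>x. mul ?h f x + z * mul ?h g x) \<in> carr V" by (intro V_add V_scale hf hg)
    have "AE x in M. mul ?h (\<lambda>x. f x + z * g x) x = mul ?h f x + z * mul ?h g x"
      using mul_add_arg[OF h f V_scale[OF g, of z]] mul_scale_arg[OF h g, of z]
      by eventually_elim simp
    then have "pairing (mul ?h (\<lambda>x. f x + z * g x)) (\<lambda>x. f x + z * g x)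
        = pairing (\<lambda>x. mul ?h f x + z * mul ?h g x) (\<lambda>x. f x + z * g x)"
      by (intro pairing_cong fg hfg mul_closed h)
    also have "\<dots> = (\<integral>x. mul ?h f x * dual_vector p (f x) + z * (mul ?h g x * dual_vector p (f x))
        + dual_vector p z * (mul ?h f x * dual_vector p (g x))
        + (z * dual_vector p z) * (mul ?h g x * dual_vector p (g x)) \<partial>M)"
      unfolding pairing_def add by (intro Bochner_Integration.integral_cong) (auto simp: algebra_simps)
    also have "\<dots> = pairing (mul ?h f) f + z * c + dual_vector p z * d
        + (z * dual_vector p z) * pairing (mul ?h g) g"
      using pairing_integrable[OF hf f] pairing_integrable[OF hg f] pairing_integrable[OF hf g]
        pairing_integrable[OF hg g]
      by (simp add: pairing_def c_def d_def)
    finally show ?thesis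
      using hermitian[OF h fg] hermitian[OF h f] hermitian[OF h g]
      by (simp add: mult_dual_vector)
  qed
  have d1: "dual_vector p 1 = 1" "dual_vector p \<i> = - \<i>"
    by (simp_all add: dual_vector_def)
  have d2: "dual_vector p 2 = of_real (2 powr (p - 1))" "dual_vector p (2 * \<i>) = - \<i> * of_real (2 powr (p - 1))"
  proof -
    have two: "2 * 2 powr (p - 2) = 2 powr (p - (1::real))"
      using powr_add[of 2 1 "p - 2"] by simp
    have "dual_vector p 2 = of_real (2 * 2 powr (p - 2))" by (simp add: dual_vector_def)
    then show *: "dual_vector p 2 = of_real (2 powr (p - 1))" unfolding two .
    show "dual_vector p (2 * \<i>) = - \<i> * of_real (2 powr (p - 1))"
      unfolding dual_vector_mult * d1 by simp
  qed
  have cd: "Im c + Im d = 0" "Re c - Re d = 0"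
    using main[of 1] main[of \<i>] by (simp_all add: d1)
  then show "c = cnj d" by (simp add: complex_eq_iff)
  \<comment> \<open>Replacing z by 2 z multiplies the two terms by 2 and by
    \<open>2 powr (p - 1)\<close>. These factors differ, so comparison with z = 1 and z = i forces d
    = 0.\<close>
  assume "p \<noteq> 2"
  then have m: "2 powr (p - 1) \<noteq> 2"
    using powr_inj[of 2 "p - 1" 1] by simp
  have "2 * Im c + 2 powr (p - 1) * Im d = 0" "2 * Re c - 2 powr (p - 1) * Re d = 0"
    using main[of 2] main[of "2 * \<i>"] by (simp_all add: d2)
  moreover have "(2 powr (p - 1) - 2) * Im d = 2 * Im c + 2 powr (p - 1) * Im d"
      "(2 powr (p - 1) - 2) * Re d = - (2 * Re c - 2 powr (p - 1) * Re d)"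
    using cd by (simp_all add: left_diff_distrib)
  ultimately have "(2 powr (p - 1) - 2) * Im d = 0" "(2 powr (p - 1) - 2) * Re d = 0" by simp_all
  then show "d = 0" using m by (simp add: complex_eq_iff)
qed

section \<open>Locality for p \<noteq> 2\<close>

text \<open>Commutation with indicators expresses that \<open>mul c\<close> acts pointwise, without
  having to produce a multiplying function on an arbitrary measure space.\<close>

definition local_multiplier :: "('x \<Rightarrow> complex) \<Rightarrow> bool" where
  "local_multiplier c \<longleftrightarrow> c \<in> C0 \<and> (\<forall>f\<in>carr V. \<forall>B\<in>sets M.
    AE x in M. mul c (\<lambda>x. indicator B x * f x) x = indicator B x * mul c f x)"

lemma local_multiplier_real:
  fixes h :: "'x \<Rightarrow> real"
  assumes h: "(\<lambda>x. complex_of_real (h x)) \<in> C0" (is "?h \<in> C0") and p2: "p \<noteq> 2"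
  shows "local_multiplier (\<lambda>x. of_real (h x))"
  unfolding local_multiplier_def
proof (intro conjI ballI h)
  have vanish: "AE x in M. x \<in> B \<longrightarrow> mul ?h f x = 0"
    if f: "f \<in> carr V" and B: "B \<in> sets M" and fB: "\<And>x. x \<in> B \<Longrightarrow> f x = 0" for f B
  proof -
    let ?g = "\<lambda>x. indicator B x * mul ?h f x"
    have hf: "mul ?h f \<in> carr V" by (intro mul_closed h f)
    have g: "?g \<in> carr V" by (rule V_restrict[OF hf B])
    \<comment> \<open>The test function is the part of \<open>mul ?h f\<close> lying where
      \<open>f\<close> vanishes. It is disjoint from \<open>f\<close>, and pairing with it returns
      the p-th power of its own norm.\<close>
    have "pairing (mul ?h f) ?g = 0"
      using fB by (intro pairing_polar(2)[OF h f g _ p2] dual_vector_add_disjoint)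
        (auto split: split_indicator)
    moreover have "pairing (mul ?h f) ?g = of_real (\<integral>x. norm (?g x) powr p \<partial>M)"
      unfolding pairing_def integral_complex_of_real[symmetric]
      by (intro Bochner_Integration.integral_cong) (auto simp: mult_dual_vector split: split_indicator)
    ultimately have "norm_of V ?g powr p = 0" by (simp add: V_norm_powr)
    then have "AE x in M. ?g x = 0" using V_norm_zero_iff[OF g] by simp
    then show ?thesis by eventually_elim (auto split: split_indicator_asm)
  qed
  fix f B assume f: "f \<in> carr V" and B: "B \<in> sets M"
  let ?C = "space M - B"
  have C: "?C \<in> sets M" using B by auto
  let ?fB = "\<lambda>x. indicator B x * f x" and ?fC = "\<lambda>x. indicator ?C x * f x"
  have fB: "?fB \<in> carr V" and fC: "?fC \<in> carr V" by (intro V_restrict f B C)+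
  have "AE x in M. f x = ?fB x + ?fC x"
    using AE_space by eventually_elim (auto split: split_indicator)
  then have "AE x in M. mul ?h f x = mul ?h (\<lambda>x. ?fB x + ?fC x) x"
    by (intro mul_cong h f V_add fB fC)
  moreover have "AE x in M. mul ?h (\<lambda>x. ?fB x + ?fC x) x = mul ?h ?fB x + mul ?h ?fC x"
    by (rule mul_add_arg[OF h fB fC])
  moreover have "AE x in M. x \<in> ?C \<longrightarrow> mul ?h ?fB x = 0"
    by (rule vanish[OF fB C]) auto
  moreover have "AE x in M. x \<in> B \<longrightarrow> mul ?h ?fC x = 0"
    by (rule vanish[OF fC B]) auto
  ultimately show "AE x in M. mul ?h ?fB x = indicator B x * mul ?h f x"
    using AE_space by eventually_elim (auto split: split_indicator)
qed

lemma local_multiplier_sum: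
  assumes fin: "finite T" and T: "\<And>t. t \<in> T \<Longrightarrow> local_multiplier (c t)"
  shows "local_multiplier (\<lambda>x. \<Sum>t\<in>T. l t * c t x)"
proof -
  have c: "c t \<in> C0" and lc: "(\<lambda>x. l t * c t x) \<in> C0" if "t \<in> T" for t
    using T[OF that] by (auto simp: local_multiplier_def intro: C0_scale)
  show ?thesis
    unfolding local_multiplier_def
  proof (intro conjI ballI C0_sum lc)
    fix f B assume f: "f \<in> carr V" and B: "B \<in> sets M"
    have fB: "(\<lambda>x. indicator B x * f x) \<in> carr V" by (rule V_restrict[OF f B])
    have ev: "AE x in M. \<forall>t\<in>T. mul (\<lambda>x. l t * c t x) (\<lambda>x. indicator B x * f x) x
        = indicator B x * mul (\<lambda>x. l t * c t x) f x"
    proof (rule AE_finite_allI[OF fin])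
      fix t assume t: "t \<in> T"
      have "AE x in M. mul (c t) (\<lambda>x. indicator B x * f x) x = indicator B x * mul (c t) f x"
        using T[OF t] f B by (auto simp: local_multiplier_def)
      then show "AE x in M. mul (\<lambda>x. l t * c t x) (\<lambda>x. indicator B x * f x) x
          = indicator B x * mul (\<lambda>x. l t * c t x) f x"
        using mul_scale[OF c[OF t] f, of "l t"] mul_scale[OF c[OF t] fB, of "l t"]
        by eventually_elim simp
    qed
    have ms: "AE x in M. mul (\<lambda>x. \<Sum>t\<in>T. l t * c t x) g x = (\<Sum>t\<in>T. mul (\<lambda>x. l t * c t x) g x)"
      if "g \<in> carr V" for g
      using that by (intro mul_sum lc)
    show "AE x in M. mul (\<lambda>x. \<Sum>t\<in>T. l t * c t x) (\<lambda>x. indicator B x * f x) x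
        = indicator B x * mul (\<lambda>x. \<Sum>t\<in>T. l t * c t x) f x"
      using ev ms[OF f] ms[OF fB] by eventually_elim (simp add: sum_distrib_left)
  qed
qed

text \<open>Restrict to the set where the estimate fails. Locality moves the indicator through
  \<open>mul c\<close>, and the norm bound for the restricted function forces that set to be
  null.\<close>

lemma local_multiplier_pointwise:
  assumes c: "local_multiplier c" and f: "f \<in> carr V" and B: "\<And>x. norm (c x) \<le> B"
  shows "AE x in M. norm (mul c f x) \<le> B * norm (f x)"
proof -
  have c0: "c \<in> C0" using c by (simp add: local_multiplier_def)
  have B0: "0 \<le> B" using B norm_ge_zero order_trans by blast
  have cf: "mul c f \<in> carr V" by (rule mul_closed[OF c0 f])
  note [measurable] = V_measurable[OF f] V_measurable[OF cf]
  define S where "S = {x \<in> space M. B * norm (f x) < norm (mul c f x)}"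
  have S: "S \<in> sets M" unfolding S_def by measurable
  let ?a = "\<lambda>x. indicator S x * mul c f x" and ?b = "\<lambda>x. indicator S x * f x"
  have a: "?a \<in> carr V" and b: "?b \<in> carr V" by (intro V_restrict S cf f)+
  have "AE x in M. mul c ?b x = ?a x" using c f S by (simp add: local_multiplier_def)
  then have "norm_of V ?a = norm_of V (mul c ?b)"
    by (intro V_norm_cong[symmetric] a mul_closed c0 b)
  also have "\<dots> \<le> B * norm_of V ?b" by (rule mul_bound_le[OF c0 b B])
  finally have "norm_of V ?a powr p \<le> B powr p * norm_of V ?b powr p"
    using p V_norm_nonneg B0 by (subst powr_mult[symmetric]) (auto intro: powr_mono2)
  then have le: "(\<integral>x. norm (?a x) powr p - B powr p * norm (?b x) powr p \<partial>M) \<le> 0"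
    using V_integrable[OF a] V_integrable[OF b] by (simp add: V_norm_powr)
  have int: "integrable M (\<lambda>x. norm (?a x) powr p - B powr p * norm (?b x) powr p)"
    using V_integrable[OF a] V_integrable[OF b] by simp
  have pos: "B powr p * norm (?b x) powr p < norm (?a x) powr p" if "x \<in> S" for x
    using that p B0 by (simp add: S_def powr_mult[symmetric] powr_less_mono2)
  have nonneg: "0 \<le> norm (?a x) powr p - B powr p * norm (?b x) powr p" for x
    using pos[of x] by (cases "x \<in> S") auto
  have "(\<integral>x. norm (?a x) powr p - B powr p * norm (?b x) powr p \<partial>M) = 0"
    using le nonneg by (intro antisym integral_nonneg_AE) auto
  then have "AE x in M. norm (?a x) powr p - B powr p * norm (?b x) powr p = 0"
    using nonneg by (subst (asm) integral_nonneg_eq_0_iff_AE[OF int]) auto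
  then have "AE x in M. x \<notin> S" by eventually_elim (use pos in force)
  then show ?thesis using AE_space by eventually_elim (auto simp: S_def)
qed

section \<open>Row and column contractions\<close>

lemma pairing_self: "pairing f f = of_real (\<integral>x. norm (f x) powr p \<partial>M)"
  unfolding pairing_def mult_dual_vector by (rule integral_complex_of_real)

lemma norm_pairing_le:
  assumes g: "g \<in> carr V" and f: "f \<in> carr V"
  shows "norm (pairing g f) \<le> (\<integral>x. norm (g x) powr p \<partial>M) / p + (1 - 1 / p) * (\<integral>x. norm (f x) powr p \<partial>M)"
proof -
  have "norm (pairing g f) \<le> (\<integral>x. norm (g x) powr p / p + (1 - 1 / p) * norm (f x) powr p \<partial>M)"
    unfolding pairing_def
    by (rule order_trans[OF integral_norm_bound], rule integral_mono)
      (use Young_dual_vector[OF p] V_integrable[OF f] V_integrable[OF g] pairing_integrable[OF g f] in auto)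
  then show ?thesis using V_integrable[OF f] V_integrable[OF g] by simp
qed

lemma pairing_sum:
  assumes "\<And>t. t \<in> T \<Longrightarrow> g t \<in> carr V" "f \<in> carr V"
  shows "pairing (\<lambda>x. \<Sum>t\<in>T. g t x) f = (\<Sum>t\<in>T. pairing (g t) f)"
  unfolding pairing_def sum_distrib_right
  by (rule Bochner_Integration.integral_sum) (use assms pairing_integrable in auto)

lemma self_adjoint:
  fixes h :: "'x \<Rightarrow> real"
  assumes "p = 2" "(\<lambda>x. complex_of_real (h x)) \<in> C0" "f \<in> carr V" "g \<in> carr V"
  shows "pairing (mul (\<lambda>x. of_real (h x)) g) f = cnj (pairing (mul (\<lambda>x. of_real (h x)) f) g)"
  using assms by (intro pairing_polar(1)) (simp_all add: dual_vector_2)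

text \<open>The combination of the \<open>k t\<close> with constant coefficients \<open>l t\<close>
  is one local multiplier, whose sup norm Hoelder's inequality bounds. Columns use it with r = q,
  rows with r = p.\<close>

lemma mul_pointwise_family:
  fixes k :: "'t \<Rightarrow> 'x \<Rightarrow> real"
  assumes "p \<noteq> 2" and T: "finite T" and k: "\<And>t. t \<in> T \<Longrightarrow> (\<lambda>x. complex_of_real (k t x)) \<in> C0"
    and nonneg: "\<And>t x. 0 \<le> k t x" and r: "1 < r" "1 / r + 1 / r' = 1"
    and sum1: "\<And>x. (\<Sum>t\<in>T. k t x powr r') \<le> 1" and f: "f \<in> carr V"
  shows "AE x in M. norm (\<Sum>t\<in>T. l t * mul (\<lambda>x. of_real (k t x)) f x)
    \<le> (\<Sum>t\<in>T. norm (l t) powr r) powr (1 / r) * norm (f x)"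
proof -
  let ?k = "\<lambda>t x. complex_of_real (k t x)"
  have "local_multiplier (\<lambda>x. \<Sum>t\<in>T. l t * ?k t x)"
    using assms by (intro local_multiplier_sum local_multiplier_real) auto
  moreover have "norm (\<Sum>t\<in>T. l t * ?k t x) \<le> (\<Sum>t\<in>T. norm (l t) powr r) powr (1 / r)" for x
  proof -
    have "norm (\<Sum>t\<in>T. l t * ?k t x) \<le> (\<Sum>t\<in>T. norm (l t) * k t x)"
      using nonneg by (intro sum_norm_le) (simp add: norm_mult)
    also have "\<dots> \<le> (\<Sum>t\<in>T. norm (l t) powr r) powr (1 / r) * (\<Sum>t\<in>T. k t x powr r') powr (1 / r')"
      using r T nonneg by (intro Holder_inequality_sum) auto
    also have "\<dots> \<le> (\<Sum>t\<in>T. norm (l t) powr r) powr (1 / r) * 1"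
    proof (intro mult_left_mono)
      have "1 / r < 1" using r(1) by simp
      then have "0 \<le> 1 / r'" using r(2) by linarith
      then show "(\<Sum>t\<in>T. k t x powr r') powr (1 / r') \<le> 1"
        using powr_mono2[of "1 / r'" "\<Sum>t\<in>T. k t x powr r'" 1] sum1[of x] by (simp add: sum_nonneg)
    qed simp
    finally show ?thesis by simp
  qed
  ultimately have 1: "AE x in M. norm (mul (\<lambda>x. \<Sum>t\<in>T. l t * ?k t x) f x)
      \<le> (\<Sum>t\<in>T. norm (l t) powr r) powr (1 / r) * norm (f x)"
    by (rule local_multiplier_pointwise[OF _ f])
  have 2: "AE x in M. mul (\<lambda>x. \<Sum>t\<in>T. l t * ?k t x) f x = (\<Sum>t\<in>T. mul (\<lambda>x. l t * ?k t x) f x)"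
    by (rule mul_sum[of T "\<lambda>t x. l t * ?k t x", OF _ f]) (rule C0_scale[OF k])
  have "AE x in M. \<forall>t\<in>T. mul (\<lambda>x. l t * ?k t x) f x = l t * mul (?k t) f x"
    by (rule AE_finite_allI[OF T]) (intro mul_scale k f)
  with 1 2 show ?thesis by eventually_elim simp
qed

text \<open>
  For \<open>p \<noteq> 2\<close> the pointwise bounds for countably many dense coefficient families \<open>l\<close> hold
  simultaneously almost everywhere, and then for all \<open>l\<close> by continuity, even for those that depend on
  the point.
\<close>

lemma column_contraction:
  fixes k :: "'t \<Rightarrow> 'x \<Rightarrow> real"
  assumes T: "finite T" and k: "\<And>t. t \<in> T \<Longrightarrow> (\<lambda>x. complex_of_real (k t x)) \<in> C0"
    and nonneg: "\<And>t x. 0 \<le> k t x" and sum1: "\<And>x. (\<Sum>t\<in>T. k t x powr p) \<le> 1" and f: "f \<in> carr V"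
  shows "(\<Sum>t\<in>T. \<integral>x. norm (mul (\<lambda>x. of_real (k t x)) f x) powr p \<partial>M) \<le> (\<integral>x. norm (f x) powr p \<partial>M)"
proof -
  define \<eta> where "\<eta> = (\<lambda>t. mul (\<lambda>x. of_real (k t x)) f)"
  have \<eta>: "\<eta> t \<in> carr V" if "t \<in> T" for t unfolding \<eta>_def by (intro mul_closed k that f)
  have "(\<Sum>t\<in>T. \<integral>x. norm (\<eta> t x) powr p \<partial>M) \<le> (\<integral>x. norm (f x) powr p \<partial>M)"
  proof (cases "p = 2")
    case False
    define q where "q = p / (p - 1)"
    have q: "1 < q" "1 / q + 1 / p = 1" using p by (auto simp: q_def field_simps)
    obtain D :: "('t \<Rightarrow> complex) set" where D: "countable D"
      and dense: "\<And>l. \<exists>\<mu>. (\<forall>n::nat. \<mu> n \<in> D) \<and> (\<forall>t\<in>T. (\<lambda>n. \<mu> n t) \<longlonglongrightarrow> l t)"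
      using countable_dense_families[OF T] by metis
    have "AE x in M. norm (\<Sum>t\<in>T. l t * \<eta> t x) \<le> (\<Sum>t\<in>T. norm (l t) powr q) powr (1 / q) * norm (f x)" for l
      unfolding \<eta>_def by (rule mul_pointwise_family[OF False T k nonneg q sum1 f])
    then have "AE x in M. \<forall>l\<in>D. norm (\<Sum>t\<in>T. l t * \<eta> t x) \<le> (\<Sum>t\<in>T. norm (l t) powr q) powr (1 / q) * norm (f x)"
      using D by (simp add: AE_ball_countable)
    then have "AE x in M. (\<Sum>t\<in>T. norm (\<eta> t x) powr p) \<le> norm (f x) powr p"
    proof eventually_elim
      fix x assume x: "\<forall>l\<in>D. norm (\<Sum>t\<in>T. l t * \<eta> t x) \<le> (\<Sum>t\<in>T. norm (l t) powr q) powr (1 / q) * norm (f x)"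
      define l where "l = (\<lambda>t. dual_vector p (\<eta> t x))"
      obtain \<mu> where \<mu>: "\<And>n::nat. \<mu> n \<in> D" "\<And>t. t \<in> T \<Longrightarrow> (\<lambda>n. \<mu> n t) \<longlonglongrightarrow> l t"
        using dense[of l] by blast
      have le: "norm (\<Sum>t\<in>T. l t * \<eta> t x) \<le> (\<Sum>t\<in>T. norm (l t) powr q) powr (1 / q) * norm (f x)"
      proof (rule LIMSEQ_le)
        show "(\<lambda>n. norm (\<Sum>t\<in>T. \<mu> n t * \<eta> t x)) \<longlonglongrightarrow> norm (\<Sum>t\<in>T. l t * \<eta> t x)"
          by (intro tendsto_intros \<mu>)
        show "(\<lambda>n. (\<Sum>t\<in>T. norm (\<mu> n t) powr q) powr (1 / q) * norm (f x))
            \<longlonglongrightarrow> (\<Sum>t\<in>T. norm (l t) powr q) powr (1 / q) * norm (f x)"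
          using q by (intro tendsto_mult tendsto_powr' tendsto_sum tendsto_norm \<mu> tendsto_const)
            (auto intro!: always_eventually sum_nonneg)
      qed (use x \<mu>(1) in auto)
      define S where "S = (\<Sum>t\<in>T. norm (\<eta> t x) powr p)"
      have S0: "0 \<le> S" unfolding S_def by (intro sum_nonneg) auto
      have "(\<Sum>t\<in>T. l t * \<eta> t x) = of_real S"
        using mult_dual_vector[of _ p] by (simp add: l_def S_def mult.commute)
      moreover have "norm (l t) powr q = norm (\<eta> t x) powr p" for t
        using p by (simp add: l_def norm_dual_vector powr_powr q_def)
      ultimately have "S \<le> S powr (1 / q) * norm (f x)" using le S0 by (simp add: S_def[symmetric])
      moreover have "S = S powr (1 / q) * S powr (1 / p)"
        using S0 q(2) by (simp add: powr_add[symmetric])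
      ultimately have "S = 0 \<or> S powr (1 / p) \<le> norm (f x)"
        using S0 by (metis mult_le_cancel_left_pos less_eq_real_def powr_gt_zero)
      then have "S \<le> norm (f x) powr p"
      proof
        assume "S powr (1 / p) \<le> norm (f x)"
        then have "(S powr (1 / p)) powr p \<le> norm (f x) powr p" using p by (intro powr_mono2) auto
        then show ?thesis using p S0 by (simp add: powr_powr)
      qed simp
      then show "(\<Sum>t\<in>T. norm (\<eta> t x) powr p) \<le> norm (f x) powr p" by (simp add: S_def)
    qed
    then have "(\<integral>x. (\<Sum>t\<in>T. norm (\<eta> t x) powr p) \<partial>M) \<le> (\<integral>x. norm (f x) powr p \<partial>M)"
      using V_integrable[OF \<eta>] V_integrable[OF f] by (intro integral_mono_AE) auto
    then show ?thesis using V_integrable[OF \<eta>] by simp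
  next
    case True
    let ?k = "\<lambda>t x. complex_of_real (k t x)"
    \<comment> \<open>For p = 2 self-adjointness moves one factor across, so the column has squared
      norm equal to the pairing of \<open>mul ?K f\<close> with f, where \<open>?K\<close> is
      bounded by 1.\<close>
    let ?K = "\<lambda>x. \<Sum>t\<in>T. ?k t x * ?k t x"
    have kk: "(\<lambda>x. ?k t x * ?k t x) \<in> C0" if "t \<in> T" for t by (intro C0_mult k that)
    have K: "?K \<in> C0" by (rule C0_sum[OF kk])
    have Kf: "mul ?K f \<in> carr V" by (rule mul_closed[OF K f])
    have K1: "norm (?K x) \<le> 1" for x
    proof -
      have "?K x = of_real (\<Sum>t\<in>T. k t x powr p)"
        using nonneg True by (simp add: power2_eq_square)
      then show ?thesis using sum1[of x] by (simp add: sum_nonneg del: of_real_sum)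
    qed
    have sq: "mul (\<lambda>x. ?k t x * ?k t x) f \<in> carr V" if "t \<in> T" for t by (intro mul_closed kk that f)
    have "of_real (\<Sum>t\<in>T. \<integral>x. norm (\<eta> t x) powr p \<partial>M) = (\<Sum>t\<in>T. pairing (\<eta> t) (\<eta> t))"
      by (simp add: pairing_self)
    also have "\<dots> = (\<Sum>t\<in>T. cnj (pairing (mul (\<lambda>x. ?k t x * ?k t x) f) f))"
    proof (rule sum.cong[OF refl])
      fix t assume t: "t \<in> T"
      have "pairing (\<eta> t) (\<eta> t) = cnj (pairing (mul (?k t) (\<eta> t)) f)"
        using self_adjoint[OF True k[OF t] \<eta>[OF t] f] by (simp add: \<eta>_def)
      also have "pairing (mul (?k t) (\<eta> t)) f = pairing (mul (\<lambda>x. ?k t x * ?k t x) f) f"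
        using mul_mult[OF k[OF t] k[OF t] f] unfolding \<eta>_def
        by (intro pairing_cong[symmetric] f mul_closed k t C0_mult)
      finally show "pairing (\<eta> t) (\<eta> t) = cnj (pairing (mul (\<lambda>x. ?k t x * ?k t x) f) f)" .
    qed
    also have "\<dots> = cnj (pairing (\<lambda>x. \<Sum>t\<in>T. mul (\<lambda>x. ?k t x * ?k t x) f x) f)"
      using pairing_sum[of T "\<lambda>t. mul (\<lambda>x. ?k t x * ?k t x) f" f] sq f by simp
    also have "pairing (\<lambda>x. \<Sum>t\<in>T. mul (\<lambda>x. ?k t x * ?k t x) f x) f = pairing (mul ?K f) f"
      using mul_sum[of T "\<lambda>t x. ?k t x * ?k t x" f] kk f sq
      by (intro pairing_cong[symmetric] f Kf V_sum) auto
    finally have "norm (complex_of_real (\<Sum>t\<in>T. \<integral>x. norm (\<eta> t x) powr p \<partial>M)) = norm (cnj (pairing (mul ?K f) f))"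
      by (rule arg_cong)
    then have "\<bar>\<Sum>t\<in>T. \<integral>x. norm (\<eta> t x) powr p \<partial>M\<bar> = norm (pairing (mul ?K f) f)"
      unfolding norm_of_real complex_mod_cnj .
    also have "\<dots> \<le> (\<integral>x. norm (mul ?K f x) powr p \<partial>M) / p + (1 - 1 / p) * (\<integral>x. norm (f x) powr p \<partial>M)"
      by (rule norm_pairing_le[OF Kf f])
    also have "(\<integral>x. norm (mul ?K f x) powr p \<partial>M) \<le> (\<integral>x. norm (f x) powr p \<partial>M)"
      unfolding V_norm_powr[symmetric]
      using mul_bound_le[OF K f K1] p V_norm_nonneg by (intro powr_mono2) auto
    finally show ?thesis using True by simp
  qed
  then show ?thesis by (simp add: \<eta>_def)
qed

text \<open>For p \<noteq> 2 the distinct functions \<eta>_t are written pointwise as scalar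
  multiples of one function w. An estimate with constant coefficients and an error term is proved
  first and specialised at each point afterwards. For p = 2 self-adjointness reduces the row to a
  column applied to the output \<zeta>.\<close>

lemma row_contraction:
  fixes k :: "'t \<Rightarrow> 'x \<Rightarrow> real"
  assumes T: "finite T" and k: "\<And>t. t \<in> T \<Longrightarrow> (\<lambda>x. complex_of_real (k t x)) \<in> C0"
    and nonneg: "\<And>t x. 0 \<le> k t x" and pq: "1 / p + 1 / q = 1"
    and sum1: "\<And>x. (\<Sum>t\<in>T. k t x powr q) \<le> 1" and \<eta>: "\<And>t. t \<in> T \<Longrightarrow> \<eta> t \<in> carr V"
  shows "(\<integral>x. norm (\<Sum>t\<in>T. mul (\<lambda>x. of_real (k t x)) (\<eta> t) x) powr p \<partial>M)
    \<le> (\<Sum>t\<in>T. \<integral>x. norm (\<eta> t x) powr p \<partial>M)"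
proof -
  let ?k = "\<lambda>t x. complex_of_real (k t x)"
  define \<zeta> where "\<zeta> = (\<lambda>x. \<Sum>t\<in>T. mul (?k t) (\<eta> t) x)"
  have k\<eta>: "mul (?k t) (\<eta> t) \<in> carr V" if "t \<in> T" for t by (intro mul_closed k that \<eta>)
  have \<zeta>: "\<zeta> \<in> carr V" unfolding \<zeta>_def by (rule V_sum) (rule k\<eta>)
  have "(\<integral>x. norm (\<zeta> x) powr p \<partial>M) \<le> (\<Sum>t\<in>T. \<integral>x. norm (\<eta> t x) powr p \<partial>M)"
  proof (cases "p = 2")
    case False
    have q: "0 < q"
    proof -
      have "1 / q = 1 - 1 / p" using pq by simp
      then have "0 < 1 / q" using p by simp
      then show ?thesis by simp
    qed
    have k1: "norm (?k t x) \<le> 1" if "t \<in> T" for t x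
    proof -
      have "k t x powr q \<le> (\<Sum>t\<in>T. k t x powr q)" using that T by (intro member_le_sum) auto
      then have "k t x powr q \<le> 1 powr q" using sum1[of x] by simp
      then have "k t x \<le> 1" using q by (rule powr_le_imp_le) simp
      then show ?thesis using nonneg by simp
    qed
    \<comment> \<open>The sum of moduli vanishes only where every \<eta>_t does, so the quotients
      below represent all of them.\<close>
    define w where "w = (\<lambda>x. complex_of_real (\<Sum>t\<in>T. norm (\<eta> t x)))"
    have w: "w \<in> carr V"
      unfolding w_def of_real_sum
    proof (rule V_sum)
      fix t assume t: "t \<in> T"
      show "(\<lambda>x. complex_of_real (norm (\<eta> t x))) \<in> carr V"
        unfolding V_def
        by (rule Lp_functions_dominated[OF _ V_integrable[OF \<eta>[OF t]]])
          (use V_measurable[OF \<eta>[OF t]] in auto)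
    qed
    obtain D :: "('t \<Rightarrow> complex) set" where D: "countable D"
      and dense: "\<And>l. \<exists>\<mu>. (\<forall>n::nat. \<mu> n \<in> D) \<and> (\<forall>t\<in>T. (\<lambda>n. \<mu> n t) \<longlonglongrightarrow> l t)"
      using countable_dense_families[OF T] by metis
    \<comment> \<open>The error term, controlled by locality of each single \<open>k t\<close>,
      disappears once \<open>l t\<close> equals \<eta>_t(x) / w(x).\<close>
    have "AE x in M. norm (\<zeta> x) \<le> (\<Sum>t\<in>T. norm (l t) powr p) powr (1 / p) * norm (w x)
        + (\<Sum>t\<in>T. norm (\<eta> t x - l t * w x))" for l
    proof -
      have 1: "AE x in M. norm (\<Sum>t\<in>T. l t * mul (?k t) w x) \<le> (\<Sum>t\<in>T. norm (l t) powr p) powr (1 / p) * norm (w x)"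
        by (rule mul_pointwise_family[OF False T k nonneg p pq sum1 w])
      have 2: "AE x in M. \<forall>t\<in>T. norm (mul (?k t) (\<eta> t) x - l t * mul (?k t) w x) \<le> norm (\<eta> t x - l t * w x)"
      proof (rule AE_finite_allI[OF T])
        fix t assume t: "t \<in> T"
        have lw: "(\<lambda>x. l t * w x) \<in> carr V" by (rule V_scale[OF w])
        have "AE x in M. norm (mul (?k t) (\<lambda>x. \<eta> t x - l t * w x) x) \<le> 1 * norm (\<eta> t x - l t * w x)"
          by (rule local_multiplier_pointwise[OF local_multiplier_real[OF k[OF t] False] V_diff[OF \<eta>[OF t] lw] k1[OF t]])
        then show "AE x in M. norm (mul (?k t) (\<eta> t) x - l t * mul (?k t) w x) \<le> norm (\<eta> t x - l t * w x)"
          using mul_diff_arg[OF k[OF t] \<eta>[OF t] lw] mul_scale_arg[OF k[OF t] w, of "l t"]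
          by eventually_elim simp
      qed
      show ?thesis using 1 2
      proof eventually_elim
        fix x assume a: "norm (\<Sum>t\<in>T. l t * mul (?k t) w x) \<le> (\<Sum>t\<in>T. norm (l t) powr p) powr (1 / p) * norm (w x)"
          and b: "\<forall>t\<in>T. norm (mul (?k t) (\<eta> t) x - l t * mul (?k t) w x) \<le> norm (\<eta> t x - l t * w x)"
        let ?A = "\<Sum>t\<in>T. l t * mul (?k t) w x" and ?B = "\<Sum>t\<in>T. mul (?k t) (\<eta> t) x - l t * mul (?k t) w x"
        have eq: "\<zeta> x = (\<Sum>t\<in>T. l t * mul (?k t) w x) + (\<Sum>t\<in>T. mul (?k t) (\<eta> t) x - l t * mul (?k t) w x)"
          by (simp add: \<zeta>_def sum_subtractf)
        have "norm ?B \<le> (\<Sum>t\<in>T. norm (\<eta> t x - l t * w x))"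
          using b by (intro sum_norm_le) auto
        then show "norm (\<zeta> x) \<le> (\<Sum>t\<in>T. norm (l t) powr p) powr (1 / p) * norm (w x)
            + (\<Sum>t\<in>T. norm (\<eta> t x - l t * w x))"
          unfolding eq using a norm_triangle_ineq[of ?A ?B] by linarith
      qed
    qed
    then have "AE x in M. \<forall>l\<in>D. norm (\<zeta> x) \<le> (\<Sum>t\<in>T. norm (l t) powr p) powr (1 / p) * norm (w x)
        + (\<Sum>t\<in>T. norm (\<eta> t x - l t * w x))"
      using D by (simp add: AE_ball_countable)
    then have "AE x in M. norm (\<zeta> x) powr p \<le> (\<Sum>t\<in>T. norm (\<eta> t x) powr p)"
    proof eventually_elim
      fix x assume x: "\<forall>l\<in>D. norm (\<zeta> x) \<le> (\<Sum>t\<in>T. norm (l t) powr p) powr (1 / p) * norm (w x)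
        + (\<Sum>t\<in>T. norm (\<eta> t x - l t * w x))"
      \<comment> \<open>If \<open>w x\<close> is 0 the quotient is 0, and so is every
        \<open>\<eta> t x\<close>.\<close>
      define l where "l = (\<lambda>t. \<eta> t x / w x)"
      obtain \<mu> where \<mu>: "\<And>n::nat. \<mu> n \<in> D" "\<And>t. t \<in> T \<Longrightarrow> (\<lambda>n. \<mu> n t) \<longlonglongrightarrow> l t"
        using dense[of l] by blast
      have le: "norm (\<zeta> x) \<le> (\<Sum>t\<in>T. norm (l t) powr p) powr (1 / p) * norm (w x)
        + (\<Sum>t\<in>T. norm (\<eta> t x - l t * w x))"
      proof (rule LIMSEQ_le_const)
        show "(\<lambda>n. (\<Sum>t\<in>T. norm (\<mu> n t) powr p) powr (1 / p) * norm (w x) + (\<Sum>t\<in>T. norm (\<eta> t x - \<mu> n t * w x)))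
            \<longlonglongrightarrow> (\<Sum>t\<in>T. norm (l t) powr p) powr (1 / p) * norm (w x) + (\<Sum>t\<in>T. norm (\<eta> t x - l t * w x))"
          using p by (intro tendsto_add tendsto_mult tendsto_powr' tendsto_sum tendsto_norm tendsto_diff \<mu> tendsto_const)
            (auto intro!: always_eventually sum_nonneg)
      qed (use x \<mu>(1) in auto)
      have \<eta>l: "\<eta> t x = l t * w x" if "t \<in> T" for t
      proof (cases "w x = 0")
        case True
        then have "(\<Sum>t\<in>T. norm (\<eta> t x)) = 0" unfolding w_def by (simp only: of_real_eq_0_iff)
        then show ?thesis using T that True by (simp add: sum_nonneg_eq_0_iff)
      qed (simp add: l_def)
      have "norm (\<zeta> x) \<le> (\<Sum>t\<in>T. norm (l t) powr p) powr (1 / p) * norm (w x)"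
        using le \<eta>l by simp
      then have "norm (\<zeta> x) powr p \<le> ((\<Sum>t\<in>T. norm (l t) powr p) powr (1 / p) * norm (w x)) powr p"
        using p by (intro powr_mono2) auto
      also have "\<dots> = (\<Sum>t\<in>T. norm (l t) powr p) * norm (w x) powr p"
        using p by (simp add: powr_mult powr_powr sum_nonneg)
      also have "\<dots> = (\<Sum>t\<in>T. norm (\<eta> t x) powr p)"
        unfolding sum_distrib_right using \<eta>l by (intro sum.cong) (auto simp: norm_mult powr_mult)
      finally show "norm (\<zeta> x) powr p \<le> (\<Sum>t\<in>T. norm (\<eta> t x) powr p)" .
    qed
    then have "(\<integral>x. norm (\<zeta> x) powr p \<partial>M) \<le> (\<integral>x. (\<Sum>t\<in>T. norm (\<eta> t x) powr p) \<partial>M)"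
      using V_integrable[OF \<eta>] V_integrable[OF \<zeta>] by (intro integral_mono_AE) auto
    then show ?thesis using V_integrable[OF \<eta>] by simp
  next
    case True
    have "inverse q = inverse 2" using pq unfolding True inverse_eq_divide by linarith
    then have q: "q = p" using True by (simp only: inverse_eq_iff_eq)
    have k\<zeta>: "mul (?k t) \<zeta> \<in> carr V" if "t \<in> T" for t by (intro mul_closed k that \<zeta>)
    \<comment> \<open>Each \<open>k t\<close> is moved onto \<zeta>. Young's inequality leaves half
      of the column of \<zeta>, at most half of its mass and absorbed on the left, plus half of the
      right-hand side.\<close>
    have "pairing \<zeta> \<zeta> = (\<Sum>t\<in>T. pairing (mul (?k t) (\<eta> t)) \<zeta>)"
      using pairing_sum[of T "\<lambda>t. mul (?k t) (\<eta> t)" \<zeta>] k\<eta> \<zeta> unfolding \<zeta>_def[symmetric] by simp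
    then have "norm (pairing \<zeta> \<zeta>) \<le> (\<Sum>t\<in>T. (\<integral>x. norm (mul (?k t) \<zeta> x) powr p \<partial>M) / p
        + (1 - 1 / p) * (\<integral>x. norm (\<eta> t x) powr p \<partial>M))"
      using self_adjoint[OF True k \<zeta> \<eta>] norm_pairing_le[OF k\<zeta> \<eta>] by (auto intro!: sum_norm_le)
    also have "\<dots> = (\<Sum>t\<in>T. \<integral>x. norm (mul (?k t) \<zeta> x) powr p \<partial>M) / 2
        + (\<Sum>t\<in>T. \<integral>x. norm (\<eta> t x) powr p \<partial>M) / 2"
      by (simp add: True sum.distrib sum_divide_distrib)
    also have "(\<Sum>t\<in>T. \<integral>x. norm (mul (?k t) \<zeta> x) powr p \<partial>M) \<le> (\<integral>x. norm (\<zeta> x) powr p \<partial>M)"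
      using T k nonneg sum1 \<zeta> by (intro column_contraction) (auto simp: q)
    finally show ?thesis by (simp add: pairing_self)
  qed
  then show ?thesis by (simp add: \<zeta>_def)
qed

end

section \<open>Factorisation through the regular representation\<close>

context twisted_action
begin

text \<open>In the additive notation \<open>t - r\<close> is \<open>t r^(-1)\<close>, the only group
  element through which \<Lambda> sends the orbit point with index r to the one with index
  t.\<close>

definition orbit_matrix :: "('g \<Rightarrow> 'x \<Rightarrow> complex) \<Rightarrow> 'x \<Rightarrow> 'g \<Rightarrow> 'g \<Rightarrow> complex" where
  "orbit_matrix b y t r = b (t - r) (\<phi> t y) * u (t - r) r (\<phi> t y)"

text \<open>The points \<open>(\<phi> t y, t)\<close> are distinct, and the arguments of \<xi> in
  the formula for \<Lambda> at such a point are again of this form. Extending \<open>v\<close> by 0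
  is isometric from l^p(R), and evaluating at these points compresses \<Lambda> to the
  matrix.\<close>

lemma orbit_matrix_contraction:
  assumes p: "1 \<le> p" and b: "b \<in> carr (F \<phi> u)" and R: "finite R"
  shows "(\<Sum>t\<in>R. norm (\<Sum>r\<in>R. orbit_matrix b y t r * v r) powr p)
    \<le> reduced_norm p \<phi> u b powr p * (\<Sum>r\<in>R. norm (v r) powr p)"
proof -
  define \<xi> where "\<xi> = (\<lambda>(x, t). if t \<in> R \<and> x = \<phi> t y then v t else 0)"
  let ?G = "(\<lambda>t. (\<phi> t y, t)) ` R"
  let ?s = "\<Sum>r\<in>R. norm (v r) powr p"
  have s0: "0 \<le> ?s" by (intro sum_nonneg) auto
  have G: "(\<Sum>z\<in>?G. norm (h z) powr p) = (\<Sum>t\<in>R. norm (h (\<phi> t y, t)) powr p)" for h :: "'x \<times> 'g \<Rightarrow> complex"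
    by (subst sum.reindex) (auto simp: inj_on_def)
  have "(\<Sum>z\<in>T. norm (\<xi> z) powr p) \<le> ?s" if T: "finite T" for T
  proof -
    have "(\<Sum>z\<in>T. norm (\<xi> z) powr p) = (\<Sum>z\<in>T \<inter> ?G. norm (\<xi> z) powr p)"
      by (rule sum.mono_neutral_right) (use T in \<open>auto simp: \<xi>_def split: if_splits\<close>)
    also have "\<dots> \<le> (\<Sum>z\<in>?G. norm (\<xi> z) powr p)"
      using R by (intro sum_mono2) auto
    also have "\<dots> = ?s" unfolding G by (simp add: \<xi>_def)
    finally show ?thesis .
  qed
  moreover have "(?s powr (1 / p)) powr p = ?s" using p s0 by (simp add: powr_powr)
  ultimately have \<xi>: "\<xi> \<in> carr (little_lp p)" and n\<xi>: "norm_of (little_lp p) \<xi> \<le> ?s powr (1 / p)"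
    unfolding little_lp_def using p lp_count_norm_leI[of p "?s powr (1 / p)" UNIV \<xi>] by auto
  have entry: "\<Lambda> \<phi> u b \<xi> (\<phi> t y, t) = (\<Sum>r\<in>R. orbit_matrix b y t r * v r)" for t
  proof -
    have orbit: "\<phi> (- s) (\<phi> t y) = \<phi> (- s + t) y" for s by (simp add: phi_add)
    have "\<Lambda> \<phi> u b \<xi> (\<phi> t y, t) = (\<Sum>s\<in>(\<lambda>r. t - r) ` R. b s (\<phi> t y) * u s (- s + t) (\<phi> t y) * \<xi> (\<phi> (- s) (\<phi> t y), - s + t))"
      unfolding \<Lambda>_def case_prod_conv
    proof (rule infsum_finite_support)
      fix s assume s: "s \<notin> (\<lambda>r. t - r) ` R"
      have "s = t - (- s + t)"
        by (simp only: diff_conv_add_uminus minus_add minus_minus add.assoc[symmetric] right_minus add_0_left)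
      then have "- s + t \<notin> R" using s by blast
      then show "b s (\<phi> t y) * u s (- s + t) (\<phi> t y) * \<xi> (\<phi> (- s) (\<phi> t y), - s + t) = 0"
        by (simp add: \<xi>_def)
    qed (use R in simp)
    also have "\<dots> = (\<Sum>r\<in>R. b (t - r) (\<phi> t y) * u (t - r) (- (t - r) + t) (\<phi> t y) * \<xi> (\<phi> (- (t - r)) (\<phi> t y), - (t - r) + t))"
    proof -
      have "inj_on (\<lambda>r. t - r) R"
        by (rule inj_onI) (simp only: diff_conv_add_uminus add_left_cancel neg_equal_iff_equal)
      from sum.reindex[OF this] show ?thesis by (simp only: comp_def)
    qed
    also have "\<dots> = (\<Sum>r\<in>R. orbit_matrix b y t r * v r)"
    proof (rule sum.cong[OF refl])
      fix r assume "r \<in> R"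
      moreover have "- (t - r) + t = r" by simp
      ultimately show "b (t - r) (\<phi> t y) * u (t - r) (- (t - r) + t) (\<phi> t y) * \<xi> (\<phi> (- (t - r)) (\<phi> t y), - (t - r) + t)
          = orbit_matrix b y t r * v r"
        unfolding orbit by (simp only: \<xi>_def orbit_matrix_def case_prod_conv simp_thms if_True)
    qed
    finally show ?thesis .
  qed
  have "(\<Sum>t\<in>R. norm (\<Sum>r\<in>R. orbit_matrix b y t r * v r) powr p) = (\<Sum>z\<in>?G. norm (\<Lambda> \<phi> u b \<xi> z) powr p)"
    unfolding G entry ..
  also have "\<dots> \<le> norm_of (little_lp p) (\<Lambda> \<phi> u b \<xi>) powr p"
    using lp_count_finite_sum_le[of p "\<Lambda> \<phi> u b \<xi>" UNIV ?G] p R regular_bound(1)[OF p b \<xi>]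
    by (simp add: little_lp_def)
  also have "\<dots> \<le> (reduced_norm p \<phi> u b * ?s powr (1 / p)) powr p"
  proof (rule powr_mono2)
    show "norm_of (little_lp p) (\<Lambda> \<phi> u b \<xi>) \<le> reduced_norm p \<phi> u b * ?s powr (1 / p)"
      using reduced_norm_apply[OF p b \<xi>] mult_left_mono[OF n\<xi> reduced_norm_nonneg[OF p b]] by simp
  qed (use p in \<open>auto simp: little_lp_def Lp_functions_norm_nonneg\<close>)
  also have "\<dots> = reduced_norm p \<phi> u b powr p * ?s"
    using p s0 reduced_norm_nonneg[OF p b] by (simp add: powr_mult powr_powr)
  finally show ?thesis .
qed

text \<open>
  The product \<open>d\<^sub>y\<^sub>,\<^sub>t c\<^sub>y\<^sub>,\<^sub>r\<close> is the point mass of this function at \<open>t r\<^sup>-\<^sup>1\<close>; the conjugated cocycle value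
  compensates for \<open>u(t r\<^sup>-\<^sup>1, r)\<close> in the orbit matrix.
\<close>

definition approximant_coeff ::
    "real \<Rightarrow> ('g \<Rightarrow> 'x \<Rightarrow> real) \<Rightarrow> ('x \<Rightarrow> 'x \<Rightarrow> real) \<Rightarrow> 'g \<Rightarrow> 'g \<Rightarrow> 'x \<Rightarrow> 'x \<Rightarrow> complex" where
  "approximant_coeff p g h t r y x =
    of_real (g t x powr (1 - 1 / p) * g r (\<phi> (- (t - r)) x) powr (1 / p) * h y (\<phi> (- t) x))
      * (cnj (u r (- r) (\<phi> (- (t - r)) x)) * u t (- r) x)"

text \<open>The products are already multiplied out here; the factors are recovered when a
  representation is applied.\<close>

definition approximant ::
    "real \<Rightarrow> ('g \<Rightarrow> 'x \<Rightarrow> real) \<Rightarrow> 'g set \<Rightarrow> ('x \<Rightarrow> 'x \<Rightarrow> real) \<Rightarrow> 'x set \<Rightarrow>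
     ('g \<Rightarrow> 'x \<Rightarrow> complex) \<Rightarrow> 'g \<Rightarrow> 'x \<Rightarrow> complex" where
  "approximant p g R h J b = (\<lambda>s x. \<Sum>(t, r, y)\<in>R \<times> R \<times> J.
    orbit_matrix b y t r * point_mass (approximant_coeff p g h t r y) (t - r) s x)"

text \<open>The cocycle identity for s, r, -r together with \<open>u s 0 = 1\<close> rewrites the
  first factor as the product of the other two, all of modulus 1.\<close>

lemma cocycle_cancel:
  "cnj (u r (- r) (\<phi> (- s) x)) * u (s + r) (- r) x * u s r x = 1"
proof -
  have "u r (- r) (\<phi> (- s) x) = u s r x * u (s + r) (- r) x"
    using u_cocycle[of r "- r" s x] by simp
  moreover have "cnj z * z = 1" if "norm z = 1" for z :: complex
    using that complex_norm_square[of z] by (simp add: mult.commute)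
  ultimately show ?thesis
    using norm_u[of r "- r" "\<phi> (- s) x"] by (simp add: mult.assoc mult.commute mult.left_commute)
qed

text \<open>The coefficient at \<open>s\<close> comes from pairs with t = s + r; if
  \<open>s + r\<close> is outside \<open>R\<close>, the factor \<open>g (s + r)\<close> vanishes, so
  no case distinction remains.\<close>

lemma approximant_eq:
  assumes R: "finite R" and g0: "\<And>t x. t \<notin> R \<Longrightarrow> g t x = 0"
  shows "approximant p g R h J b s x = (\<Sum>r\<in>R. \<Sum>y\<in>J.
    orbit_matrix b y (s + r) r * approximant_coeff p g h (s + r) r y x)"
proof -
  have "approximant p g R h J b s x = (\<Sum>t\<in>R. \<Sum>r\<in>R. \<Sum>y\<in>J.
      orbit_matrix b y t r * point_mass (approximant_coeff p g h t r y) (t - r) s x)"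
    unfolding approximant_def by (simp add: sum.cartesian_product)
  also have "\<dots> = (\<Sum>t\<in>R. \<Sum>r\<in>R. if t = s + r then (\<Sum>y\<in>J.
      orbit_matrix b y t r * approximant_coeff p g h t r y x) else 0)"
  proof -
    have "s = t - r \<longleftrightarrow> t = s + r" for t r by (metis add_diff_cancel diff_add_cancel)
    then show ?thesis by (intro sum.cong refl) (simp add: point_mass_def)
  qed
  also have "\<dots> = (\<Sum>r\<in>R. \<Sum>t\<in>R. if t = s + r then (\<Sum>y\<in>J.
      orbit_matrix b y t r * approximant_coeff p g h t r y x) else 0)"
    by (rule sum.swap)
  also have "\<dots> = (\<Sum>r\<in>R. \<Sum>y\<in>J. orbit_matrix b y (s + r) r * approximant_coeff p g h (s + r) r y x)"
    using R by (intro sum.cong refl) (auto simp: sum.delta approximant_coeff_def g0)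
  finally show ?thesis .
qed

text \<open>Once the matrix entries are unfrozen, at a cost of \<delta> per pair, the cocycle
  factors cancel and \<open>b s x\<close> is multiplied by the sum of the geometric means
  \<open>w r\<close>. This factor lies between the overlap and 1. The last sum counts the pairs that
  contribute at \<open>s\<close>.\<close>

lemma approximant_pointwise:
  fixes g :: "'g \<Rightarrow> 'x \<Rightarrow> real"
  assumes p: "1 < p" and R: "finite R" and g0: "\<And>t x. t \<notin> R \<Longrightarrow> g t x = 0"
    and g: "\<And>t x. 0 \<le> g t x" "\<And>x. (\<Sum>t\<in>R. g t x) \<le> 1"
    and h: "\<And>t r x. t \<in> R \<Longrightarrow> r \<in> R \<Longrightarrow>
      norm ((\<Sum>y\<in>J. of_real (h y x) * orbit_matrix b y t r) - orbit_matrix b x t r) \<le> \<delta>"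
  shows "\<exists>\<theta>. 0 \<le> \<theta> \<and> \<theta> \<le> 1 \<and> (\<Sum>r\<in>R. min (g (s + r) x) (g r (\<phi> (- s) x))) \<le> \<theta> \<and>
    norm (approximant p g R h J b s x - \<theta> * b s x) \<le> \<delta> * (\<Sum>r\<in>R. if s + r \<in> R then 1 else 0)"
proof -
  define w where "w = (\<lambda>r. g (s + r) x powr (1 - 1 / p) * g r (\<phi> (- s) x) powr (1 / p))"
  define \<theta> where "\<theta> = (\<Sum>r\<in>R. w r)"
  have g1: "g t x \<le> 1" for t x
  proof (cases "t \<in> R")
    case True
    have "g t x \<le> (\<Sum>t\<in>R. g t x)" using True R g by (intro member_le_sum) auto
    then show ?thesis using g(2)[of x] by linarith
  qed (simp add: g0)
  have w: "0 \<le> w r" "w r \<le> 1" for r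
  proof -
    have "w r \<le> 1 * 1" unfolding w_def
      using p g g1 by (intro mult_mono powr_le1) auto
    then show "0 \<le> w r" "w r \<le> 1" by (simp_all add: w_def)
  qed
  have shift: "(\<Sum>r\<in>R. g (s + r) x) \<le> 1"
  proof -
    have "(\<Sum>r\<in>R. g (s + r) x) = (\<Sum>r\<in>(\<lambda>r. s + r) ` R. g r x)"
      by (subst sum.reindex) (auto simp: inj_on_def)
    also have "\<dots> = (\<Sum>r\<in>(\<lambda>r. s + r) ` R \<inter> R. g r x)"
      by (rule sum.mono_neutral_right) (use R g0 in auto)
    also have "\<dots> \<le> (\<Sum>r\<in>R. g r x)" using R g by (intro sum_mono2) auto
    finally show ?thesis using g(2)[of x] by linarith
  qed
  have "\<theta> \<le> (\<Sum>r\<in>R. (1 - 1 / p) * g (s + r) x + 1 / p * g r (\<phi> (- s) x))"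
    unfolding \<theta>_def w_def using g p by (intro sum_mono Young_powr_weighted) auto
  also have "\<dots> = (1 - 1 / p) * (\<Sum>r\<in>R. g (s + r) x) + 1 / p * (\<Sum>r\<in>R. g r (\<phi> (- s) x))"
    by (simp add: sum.distrib sum_distrib_left)
  also have "\<dots> \<le> (1 - 1 / p) * 1 + 1 / p * 1"
    using p shift g(2) by (intro add_mono mult_left_mono) auto
  finally have th1: "\<theta> \<le> 1" by simp
  have th2: "(\<Sum>r\<in>R. min (g (s + r) x) (g r (\<phi> (- s) x))) \<le> \<theta>"
    unfolding \<theta>_def w_def using g p by (intro sum_mono min_le_powr_mult) auto
  have close: "norm ((\<Sum>y\<in>J. orbit_matrix b y (s + r) r * approximant_coeff p g h (s + r) r y x) - w r * b s x)
      \<le> \<delta> * (if s + r \<in> R then 1 else 0)" if r: "r \<in> R" for r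
  proof (cases "s + r \<in> R")
    case True
    define \<nu> where "\<nu> = cnj (u r (- r) (\<phi> (- s) x)) * u (s + r) (- r) x"
    let ?z = "\<phi> (- (s + r)) x"
    have nu: "norm \<nu> = 1" by (simp add: \<nu>_def norm_mult)
    have "orbit_matrix b ?z (s + r) r = b s x * u s r x"
      by (simp add: orbit_matrix_def)
    \<comment> \<open>The base point \<open>?z\<close> is the one whose orbit passes through
      \<open>x\<close> at index \<open>s + r\<close>.\<close>
    then have bs: "\<nu> * orbit_matrix b ?z (s + r) r = b s x"
      using cocycle_cancel[of r s x] by (simp add: \<nu>_def mult.assoc mult.left_commute)
    have "(\<Sum>y\<in>J. orbit_matrix b y (s + r) r * approximant_coeff p g h (s + r) r y x)
        = of_real (w r) * \<nu> * (\<Sum>y\<in>J. of_real (h y ?z) * orbit_matrix b y (s + r) r)"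
      by (simp add: approximant_coeff_def w_def \<nu>_def sum_distrib_left mult_ac)
    then have "(\<Sum>y\<in>J. orbit_matrix b y (s + r) r * approximant_coeff p g h (s + r) r y x) - w r * b s x
        = of_real (w r) * \<nu> * ((\<Sum>y\<in>J. of_real (h y ?z) * orbit_matrix b y (s + r) r) - orbit_matrix b ?z (s + r) r)"
      by (simp add: bs[symmetric] right_diff_distrib mult.assoc)
    also have "norm \<dots> \<le> 1 * \<delta>"
      unfolding norm_mult nu using w[of r] h[OF True r, of ?z] by (intro mult_mono) auto
    finally show ?thesis using True by simp
  next
    case False
    then show ?thesis using p by (simp add: approximant_coeff_def w_def g0)
  qed
  have "approximant p g R h J b s x - \<theta> * b s x
      = (\<Sum>r\<in>R. (\<Sum>y\<in>J. orbit_matrix b y (s + r) r * approximant_coeff p g h (s + r) r y x) - w r * b s x)"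
    by (simp add: approximant_eq[OF R g0] \<theta>_def sum_subtractf sum_distrib_right)
  also have "norm \<dots> \<le> (\<Sum>r\<in>R. \<delta> * (if s + r \<in> R then 1 else 0))"
    by (intro sum_norm_le close)
  finally have "norm (approximant p g R h J b s x - \<theta> * b s x) \<le> \<delta> * (\<Sum>r\<in>R. if s + r \<in> R then 1 else 0)"
    by (simp only: sum_distrib_left)
  moreover have "0 \<le> \<theta>" unfolding \<theta>_def using w by (intro sum_nonneg) auto
  ultimately show ?thesis using th1 th2 by blast
qed

end

section \<open>The l^1-distance between an element and its approximant\<close>

lemma C0_of_real_powr:
  assumes g: "g \<in> Cc_nonneg" and a: "0 < a"
  shows "(\<lambda>x. complex_of_real (g x powr a)) \<in> C0"
proof -
  obtain K where K: "compact K" "\<And>x. x \<notin> K \<Longrightarrow> g x = 0"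
    using Cc_nonneg_zero_outside[OF g] by metis
  have "continuous_on UNIV (\<lambda>x. complex_of_real (g x powr a))"
    using g a by (intro continuous_on_of_real continuous_on_powr' continuous_on_const)
      (auto simp: Cc_nonneg_def)
  then show ?thesis using K by (intro C0_compact_support[of _ K]) auto
qed

context twisted_action
begin

lemma orbit_matrix_C0:
  assumes "b \<in> carr (F \<phi> u)"
  shows "(\<lambda>y. orbit_matrix b y t r) \<in> C0"
  unfolding orbit_matrix_def
proof (rule C0_mult_bounded[of _ _ 1])
  show "(\<lambda>y. b (t - r) (\<phi> t y)) \<in> C0" by (rule C0_translate[OF F_carrD[OF assms]])
  show "continuous_on UNIV (\<lambda>y. u (t - r) r (\<phi> t y))"
    by (rule continuous_on_compose2[OF u_continuous phi_continuous]) auto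
qed simp

lemma approximant_coeff_C0:
  assumes p: "1 < p" and g: "\<And>t. g t \<in> Cc_nonneg"
    and h: "\<And>y. continuous_on UNIV (h y)" "\<And>y x. 0 \<le> h y x" "\<And>x. (\<Sum>y\<in>J. h y x) \<le> 1"
    and J: "finite J" and y: "y \<in> J"
  shows "approximant_coeff p g h t r y \<in> C0"
proof -
  have h1: "h y x \<le> 1" for x
    using member_le_sum[of y J "\<lambda>y. h y x"] y J h(2) h(3)[of x] by fastforce
  have cont: "continuous_on UNIV (\<lambda>x. f (\<phi> s x))" if "continuous_on UNIV f" for f :: "'x \<Rightarrow> complex" and s
    by (rule continuous_on_compose2[OF that phi_continuous]) auto
  have gp: "(\<lambda>x. complex_of_real (g r x powr (1 / p))) \<in> C0"
    using p by (intro C0_of_real_powr g) auto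
  have gq: "(\<lambda>x. complex_of_real (g t x powr (1 - 1 / p))) \<in> C0"
    using p by (intro C0_of_real_powr g) auto
  have hc: "continuous_on UNIV (\<lambda>x. complex_of_real (h y (\<phi> (- t) x)))"
    by (intro cont[of "\<lambda>x. complex_of_real (h y x)"] continuous_on_of_real h)
  have uc: "continuous_on UNIV (\<lambda>x. cnj (u r (- r) (\<phi> (- (t - r)) x)) * u t (- r) x)"
    by (intro continuous_on_mult continuous_on_cnj u_continuous cont[OF u_continuous])
  have "(\<lambda>x. complex_of_real (g t x powr (1 - 1 / p)) * complex_of_real (g r (\<phi> (- (t - r)) x) powr (1 / p))) \<in> C0"
    by (rule C0_mult[OF gq C0_translate[OF gp]])
  then have "(\<lambda>x. complex_of_real (g t x powr (1 - 1 / p)) * complex_of_real (g r (\<phi> (- (t - r)) x) powr (1 / p))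
      * complex_of_real (h y (\<phi> (- t) x))) \<in> C0"
    using h(2) h1 by (intro C0_mult_bounded[OF _ hc, of _ 1]) auto
  then have "(\<lambda>x. complex_of_real (g t x powr (1 - 1 / p)) * complex_of_real (g r (\<phi> (- (t - r)) x) powr (1 / p))
      * complex_of_real (h y (\<phi> (- t) x)) * (cnj (u r (- r) (\<phi> (- (t - r)) x)) * u t (- r) x)) \<in> C0"
    by (intro C0_mult_bounded[OF _ uc, of _ 1]) (auto simp: norm_mult)
  then show ?thesis by (simp add: approximant_coeff_def[abs_def])
qed

lemma approximant_closed:
  assumes "\<And>t r y. t \<in> R \<Longrightarrow> r \<in> R \<Longrightarrow> y \<in> J \<Longrightarrow> approximant_coeff p g h t r y \<in> C0"
  shows "approximant p g R h J b \<in> carr (F \<phi> u)"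
proof -
  have "(\<lambda>s x. \<Sum>i\<in>R \<times> R \<times> J. (\<lambda>i s x. case i of (t, r, y) \<Rightarrow>
      orbit_matrix b y t r * point_mass (approximant_coeff p g h t r y) (t - r) s x) i s x) \<in> carr (F \<phi> u)"
  proof (rule F_sum_closed)
    fix i assume "i \<in> R \<times> R \<times> J"
    then obtain t r y where i: "i = (t, r, y)" "t \<in> R" "r \<in> R" "y \<in> J" by auto
    show "(\<lambda>s x. case i of (t, r, y) \<Rightarrow>
        orbit_matrix b y t r * point_mass (approximant_coeff p g h t r y) (t - r) s x) \<in> carr (F \<phi> u)"
      using F_scale_closed[OF point_mass_closed[OF assms[OF i(2-4)]]] by (simp add: i(1))
  qed
  then show ?thesis by (simp add: approximant_def)
qed

text \<open>The four errors are: the missing overlap on \<open>K\<close>; the values of b outside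
  \<open>K\<close>, once for each element of \<open>S\<close>; the tail of b outside
  \<open>S\<close>; and \<delta> for each pair in \<open>R \<times> R\<close>.\<close>

lemma approximant_close:
  fixes g :: "'g \<Rightarrow> 'x \<Rightarrow> real"
  assumes p: "1 < p" and b: "b \<in> carr (F \<phi> u)" and X: "approximant p g R h J b \<in> carr (F \<phi> u)"
    and R: "finite R" and g0: "\<And>t x. t \<notin> R \<Longrightarrow> g t x = 0"
    and g: "\<And>t x. 0 \<le> g t x" "\<And>x. (\<Sum>t\<in>R. g t x) \<le> 1"
    and h: "\<And>t r x. t \<in> R \<Longrightarrow> r \<in> R \<Longrightarrow>
      norm ((\<Sum>y\<in>J. of_real (h y x) * orbit_matrix b y t r) - orbit_matrix b x t r) \<le> \<delta>"
    and S: "finite S" and tail: "norm_of (F \<phi> u) b - (\<Sum>s\<in>S. sup_norm (b s)) \<le> \<epsilon>" and e: "0 \<le> \<epsilon>" "0 \<le> \<epsilon>'"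
    and inv: "\<And>s x. s \<in> S \<Longrightarrow> x \<in> K \<Longrightarrow> 1 - \<epsilon>' \<le> (\<Sum>r\<in>R. min (g (s + r) x) (g r (\<phi> (- s) x)))"
    and K: "\<And>s x. s \<in> S \<Longrightarrow> x \<notin> K \<Longrightarrow> norm (b s x) \<le> \<epsilon>'" and d: "0 \<le> \<delta>"
  shows "norm_of (F \<phi> u) (\<lambda>s x. b s x - approximant p g R h J b s x)
    \<le> \<epsilon>' * norm_of (F \<phi> u) b + \<epsilon>' * card S + \<epsilon> + \<delta> * (card R)\<^sup>2"
proof -
  let ?X = "approximant p g R h J b"
  let ?n = "\<lambda>s. \<Sum>r\<in>R. if s + r \<in> R then 1 else (0::real)"
  have bnn: "0 \<le> sup_norm (b s)" for s by (rule sup_norm_nonneg[OF F_carrD[OF b]])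
  have n0: "0 \<le> ?n s" for s by (intro sum_nonneg) auto
  have theta: "\<exists>\<theta>. 0 \<le> \<theta> \<and> \<theta> \<le> 1 \<and> (\<Sum>r\<in>R. min (g (s + r) x) (g r (\<phi> (- s) x))) \<le> \<theta> \<and>
      norm (b s x - ?X s x) \<le> (1 - \<theta>) * norm (b s x) + \<delta> * ?n s" for s x
  proof -
    have "\<exists>\<theta>. 0 \<le> \<theta> \<and> \<theta> \<le> 1 \<and> (\<Sum>r\<in>R. min (g (s + r) x) (g r (\<phi> (- s) x))) \<le> \<theta> \<and>
        norm (?X s x - \<theta> * b s x) \<le> \<delta> * ?n s"
      by (rule approximant_pointwise[OF p R g0 g h])
    then obtain \<theta> where t: "0 \<le> \<theta>" "\<theta> \<le> 1" "(\<Sum>r\<in>R. min (g (s + r) x) (g r (\<phi> (- s) x))) \<le> \<theta>"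
      "norm (?X s x - \<theta> * b s x) \<le> \<delta> * ?n s" by blast
    have "b s x - ?X s x = of_real (1 - \<theta>) * b s x - (?X s x - \<theta> * b s x)"
      by (simp add: algebra_simps)
    also have "norm \<dots> \<le> norm (of_real (1 - \<theta>) * b s x) + norm (?X s x - \<theta> * b s x)"
      by (rule norm_triangle_ineq4)
    also have "norm (of_real (1 - \<theta>) * b s x) = (1 - \<theta>) * norm (b s x)"
      unfolding norm_mult norm_of_real using t by simp
    finally show ?thesis using t by fastforce
  qed
  have generic: "sup_norm (\<lambda>x. b s x - ?X s x) \<le> sup_norm (b s) + \<delta> * ?n s" for s
  proof (rule sup_norm_least)
    fix x
    obtain \<theta> where t: "0 \<le> \<theta>" "\<theta> \<le> 1" "norm (b s x - ?X s x) \<le> (1 - \<theta>) * norm (b s x) + \<delta> * ?n s"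
      using theta[of s x] by blast
    have "(1 - \<theta>) * norm (b s x) \<le> 1 * sup_norm (b s)"
      using t sup_norm_upper[OF F_carrD[OF b], of s x] by (intro mult_mono) auto
    then show "norm (b s x - ?X s x) \<le> sup_norm (b s) + \<delta> * ?n s" using t(3) by simp
  qed
  have special: "sup_norm (\<lambda>x. b s x - ?X s x) \<le> \<epsilon>' * sup_norm (b s) + \<epsilon>' + \<delta> * ?n s" if s: "s \<in> S" for s
  proof (rule sup_norm_least)
    fix x
    obtain \<theta> where t: "0 \<le> \<theta>" "\<theta> \<le> 1" "(\<Sum>r\<in>R. min (g (s + r) x) (g r (\<phi> (- s) x))) \<le> \<theta>"
      "norm (b s x - ?X s x) \<le> (1 - \<theta>) * norm (b s x) + \<delta> * ?n s"
      using theta[of s x] by blast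
    have "(1 - \<theta>) * norm (b s x) \<le> \<epsilon>' * sup_norm (b s) + \<epsilon>'"
    proof (cases "x \<in> K")
      case True
      have "(1 - \<theta>) * norm (b s x) \<le> \<epsilon>' * sup_norm (b s)"
        using inv[OF s True] t e sup_norm_upper[OF F_carrD[OF b], of s x] by (intro mult_mono) auto
      then show ?thesis using e by simp
    next
      case False
      have "(1 - \<theta>) * norm (b s x) \<le> 1 * \<epsilon>'"
        using t K[OF s False] by (intro mult_mono) auto
      moreover have "0 \<le> \<epsilon>' * sup_norm (b s)" using e bnn by simp
      ultimately show ?thesis by simp
    qed
    then show "norm (b s x - ?X s x) \<le> \<epsilon>' * sup_norm (b s) + \<epsilon>' + \<delta> * ?n s" using t(4) by simp
  qed
  have bX: "(\<lambda>s x. b s x - ?X s x) \<in> carr (F \<phi> u)"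
    using F_add_closed[OF b F_scale_closed[OF X, of "-1"]] by simp
  have "(\<Sum>\<^sub>\<infinity>s. sup_norm (\<lambda>x. b s x - ?X s x)) \<le> \<epsilon>' * norm_of (F \<phi> u) b + \<epsilon>' * card S + \<epsilon> + \<delta> * (card R)\<^sup>2"
  proof (rule infsum_le_finite_sums)
    show "(\<lambda>s. sup_norm (\<lambda>x. b s x - ?X s x)) summable_on UNIV" using F_summable[OF bX] .
    fix U :: "'g set" assume U: "finite U"
    let ?a = "\<lambda>s. if s \<in> S then \<epsilon>' * sup_norm (b s) + \<epsilon>' else sup_norm (b s)"
    have "(\<Sum>s\<in>U. sup_norm (\<lambda>x. b s x - ?X s x)) \<le> (\<Sum>s\<in>U. ?a s + \<delta> * ?n s)"
      using generic special by (intro sum_mono) auto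
    also have "\<dots> = (\<Sum>s\<in>U. ?a s) + \<delta> * (\<Sum>s\<in>U. ?n s)"
      by (simp only: sum.distrib sum_distrib_left)
    \<comment> \<open>For fixed \<open>r\<close>, right translation by \<open>r\<close> is
      injective, so at most \<open>card R\<close> elements \<open>s\<close> are counted.\<close>
    also have "(\<Sum>s\<in>U. ?n s) \<le> (card R)\<^sup>2"
    proof -
      have "(\<Sum>s\<in>U. ?n s) = (\<Sum>r\<in>R. \<Sum>s\<in>U. if s + r \<in> R then 1 else 0)" by (rule sum.swap)
      also have "\<dots> \<le> (\<Sum>r\<in>R. real (card R))"
      proof (rule sum_mono)
        fix r
        have "(\<Sum>s\<in>U. if s + r \<in> R then 1 else (0::real)) = card {s \<in> U. s + r \<in> R}"
          using U by (simp add: sum.If_cases Int_def)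
        also have "card {s \<in> U. s + r \<in> R} \<le> card R"
          by (rule card_inj_on_le[of "\<lambda>s. s + r"]) (use R in \<open>auto simp: inj_on_def\<close>)
        finally show "(\<Sum>s\<in>U. if s + r \<in> R then 1 else (0::real)) \<le> real (card R)" by simp
      qed
      also have "\<dots> = (card R)\<^sup>2" by (simp add: power2_eq_square)
      finally show ?thesis .
    qed
    also have "(\<Sum>s\<in>U. ?a s) = (\<Sum>s\<in>U \<inter> S. \<epsilon>' * sup_norm (b s) + \<epsilon>') + (\<Sum>s\<in>U - S. sup_norm (b s))"
      using U by (simp add: sum.If_cases Diff_eq Int_def)
    also have "(\<Sum>s\<in>U \<inter> S. \<epsilon>' * sup_norm (b s) + \<epsilon>') \<le> \<epsilon>' * norm_of (F \<phi> u) b + \<epsilon>' * card S"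
    proof -
      have "(\<Sum>s\<in>U \<inter> S. \<epsilon>' * sup_norm (b s) + \<epsilon>') = \<epsilon>' * (\<Sum>s\<in>U \<inter> S. sup_norm (b s)) + \<epsilon>' * card (U \<inter> S)"
        by (simp add: sum.distrib sum_distrib_left mult.commute)
      also have "\<dots> \<le> \<epsilon>' * norm_of (F \<phi> u) b + \<epsilon>' * card S"
        using e S U bnn finite_sum_le_infsum[OF F_summable[OF b], of "U \<inter> S"]
        by (intro add_mono mult_left_mono) (auto simp: F_simps intro: card_mono)
      finally show ?thesis .
    qed
    also have "(\<Sum>s\<in>U - S. sup_norm (b s)) \<le> \<epsilon>"
      using F_sum_Diff_le[OF b U S] tail by simp
    finally show "(\<Sum>s\<in>U. sup_norm (\<lambda>x. b s x - ?X s x)) \<le> \<epsilon>' * norm_of (F \<phi> u) b + \<epsilon>' * card S + \<epsilon> + \<delta> * (card R)\<^sup>2"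
      using d by (simp add: mult_left_mono)
  qed
  then show ?thesis by (simp add: F_simps)
qed

end

section \<open>The norm of the approximant under a representation\<close>

context lp_representation
begin

abbreviation mass :: "('n \<Rightarrow> complex) \<Rightarrow> real" where
  "mass f \<equiv> (\<integral>x. norm (f x) powr p \<partial>M)"

lemma mass_cong: "\<lbrakk>f \<in> carr V; g \<in> carr V; AE x in M. f x = g x\<rbrakk> \<Longrightarrow> mass f = mass g"
  using V_norm_cong[of f g] by (simp add: V_norm_powr[symmetric])

lemma mass_rep_le:
  assumes "b \<in> carr (F \<phi> u)" "f \<in> carr V" "norm_of (F \<phi> u) b \<le> 1"
  shows "mass (\<Psi> b f) \<le> mass f"
proof -
  have "norm_of V (\<Psi> b f) \<le> 1 * norm_of V f"
    using rep_bound[OF assms(1,2)] mult_right_mono[OF assms(3) V_norm_nonneg[of f]] by linarith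
  then show ?thesis
    unfolding V_norm_powr[symmetric] using p V_norm_nonneg by (intro powr_mono2) auto
qed

lemma rep_sum_arg:
  assumes b: "b \<in> carr (F \<phi> u)" and g: "\<And>i. i \<in> I \<Longrightarrow> g i \<in> carr V"
  shows "AE x in M. \<Psi> b (\<lambda>x. \<Sum>i\<in>I. l i * g i x) x = (\<Sum>i\<in>I. l i * \<Psi> b (g i) x)"
  using g
proof (induction I rule: infinite_finite_induct)
  case (insert i I)
  have gi: "(\<lambda>x. l i * g i x) \<in> carr V" using insert by (intro V_scale) auto
  have gI: "(\<lambda>x. \<Sum>i\<in>I. l i * g i x) \<in> carr V" using insert by (intro V_sum V_scale) auto
  have "AE x in M. \<Psi> b (\<lambda>x. \<Sum>i\<in>I. l i * g i x) x = (\<Sum>i\<in>I. l i * \<Psi> b (g i) x)"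
    using insert by auto
  moreover have "AE x in M. \<Psi> b (\<lambda>x. l i * g i x) x = l i * \<Psi> b (g i) x"
    using insert by (intro rep_scale_arg b) auto
  ultimately show ?case
    using rep_add_arg[OF b gi gI] by eventually_elim (simp add: insert.hyps)
qed (use rep_scale_arg[OF b V_zero, of 0] in simp_all)

lemma rep_mult3:
  assumes a: "a \<in> carr (F \<phi> u)" and b: "b \<in> carr (F \<phi> u)" and c: "c \<in> carr (F \<phi> u)"
    and bc: "mult_of (F \<phi> u) b c \<in> carr (F \<phi> u)" and f: "f \<in> carr V"
  shows "AE x in M. \<Psi> (mult_of (F \<phi> u) a (mult_of (F \<phi> u) b c)) f x = \<Psi> a (\<Psi> b (\<Psi> c f)) x"
  using rep_mult[OF a bc f] rep_cong[OF a rep_closed[OF bc f] rep_closed[OF b rep_closed[OF c f]] rep_mult[OF b c f]]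
  by eventually_elim simp

text \<open>A scalar matrix acts on L^p-valued families with no larger norm than on scalar ones:
  integrate the pointwise estimate of \<open>orbit_matrix_contraction\<close>.\<close>

lemma orbit_matrix_mass:
  assumes b: "b \<in> carr (F \<phi> u)" and R: "finite R" and \<zeta>: "\<And>r. r \<in> R \<Longrightarrow> \<zeta> r \<in> carr V"
  shows "(\<Sum>t\<in>R. mass (\<lambda>x. \<Sum>r\<in>R. orbit_matrix b y t r * \<zeta> r x))
    \<le> reduced_norm p \<phi> u b powr p * (\<Sum>r\<in>R. mass (\<zeta> r))"
proof -
  have c: "(\<lambda>x. \<Sum>r\<in>R. orbit_matrix b y t r * \<zeta> r x) \<in> carr V" for t
    by (intro V_sum V_scale \<zeta>)
  have "(\<Sum>t\<in>R. mass (\<lambda>x. \<Sum>r\<in>R. orbit_matrix b y t r * \<zeta> r x))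
      = (\<integral>x. (\<Sum>t\<in>R. norm (\<Sum>r\<in>R. orbit_matrix b y t r * \<zeta> r x) powr p) \<partial>M)"
    using V_integrable[OF c] by (subst Bochner_Integration.integral_sum) auto
  also have "\<dots> \<le> (\<integral>x. reduced_norm p \<phi> u b powr p * (\<Sum>r\<in>R. norm (\<zeta> r x) powr p) \<partial>M)"
    using V_integrable[OF c] V_integrable[OF \<zeta>] p
    by (intro integral_mono orbit_matrix_contraction b R) auto
  also have "\<dots> = reduced_norm p \<phi> u b powr p * (\<Sum>r\<in>R. mass (\<zeta> r))"
    using V_integrable[OF \<zeta>] by (simp add: Bochner_Integration.integral_sum)
  finally show ?thesis .
qed

text \<open>The factors are realised as products of point masses inside \<open>F\<close>, with the
  cutoff \<open>e\<close> in place of the units; it is invisible in the product because it equals 1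
  wherever some g_t is nonzero. By multiplicativity the image of the approximant is a chain of
  contractions around the orbit matrices, followed through p-th powers of norms.\<close>

lemma approximant_bound:
  fixes g :: "'g \<Rightarrow> 'x \<Rightarrow> real" and h :: "'x \<Rightarrow> 'x \<Rightarrow> real" and e :: "'x \<Rightarrow> real"
  assumes b: "b \<in> carr (F \<phi> u)" and f: "f \<in> carr V" and R: "finite R" and J: "finite J"
    and g: "\<And>t. g t \<in> Cc_nonneg" "\<And>x. (\<Sum>t\<in>R. g t x) \<le> 1"
    and h: "\<And>y. continuous_on UNIV (h y)" "\<And>y x. 0 \<le> h y x" "\<And>x. (\<Sum>y\<in>J. h y x) \<le> 1"
    and K: "compact K" "\<And>y x. y \<in> J \<Longrightarrow> x \<notin> K \<Longrightarrow> h y x = 0"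
    and e: "(\<lambda>x. complex_of_real (e x)) \<in> C0" "\<And>x. 0 \<le> e x" "\<And>x. e x \<le> 1"
      "\<And>t x. t \<in> R \<Longrightarrow> g t x \<noteq> 0 \<Longrightarrow> e x = 1"
  shows "norm_of V (\<Psi> (approximant p g R h J b) f) \<le> reduced_norm p \<phi> u b * norm_of V f"
proof -
  let ?L = "reduced_norm p \<phi> u b"
  let ?pm = "point_mass :: ('x \<Rightarrow> complex) \<Rightarrow> 'g \<Rightarrow> 'g \<Rightarrow> 'x \<Rightarrow> complex"
  let ?mult = "mult_of (F \<phi> u)"
  have g0: "0 \<le> g t x" for t x using g(1)[of t] by (simp add: Cc_nonneg_def)
  define q where "q = p / (p - 1)"
  have q: "1 / p + 1 / q = 1" "(1 - 1 / p) * q = 1" "0 < 1 - 1 / p"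
    using p by (auto simp: q_def field_simps)
  define gq where "gq = (\<lambda>t x. g t x powr (1 - 1 / p))"
  define gp where "gp = (\<lambda>t x. g t x powr (1 / p))"
  define hq where "hq = (\<lambda>y x. h y x powr (1 - 1 / p))"
  define hp where "hp = (\<lambda>y x. h y x powr (1 / p))"
  have hpow: "(\<lambda>x. complex_of_real (h y x powr a)) \<in> C0" if "y \<in> J" "0 < a" for y a
  proof (rule C0_compact_support[OF _ K(1)])
    show "continuous_on UNIV (\<lambda>x. complex_of_real (h y x powr a))"
      using h(1)[of y] h(2)[of y] that
      by (intro continuous_on_of_real continuous_on_powr' continuous_on_const) auto
  qed (use K(2) that in simp)
  have gqC: "(\<lambda>x. complex_of_real (gq t x)) \<in> C0" and gpC: "(\<lambda>x. complex_of_real (gp t x)) \<in> C0" for t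
    unfolding gq_def gp_def using p q by (intro C0_of_real_powr g; simp)+
  have hqC: "(\<lambda>x. complex_of_real (hq y x)) \<in> C0" and hpC: "(\<lambda>x. complex_of_real (hp y x)) \<in> C0"
    if "y \<in> J" for y
    unfolding hq_def hp_def using p q that by (intro hpow; simp)+
  let ?gq = "\<lambda>t x. complex_of_real (gq t x)" and ?gp = "\<lambda>t x. complex_of_real (gp t x)"
    and ?hq = "\<lambda>y x. complex_of_real (hq y x)" and ?hp = "\<lambda>y x. complex_of_real (hp y x)"
    and ?e = "\<lambda>x. complex_of_real (e x)"
  \<comment> \<open>Chosen so that \<open>E r\<close> at \<open>- r\<close> is a right inverse of
    delta_r up to the cutoff: their formal product is \<open>e\<close> at the unit, the conjugate
    cancelling \<open>u r (- r)\<close>.\<close>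
  define E where "E = (\<lambda>r x. ?e (\<phi> r x) * cnj (u r (- r) (\<phi> r x)))"
  have EC: "E r \<in> C0" for r
    unfolding E_def
    by (rule C0_mult_bounded[OF C0_translate[OF e(1)], of _ 1])
      (auto intro!: continuous_on_cnj continuous_on_compose2[OF u_continuous phi_continuous])
  have E1: "norm (E r x) \<le> 1" for r x
    using e(2,3)[of "\<phi> r x"] by (simp add: E_def norm_mult)
  \<comment> \<open>The exponents are split for the two kinds of contraction: q-th roots of
    \<open>g\<close> and \<open>h\<close> to the left of the matrix, p-th roots to its
    right.\<close>
  define D where "D = (\<lambda>y t. ?mult (?pm (?gq t) 0) (?mult (?pm ?e t) (?pm (?hq y) 0)))"
  define C where "C = (\<lambda>y r. ?mult (?pm (?hp y) 0) (?mult (?pm (E r) (- r)) (?pm (?gp r) 0)))"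
  have in1: "?mult (?pm ?e t) (?pm (?hq y) 0) \<in> carr (F \<phi> u)" if "y \<in> J" for y t
    using C0_mult[OF e(1) C0_translate[OF hqC[OF that]]] by (simp add: point_mass_mult point_mass_closed)
  have in2: "?mult (?pm (E r) (- r)) (?pm (?gp r) 0) \<in> carr (F \<phi> u)" for r
    using C0_mult[OF EC C0_translate[OF gpC]] by (simp add: point_mass_mult point_mass_closed)
  have DF: "D y t \<in> carr (F \<phi> u)" if "y \<in> J" for y t
    unfolding D_def using C0_mult[OF gqC C0_mult[OF e(1) C0_translate[OF hqC[OF that]]]]
    by (simp add: point_mass_mult point_mass_closed)
  have CF: "C y r \<in> carr (F \<phi> u)" if "y \<in> J" for y r
    unfolding C_def using C0_mult[OF hpC[OF that] C0_mult[OF EC C0_translate[OF gpC]]]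
    by (simp add: point_mass_mult point_mass_closed)
  have DC: "?mult (D y t) (C y r) = ?pm (approximant_coeff p g h t r y) (t - r)"
    if y: "y \<in> J" and t: "t \<in> R" and r: "r \<in> R" for y t r
  proof -
    have "approximant_coeff p g h t r y x = ?gq t x * (?e x * ?hq y (\<phi> (- t) x)) *
        (?hp y (\<phi> (- t) x) * (E r (\<phi> (- t) x) * ?gp r (\<phi> r (\<phi> (- t) x)))) * u t (- r) x" for x
    proof -
      have z: "\<phi> r (\<phi> (- t) x) = \<phi> (- (t - r)) x" by (simp add: phi_add[symmetric])
      have 1: "?gq t x * ?e x = ?gq t x"
        using e(4)[OF t, of x] by (cases "g t x = 0") (auto simp: gq_def)
      have 2: "?gp r (\<phi> (- (t - r)) x) * ?e (\<phi> (- (t - r)) x) = ?gp r (\<phi> (- (t - r)) x)"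
        using e(4)[OF r] by (cases "g r (\<phi> (- (t - r)) x) = 0") (auto simp: gp_def)
      have 3: "?hq y z * ?hp y z = h y z" for z
        using h(2)[of y z] by (simp add: hq_def hp_def of_real_mult[symmetric] powr_add[symmetric] del: of_real_mult)
      have "?gq t x * (?e x * ?hq y (\<phi> (- t) x)) *
          (?hp y (\<phi> (- t) x) * (E r (\<phi> (- t) x) * ?gp r (\<phi> r (\<phi> (- t) x)))) * u t (- r) x
        = (?gq t x * ?e x) * (?gp r (\<phi> (- (t - r)) x) * ?e (\<phi> (- (t - r)) x))
          * (?hq y (\<phi> (- t) x) * ?hp y (\<phi> (- t) x))
          * (cnj (u r (- r) (\<phi> (- (t - r)) x)) * u t (- r) x)"
        unfolding E_def z by (simp only: mult_ac)
      also have "\<dots> = approximant_coeff p g h t r y x"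
        unfolding 1 2 3 by (simp add: approximant_coeff_def gq_def gp_def)
      finally show ?thesis by simp
    qed
    then have "approximant_coeff p g h t r y = (\<lambda>x. ?gq t x * (?e x * ?hq y (\<phi> (- t) x)) *
        (?hp y (\<phi> (- t) x) * (E r (\<phi> (- t) x) * ?gp r (\<phi> r (\<phi> (- t) x)))) * u t (- r) x)"
      by (rule ext)
    then show ?thesis by (simp add: D_def C_def point_mass_mult)
  qed
  let ?a = "orbit_matrix b"
  \<comment> \<open>The factorisation from the inside out: columns applied to f, the scalar matrix
    for each y, the row over \<open>J\<close>, the twisted translation by t, and the row over
    \<open>R\<close>.\<close>
  define \<zeta> where "\<zeta> = (\<lambda>y r. \<Psi> (C y r) f)"
  define \<omega> where "\<omega> = (\<lambda>y t x. \<Sum>r\<in>R. ?a y t r * \<zeta> y r x)"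
  define \<kappa> where "\<kappa> = (\<lambda>t x. \<Sum>y\<in>J. mul (?hq y) (\<omega> y t) x)"
  define \<theta> where "\<theta> = (\<lambda>t. \<Psi> (?pm ?e t) (\<kappa> t))"
  define Z where "Z = (\<lambda>x. \<Sum>t\<in>R. mul (?gq t) (\<theta> t) x)"
  have eF: "?pm ?e t \<in> carr (F \<phi> u)" for t by (rule point_mass_closed[OF e(1)])
  have \<zeta>: "\<zeta> y r \<in> carr V" if "y \<in> J" for y r unfolding \<zeta>_def by (intro rep_closed CF that f)
  have \<omega>: "\<omega> y t \<in> carr V" if "y \<in> J" for y t unfolding \<omega>_def by (intro V_sum V_scale \<zeta> that)
  have h\<omega>: "mul (?hq y) (\<omega> y t) \<in> carr V" if "y \<in> J" for y t by (intro mul_closed hqC \<omega> that)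
  have \<kappa>: "\<kappa> t \<in> carr V" for t unfolding \<kappa>_def by (intro V_sum h\<omega>)
  have \<theta>: "\<theta> t \<in> carr V" for t unfolding \<theta>_def by (intro rep_closed eF \<kappa>)
  have Z: "Z \<in> carr V" unfolding Z_def by (intro V_sum mul_closed gqC \<theta>)
  have coeffC: "approximant_coeff p g h t r y \<in> C0" if "y \<in> J" for t r y
    using that by (rule approximant_coeff_C0[OF p g(1) h J])
  have X: "approximant p g R h J b \<in> carr (F \<phi> u)" by (rule approximant_closed[OF coeffC])
  have XZ: "AE x in M. \<Psi> (approximant p g R h J b) f x = Z x"
  proof -
    let ?I = "R \<times> R \<times> J"
    let ?b = "\<lambda>i s x. case i of (t, r, y) \<Rightarrow> ?a y t r * ?pm (approximant_coeff p g h t r y) (t - r) s x"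
    have bF: "?b i \<in> carr (F \<phi> u)" if mem: "i \<in> ?I" for i
    proof -
      obtain t r y where i: "i = (t, r, y)" "t \<in> R" "r \<in> R" "y \<in> J" using mem by auto
      then show ?thesis using F_scale_closed[OF point_mass_closed[OF coeffC]] by simp
    qed
    have 1: "AE x in M. \<Psi> (approximant p g R h J b) f x = (\<Sum>i\<in>?I. \<Psi> (?b i) f x)"
      unfolding approximant_def by (rule rep_sum[OF f bF])
    have 2: "AE x in M. \<forall>i\<in>?I. \<Psi> (?b i) f x = (case i of (t, r, y) \<Rightarrow> ?a y t r * \<Psi> (D y t) (\<zeta> y r) x)"
    proof (rule AE_finite_allI)
      fix i assume "i \<in> ?I"
      then obtain t r y where i: "i = (t, r, y)" "t \<in> R" "r \<in> R" "y \<in> J" by auto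
      have W: "?mult (D y t) (C y r) \<in> carr (F \<phi> u)"
        unfolding DC[OF i(4,2,3)] by (rule point_mass_closed[OF coeffC[OF i(4)]])
      have "AE x in M. \<Psi> (\<lambda>s x. ?a y t r * ?mult (D y t) (C y r) s x) f x
          = ?a y t r * \<Psi> (?mult (D y t) (C y r)) f x"
        by (rule rep_scale[OF W f])
      then show "AE x in M. \<Psi> (?b i) f x = (case i of (t, r, y) \<Rightarrow> ?a y t r * \<Psi> (D y t) (\<zeta> y r) x)"
        using rep_mult[OF DF[OF i(4), of t] CF[OF i(4), of r] f]
        by eventually_elim (simp add: i(1) DC[OF i(4,2,3), symmetric] \<zeta>_def)
    qed (use R J in simp)
    have 3: "AE x in M. \<forall>t\<in>R. mul (?gq t) (\<theta> t) x = (\<Sum>y\<in>J. \<Sum>r\<in>R. ?a y t r * \<Psi> (D y t) (\<zeta> y r) x)"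
    proof (rule AE_finite_allI[OF R])
      fix t assume t: "t \<in> R"
      let ?v = "\<lambda>y. \<Psi> (?pm ?e t) (mul (?hq y) (\<omega> y t))"
      have v: "?v y \<in> carr V" if "y \<in> J" for y by (intro rep_closed eF h\<omega> that)
      have gF: "?pm (?gq t) 0 \<in> carr (F \<phi> u)" by (rule point_mass_closed[OF gqC])
      have sv: "(\<lambda>x. \<Sum>y\<in>J. 1 * ?v y x) \<in> carr V" by (intro V_sum V_scale v)
      have "AE x in M. \<theta> t x = (\<Sum>y\<in>J. 1 * ?v y x)"
        unfolding \<theta>_def \<kappa>_def
        using rep_sum_arg[OF eF, where l = "\<lambda>_. 1" and I = J and g = "\<lambda>y. mul (?hq y) (\<omega> y t)", OF h\<omega>]
        by simp
      then have a: "AE x in M. mul (?gq t) (\<theta> t) x = mul (?gq t) (\<lambda>x. \<Sum>y\<in>J. 1 * ?v y x) x"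
        by (intro mul_cong gqC \<theta> sv)
      have b: "AE x in M. mul (?gq t) (\<lambda>x. \<Sum>y\<in>J. 1 * ?v y x) x = (\<Sum>y\<in>J. 1 * mul (?gq t) (?v y) x)"
        unfolding mul_def[of "?gq t"] by (rule rep_sum_arg[OF gF v])
      have c: "AE x in M. \<forall>y\<in>J. mul (?gq t) (?v y) x = (\<Sum>r\<in>R. ?a y t r * \<Psi> (D y t) (\<zeta> y r) x)"
      proof (rule AE_finite_allI[OF J])
        fix y assume y: "y \<in> J"
        have "AE x in M. \<Psi> (D y t) (\<omega> y t) x = mul (?gq t) (?v y) x"
          unfolding D_def mul_def
          by (rule rep_mult3[OF gF eF point_mass_closed[OF hqC[OF y]] in1[OF y] \<omega>[OF y]])
        moreover have "AE x in M. \<Psi> (D y t) (\<omega> y t) x = (\<Sum>r\<in>R. ?a y t r * \<Psi> (D y t) (\<zeta> y r) x)"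
          unfolding \<omega>_def by (rule rep_sum_arg[OF DF[OF y] \<zeta>[OF y]])
        ultimately show "AE x in M. mul (?gq t) (?v y) x = (\<Sum>r\<in>R. ?a y t r * \<Psi> (D y t) (\<zeta> y r) x)"
          by eventually_elim simp
      qed
      from a b c show "AE x in M. mul (?gq t) (\<theta> t) x = (\<Sum>y\<in>J. \<Sum>r\<in>R. ?a y t r * \<Psi> (D y t) (\<zeta> y r) x)"
        by eventually_elim simp
    qed
    have re: "(\<Sum>i\<in>?I. case i of (t, r, y) \<Rightarrow> k t r y) = (\<Sum>t\<in>R. \<Sum>y\<in>J. \<Sum>r\<in>R. k t r y)"
      for k :: "'g \<Rightarrow> 'g \<Rightarrow> 'x \<Rightarrow> complex"
    proof -
      have "(\<Sum>i\<in>?I. case i of (t, r, y) \<Rightarrow> k t r y) = (\<Sum>t\<in>R. \<Sum>r\<in>R. \<Sum>y\<in>J. k t r y)"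
        by (simp add: sum.cartesian_product)
      also have "\<dots> = (\<Sum>t\<in>R. \<Sum>y\<in>J. \<Sum>r\<in>R. k t r y)"
        by (intro sum.cong refl sum.swap)
      finally show ?thesis .
    qed
    from 1 2 3 show ?thesis
      by eventually_elim (simp add: Z_def re[symmetric] cong: sum.cong)
  qed
  have pmn: "norm_of (F \<phi> u) (?pm c s) \<le> 1" if "\<And>x. norm (c x) \<le> 1" for c s
    unfolding point_mass_norm using that by (rule sup_norm_least)
  have "mass Z \<le> (\<Sum>t\<in>R. mass (\<theta> t))"
    unfolding Z_def
  proof (rule row_contraction[OF R gqC _ q(1) _ \<theta>])
    show "(\<Sum>t\<in>R. gq t x powr q) \<le> 1" for x
      using g(2)[of x] g0 by (simp add: gq_def powr_powr q(2))
  qed (simp add: gq_def)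
  also have "\<dots> \<le> (\<Sum>t\<in>R. mass (\<kappa> t))"
    unfolding \<theta>_def using e(2,3) by (intro sum_mono mass_rep_le eF \<kappa> pmn) auto
  also have "\<dots> \<le> (\<Sum>t\<in>R. \<Sum>y\<in>J. mass (\<omega> y t))"
  proof (rule sum_mono)
    fix t
    show "mass (\<kappa> t) \<le> (\<Sum>y\<in>J. mass (\<omega> y t))"
      unfolding \<kappa>_def
    proof (rule row_contraction[OF J hqC _ q(1) _ \<omega>])
      show "(\<Sum>y\<in>J. hq y x powr q) \<le> 1" for x
        using h(2,3) by (simp add: hq_def powr_powr q(2))
    qed (simp_all add: hq_def)
  qed
  also have "\<dots> = (\<Sum>y\<in>J. \<Sum>t\<in>R. mass (\<omega> y t))" by (rule sum.swap)
  also have "\<dots> \<le> (\<Sum>y\<in>J. ?L powr p * (\<Sum>r\<in>R. mass (\<zeta> y r)))"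
    unfolding \<omega>_def by (intro sum_mono orbit_matrix_mass b R \<zeta>)
  also have "\<dots> = ?L powr p * (\<Sum>r\<in>R. \<Sum>y\<in>J. mass (\<zeta> y r))"
    by (subst sum.swap) (simp add: sum_distrib_left)
  \<comment> \<open>For each r separately the column over \<open>J\<close> is removed, then the
    translation; what remains is the column over \<open>R\<close> applied to f.\<close>
  also have "(\<Sum>r\<in>R. \<Sum>y\<in>J. mass (\<zeta> y r)) \<le> (\<Sum>r\<in>R. mass (mul (?gp r) f))"
  proof (rule sum_mono)
    fix r
    have gf: "mul (?gp r) f \<in> carr V" by (intro mul_closed gpC f)
    have EF: "?pm (E r) (- r) \<in> carr (F \<phi> u)" by (rule point_mass_closed[OF EC])
    let ?v = "\<Psi> (?pm (E r) (- r)) (mul (?gp r) f)"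
    have v: "?v \<in> carr V" by (intro rep_closed EF gf)
    have "(\<Sum>y\<in>J. mass (\<zeta> y r)) = (\<Sum>y\<in>J. mass (mul (?hp y) ?v))"
    proof (intro sum.cong refl mass_cong)
      fix y assume y: "y \<in> J"
      show "\<zeta> y r \<in> carr V" "mul (?hp y) ?v \<in> carr V" by (intro \<zeta> mul_closed hpC v y)+
      show "AE x in M. \<zeta> y r x = mul (?hp y) ?v x"
        unfolding \<zeta>_def C_def mul_def
        by (rule rep_mult3[OF point_mass_closed[OF hpC[OF y]] EF point_mass_closed[OF gpC] in2 f])
    qed
    also have "\<dots> \<le> mass ?v"
    proof (rule column_contraction[OF J hpC _ _ v])
      show "(\<Sum>y\<in>J. hp y x powr p) \<le> 1" for x
        using h(2,3) p by (simp add: hp_def powr_powr)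
    qed (simp_all add: hp_def)
    also have "\<dots> \<le> mass (mul (?gp r) f)"
      by (intro mass_rep_le EF gf pmn E1)
    finally show "(\<Sum>y\<in>J. mass (\<zeta> y r)) \<le> mass (mul (?gp r) f)" .
  qed
  also have "\<dots> \<le> mass f"
  proof (rule column_contraction[OF R gpC _ _ f])
    show "(\<Sum>t\<in>R. gp t x powr p) \<le> 1" for x
      using g(2)[of x] g0 p by (simp add: gp_def powr_powr)
  qed (simp add: gp_def)
  finally have "mass Z \<le> ?L powr p * mass f" by (simp add: mult_left_mono)
  moreover have "mass Z = mass (\<Psi> (approximant p g R h J b) f)"
    using XZ by (intro mass_cong[symmetric] rep_closed X f Z)
  moreover have L0: "0 \<le> ?L" using p by (intro reduced_norm_nonneg b) simp
  ultimately have "norm_of V (\<Psi> (approximant p g R h J b) f) powr p \<le> (?L * norm_of V f) powr p"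
    by (simp add: V_norm_powr powr_mult V_norm_nonneg)
  then show ?thesis by (rule powr_le_imp_le) (use p L0 V_norm_nonneg[of f] in simp_all)
qed

end

section \<open>Passage from approximants to arbitrary elements\<close>

lemma F_tail:
  assumes b: "b \<in> carr (F \<phi> u)" and e: "0 < e"
  obtains S where "finite S" "norm_of (F \<phi> u) b - (\<Sum>s\<in>S. sup_norm (b s)) \<le> e"
proof -
  have "(sum (\<lambda>s. sup_norm (b s)) \<longlongrightarrow> norm_of (F \<phi> u) b) (finite_subsets_at_top UNIV)"
    using has_sum_infsum[OF F_summable[OF b]] by (simp add: has_sum_def F_simps)
  then have "\<forall>\<^sub>F S in finite_subsets_at_top UNIV. dist (\<Sum>s\<in>S. sup_norm (b s)) (norm_of (F \<phi> u) b) < e"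
    using e by (rule tendstoD)
  then obtain S where "finite S" "dist (\<Sum>s\<in>S. sup_norm (b s)) (norm_of (F \<phi> u) b) < e"
    by (auto simp: eventually_finite_subsets_at_top)
  then show thesis using that[of S] by (simp add: dist_real_def abs_less_iff)
qed

lemma C0_cutoff_family:
  assumes S: "finite S" and b: "\<And>s. s \<in> S \<Longrightarrow> b s \<in> C0" and e: "0 < e"
  obtains K where "compact K" "\<And>s x. s \<in> S \<Longrightarrow> x \<notin> K \<Longrightarrow> norm (b s x) \<le> e"
proof -
  have "\<forall>s\<in>S. \<exists>K. compact K \<and> (\<forall>x. x \<notin> K \<longrightarrow> norm (b s x) < e)"
  proof
    fix s assume "s \<in> S"
    show "\<exists>K. compact K \<and> (\<forall>x. x \<notin> K \<longrightarrow> norm (b s x) < e)"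
      by (rule C0_cutoff[OF b[OF \<open>s \<in> S\<close>] e]) blast
  qed
  then obtain L where L: "\<And>s. s \<in> S \<Longrightarrow> compact (L s)" "\<And>s x. s \<in> S \<Longrightarrow> x \<notin> L s \<Longrightarrow> norm (b s x) < e"
    by metis
  show thesis
  proof (rule that[of "\<Union>s\<in>S. L s"])
    show "compact (\<Union>s\<in>S. L s)" using S L by (intro compact_UN) auto
    show "norm (b s x) \<le> e" if "s \<in> S" "x \<notin> (\<Union>s\<in>S. L s)" for s x
      using L(2)[of s x] that by (auto intro: less_imp_le)
  qed
qed

text \<open>The bound for approximants carries over because a representation is contractive for the
  l^1-norm. The choices depend on each other in the order tail set, cutoff accuracy, compact set,
  amenability functions, matrix accuracy, partition of unity.\<close>

lemma (in lp_representation) rep_le_reduced_norm: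
  assumes amen: "amenable_action TYPE('i) \<phi>" and b: "b \<in> carr (F \<phi> u)" and f: "f \<in> carr V"
  shows "norm_of V (\<Psi> b f) \<le> reduced_norm p \<phi> u b * norm_of V f"
proof (rule field_le_epsilon)
  fix e :: real assume e: "0 < e"
  define B N where "B = norm_of (F \<phi> u) b" and "N = norm_of V f"
  have B0: "0 \<le> B" unfolding B_def by (rule F_norm_nonneg[OF b])
  have N0: "0 \<le> N" unfolding N_def by (rule V_norm_nonneg)
  \<comment> \<open>The l^1-error consists of three parts of size at most \<epsilon> and is
    multiplied by N; adding 1 avoids division by zero.\<close>
  define \<epsilon> where "\<epsilon> = e / (3 * (N + 1))"
  have \<epsilon>: "0 < \<epsilon>" using e N0 by (simp add: \<epsilon>_def)
  obtain S where S: "finite S" and tail: "norm_of (F \<phi> u) b - (\<Sum>s\<in>S. sup_norm (b s)) \<le> \<epsilon>"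
    by (rule F_tail[OF b \<epsilon>])
  define \<epsilon>' where "\<epsilon>' = \<epsilon> / (1 + B + card S)"
  have \<epsilon>': "0 < \<epsilon>'" using \<epsilon> B0 by (simp add: \<epsilon>'_def)
  obtain K where K: "compact K" and bK: "\<And>s x. s \<in> S \<Longrightarrow> x \<notin> K \<Longrightarrow> norm (b s x) \<le> \<epsilon>'"
    by (rule C0_cutoff_family[of S b, OF S F_carrD[OF b] \<epsilon>']) blast
  obtain R and g :: "'g \<Rightarrow> 'x \<Rightarrow> real" where R: "finite R" and gC: "\<And>t. g t \<in> Cc_nonneg"
    and g0: "\<And>t x. t \<notin> R \<Longrightarrow> g t x = 0" and g1: "\<And>x. (\<Sum>t\<in>R. g t x) \<le> 1"
    and inv: "\<And>s x. s \<in> S \<Longrightarrow> x \<in> K \<Longrightarrow> 1 - \<epsilon>' \<le> (\<Sum>r\<in>R. min (g (s + r) x) (g r (\<phi> (- s) x)))"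
    by (rule amenable_normalised[OF amen S K \<epsilon>']) blast
  have gnn: "0 \<le> g t x" for t x using gC[of t] by (simp add: Cc_nonneg_def)
  \<comment> \<open>Fixed only now because the matrix error is multiplied by the number of pairs in
    \<open>R \<times> R\<close>.\<close>
  define \<delta> where "\<delta> = \<epsilon> / (1 + (card R)\<^sup>2)"
  have \<delta>: "0 < \<delta>" using \<epsilon> by (simp add: \<delta>_def add_pos_nonneg)
  let ?a = "\<lambda>(t, r) y. orbit_matrix b y t r"
  have fRR: "finite (R \<times> R)" using R by simp
  have aC: "?a i \<in> C0" for i using orbit_matrix_C0[OF b] by (cases i) simp
  obtain J :: "'x set" and h :: "'x \<Rightarrow> 'x \<Rightarrow> real" and K' where J: "finite J"
    and h: "\<And>y. continuous_on UNIV (h y)" "\<And>y x. 0 \<le> h y x" "\<And>x. (\<Sum>y\<in>J. h y x) \<le> 1"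
    and K': "compact K'" "\<And>y x. y \<in> J \<Longrightarrow> x \<notin> K' \<Longrightarrow> h y x = 0"
    and happ: "\<And>i x. i \<in> R \<times> R \<Longrightarrow> norm ((\<Sum>y\<in>J. h y x * ?a i y) - ?a i x) \<le> \<delta>"
    by (rule C0_partition[of "R \<times> R" ?a, OF fRR aC \<delta>]) blast
  have "\<forall>t. \<exists>L. compact L \<and> (\<forall>x. x \<notin> L \<longrightarrow> g t x = 0)"
  proof
    fix t show "\<exists>L. compact L \<and> (\<forall>x. x \<notin> L \<longrightarrow> g t x = 0)"
      by (rule Cc_nonneg_zero_outside[OF gC[of t]]) blast
  qed
  then obtain L where L: "\<And>t. compact (L t)" "\<And>t x. x \<notin> L t \<Longrightarrow> g t x = 0" by metis
  have "compact (\<Union>t\<in>R. L t)" using R L by (intro compact_UN) auto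
  then obtain c :: "'x \<Rightarrow> real" and K'' where c: "continuous_on UNIV c" "\<And>x. 0 \<le> c x" "\<And>x. c x \<le> 1"
    "\<And>x. x \<in> (\<Union>t\<in>R. L t) \<Longrightarrow> c x = 1" "compact K''" "\<And>x. x \<notin> K'' \<Longrightarrow> c x = 0"
    by (rule amenable_cutoff[OF amen]) blast
  have c0: "(\<lambda>x. complex_of_real (c x)) \<in> C0"
    using c by (intro C0_compact_support[of _ K''] continuous_on_of_real) auto
  have cg: "c x = 1" if "t \<in> R" "g t x \<noteq> 0" for t x using that L(2) c(4) by blast
  let ?X = "approximant p g R h J b"
  have X: "?X \<in> carr (F \<phi> u)"
    by (rule approximant_closed, rule approximant_coeff_C0[OF p gC h J])
  let ?Y = "\<lambda>s x. b s x - ?X s x"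
  have Y: "?Y \<in> carr (F \<phi> u)"
    using F_add_closed[OF b F_scale_closed[OF X, of "-1"]] by simp
  have "norm_of (F \<phi> u) ?Y \<le> \<epsilon>' * norm_of (F \<phi> u) b + \<epsilon>' * card S + \<epsilon> + \<delta> * (card R)\<^sup>2"
  proof (rule approximant_close[OF p b X R g0 gnn g1 _ S tail _ _ inv bK])
    show "norm ((\<Sum>y\<in>J. of_real (h y x) * orbit_matrix b y t r) - orbit_matrix b x t r) \<le> \<delta>"
      if "t \<in> R" "r \<in> R" for t r x
      using happ[of "(t, r)" x] that by simp
  qed (use \<epsilon> \<epsilon>' \<delta> in auto)
  also have "\<epsilon>' * norm_of (F \<phi> u) b + \<epsilon>' * card S \<le> \<epsilon>"
  proof -
    have "\<epsilon>' * norm_of (F \<phi> u) b + \<epsilon>' * card S = \<epsilon>' * (B + card S)" by (simp add: B_def distrib_left)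
    also have "\<dots> \<le> \<epsilon>' * (1 + B + card S)" using \<epsilon>' by (intro mult_left_mono) auto
    also have "\<dots> = \<epsilon>" using B0 by (simp add: \<epsilon>'_def)
    finally show ?thesis .
  qed
  also have "\<delta> * (card R)\<^sup>2 \<le> \<epsilon>"
  proof -
    have "\<delta> * (card R)\<^sup>2 \<le> \<delta> * (1 + (card R)\<^sup>2)" using \<delta> by (intro mult_left_mono) auto
    also have "\<dots> = \<epsilon>"
    proof -
      have "1 + (real (card R))\<^sup>2 \<noteq> 0" by (metis add_pos_nonneg less_irrefl zero_le_power2 zero_less_one)
      then show ?thesis by (simp add: \<delta>_def)
    qed
    finally show ?thesis .
  qed
  finally have Yn: "norm_of (F \<phi> u) ?Y \<le> 3 * \<epsilon>" by simp
  have Xf: "\<Psi> ?X f \<in> carr V" and Yf: "\<Psi> ?Y f \<in> carr V" by (intro rep_closed X Y f)+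
  have "AE x in M. \<Psi> b f x = \<Psi> ?X f x + \<Psi> ?Y f x"
    using rep_add[OF X Y f] by simp
  then have "norm_of V (\<Psi> b f) = norm_of V (\<lambda>x. \<Psi> ?X f x + \<Psi> ?Y f x)"
    by (intro V_norm_cong rep_closed b f V_add Xf Yf)
  also have "\<dots> \<le> norm_of V (\<Psi> ?X f) + norm_of V (\<Psi> ?Y f)" by (rule V_triangle[OF Xf Yf])
  also have "norm_of V (\<Psi> ?X f) \<le> reduced_norm p \<phi> u b * norm_of V f"
    by (rule approximant_bound[OF b f R J gC g1 h K' c0 c(2,3) cg])
  also have "norm_of V (\<Psi> ?Y f) \<le> 3 * \<epsilon> * N"
    using rep_bound[OF Y f] mult_right_mono[OF Yn N0] by (simp add: N_def)
  also have "3 * \<epsilon> * N \<le> 3 * \<epsilon> * (N + 1)" using \<epsilon> by simp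
  also have "\<dots> = \<epsilon> * (3 * (N + 1))" by simp
  also have "\<dots> = e"
    unfolding \<epsilon>_def by (rule nonzero_eq_divide_eq[THEN iffD1, OF _ refl]) (use N0 in simp)
  finally show "norm_of V (\<Psi> b f) \<le> reduced_norm p \<phi> u b * norm_of V f + e" by simp
qed

section \<open>Approximate units and transfer to abstract L^p-spaces\<close>

context twisted_action
begin

lemma cutoff_mult_closed:
  assumes k: "(\<lambda>x. complex_of_real (k x)) \<in> C0" "\<And>x. 0 \<le> k x" "\<And>x. k x \<le> 1" and b: "b \<in> carr (F \<phi> u)"
  shows "(\<lambda>s x. of_real (k x) * b s x) \<in> carr (F \<phi> u)"
proof -
  have c: "(\<lambda>x. of_real (k x) * b s x) \<in> C0" for s by (rule C0_mult[OF k(1) F_carrD[OF b]])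
  have "(\<lambda>s. sup_norm (\<lambda>x. of_real (k x) * b s x)) summable_on UNIV"
  proof (rule summable_on_comparison_test[OF F_summable[OF b]])
    fix s
    show "0 \<le> sup_norm (\<lambda>x. of_real (k x) * b s x)" by (rule sup_norm_nonneg[OF c])
    show "sup_norm (\<lambda>x. of_real (k x) * b s x) \<le> sup_norm (b s)"
    proof (rule sup_norm_least)
      fix x
      have "norm (of_real (k x) * b s x) \<le> 1 * sup_norm (b s)"
        unfolding norm_mult norm_of_real using k sup_norm_upper[OF F_carrD[OF b]]
        by (intro mult_mono) auto
      then show "norm (of_real (k x) * b s x) \<le> sup_norm (b s)" by simp
    qed
  qed
  then show ?thesis using c by (simp add: F_simps)
qed

lemma point_mass_mult_zero:
  "mult_of (F \<phi> u) (point_mass a 0) b = (\<lambda>s x. a x * b s x)"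
proof (intro ext)
  fix r x
  let ?f = "\<lambda>(s, t). point_mass a 0 s x * \<alpha> \<phi> s (b t) x * u s t x"
  have "(\<Sum>\<^sub>\<infinity>z\<in>{(s, t). s + t = r}. ?f z) = (\<Sum>\<^sub>\<infinity>z\<in>{(0, r)}. ?f z)"
    by (rule infsum_cong_neutral) (auto simp: point_mass_def split: if_splits)
  also have "\<dots> = a x * b r x" by (simp add: point_mass_def \<alpha>_def)
  finally show "mult_of (F \<phi> u) (point_mass a 0) b r x = a x * b r x" by (simp add: F_simps)
qed

text \<open>The compact set works for all cutoffs equal to 1 on it at once. This uniformity allows
  finitely many elements to share a cutoff.\<close>

lemma cutoff_close:
  assumes b: "b \<in> carr (F \<phi> u)" and e: "0 < e"
  obtains K where "compact K" "\<And>k. \<lbrakk>(\<lambda>x. complex_of_real (k x)) \<in> C0; \<And>x. 0 \<le> k x; \<And>x. k x \<le> 1;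
      \<And>x. x \<in> K \<Longrightarrow> k x = 1\<rbrakk> \<Longrightarrow> norm_of (F \<phi> u) (\<lambda>s x. of_real (k x) * b s x - b s x) \<le> e"
proof -
  have "0 < e / 2" using e by simp
  then obtain S where S: "finite S" and tail: "norm_of (F \<phi> u) b - (\<Sum>s\<in>S. sup_norm (b s)) \<le> e / 2"
    by (rule F_tail[OF b])
  define d where "d = e / 2 / (1 + card S)"
  have d: "0 < d" using e by (simp add: d_def)
  obtain K where K: "compact K" and bK: "\<And>s x. s \<in> S \<Longrightarrow> x \<notin> K \<Longrightarrow> norm (b s x) \<le> d"
    by (rule C0_cutoff_family[of S b, OF S F_carrD[OF b] d]) blast
  show thesis
  proof (rule that[OF K])
    fix k :: "'x \<Rightarrow> real"
    assume k: "(\<lambda>x. complex_of_real (k x)) \<in> C0" "\<And>x. 0 \<le> k x" "\<And>x. k x \<le> 1" "\<And>x. x \<in> K \<Longrightarrow> k x = 1"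
    let ?Y = "\<lambda>s x. of_real (k x) * b s x - b s x"
    have Y: "?Y \<in> carr (F \<phi> u)"
      using F_add_closed[OF cutoff_mult_closed[OF k(1-3) b] F_scale_closed[OF b, of "-1"]] by simp
    have Yx: "norm (?Y s x) = (1 - k x) * norm (b s x)" for s x
    proof -
      have "?Y s x = of_real (k x - 1) * b s x" by (simp add: algebra_simps)
      then have "norm (?Y s x) = \<bar>k x - 1\<bar> * norm (b s x)" by (simp only: norm_mult norm_of_real)
      then show ?thesis using k(3)[of x] by simp
    qed
    have 1: "sup_norm (?Y s) \<le> sup_norm (b s)" for s
    proof (rule sup_norm_least)
      fix x
      have "(1 - k x) * norm (b s x) \<le> 1 * sup_norm (b s)"
        using k(2,3)[of x] sup_norm_upper[OF F_carrD[OF b]] by (intro mult_mono) auto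
      then show "norm (?Y s x) \<le> sup_norm (b s)" unfolding Yx by simp
    qed
    have 2: "sup_norm (?Y s) \<le> d" if s: "s \<in> S" for s
    proof (rule sup_norm_least)
      fix x
      show "norm (?Y s x) \<le> d"
      proof (cases "x \<in> K")
        case True
        then show ?thesis using k(4) d by simp
      next
        case False
        have "(1 - k x) * norm (b s x) \<le> 1 * d"
          using k(2,3)[of x] bK[OF s False] by (intro mult_mono) auto
        then show ?thesis unfolding Yx by simp
      qed
    qed
    have "(\<Sum>\<^sub>\<infinity>s. sup_norm (?Y s)) \<le> e"
    proof (rule infsum_le_finite_sums[OF F_summable[OF Y]])
      fix U :: "'g set" assume U: "finite U"
      have "(\<Sum>s\<in>U. sup_norm (?Y s)) \<le> (\<Sum>s\<in>U. if s \<in> S then d else sup_norm (b s))"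
        using 1 2 by (intro sum_mono) auto
      also have "\<dots> = d * card (U \<inter> S) + (\<Sum>s\<in>U - S. sup_norm (b s))"
        using U by (simp add: sum.If_cases Diff_eq Int_def mult.commute)
      also have "d * card (U \<inter> S) \<le> e / 2"
      proof -
        have "d * card (U \<inter> S) \<le> d * (1 + card S)"
          using d card_mono[of S "U \<inter> S"] S by (intro mult_left_mono) auto
        also have "\<dots> = e / 2"
          unfolding d_def by (rule nonzero_eq_divide_eq[THEN iffD1, OF _ refl]) simp
        finally show ?thesis .
      qed
      also have "(\<Sum>s\<in>U - S. sup_norm (b s)) \<le> e / 2"
        using F_sum_Diff_le[OF b U S] tail by simp
      finally show "(\<Sum>s\<in>U. sup_norm (?Y s)) \<le> e" by simp
    qed
    then show "norm_of (F \<phi> u) ?Y \<le> e" by (simp add: F_simps)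
  qed
qed

text \<open>On vectors \<open>\<psi> b \<zeta>\<close> the claim is \<open>cutoff_close\<close>; it
  extends to the span by induction and to the closure because cutoffs act contractively.\<close>

lemma nondegenerate_approximate_unit:
  fixes E :: "'e cspace"
  assumes amen: "amenable_action TYPE('i) \<phi>" and E: "complex_normed_space E"
    and rep: "representation (F \<phi> u) E \<psi>" and nd: "nondegenerate (F \<phi> u) E \<psi>"
    and \<xi>: "\<xi> \<in> carr E" and e: "0 < e"
  shows "\<exists>k :: 'x \<Rightarrow> real. (\<lambda>x. of_real (k x)) \<in> C0 \<and> (\<forall>x. 0 \<le> k x \<and> k x \<le> 1) \<and>
    norm_of E (diff_of E (\<psi> (point_mass (\<lambda>x. of_real (k x)) 0) \<xi>) \<xi>) < e"
proof -
  interpret E: complex_normed_space E by (rule E)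
  note cl = representation_closed[OF rep] and addE = representation_linear(1)[OF rep]
    and scaleE = representation_linear(2)[OF rep] and bd = E.representation_norm_le[OF rep]
  let ?G = "{\<psi> b \<zeta> |b \<zeta>. b \<in> carr (F \<phi> u) \<and> \<zeta> \<in> carr E}"
  define good where "good = (\<lambda>K (k :: 'x \<Rightarrow> real). (\<lambda>x. complex_of_real (k x)) \<in> C0 \<and>
    (\<forall>x. 0 \<le> k x \<and> k x \<le> 1) \<and> (\<forall>x\<in>K. k x = 1))"
  let ?T = "\<lambda>k. \<psi> (point_mass (\<lambda>x. complex_of_real (k x)) 0)"
  have goodF: "point_mass (\<lambda>x. complex_of_real (k x)) 0 \<in> carr (F \<phi> u)" if "good K k" for K k
    using that by (intro point_mass_closed) (simp add: good_def)
  have mono: "good L k" if "good K k" "L \<subseteq> K" for K L k using that by (auto simp: good_def)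
  \<comment> \<open>Quantifying over all good cutoffs makes the induction close: for a sum one takes
    the union of the two compact sets.\<close>
  have span: "\<eta> \<in> carr E \<and> (\<forall>e>0. \<exists>K. compact K \<and> (\<forall>k. good K k \<longrightarrow> norm_of E (diff_of E (?T k \<eta>) \<eta>) \<le> e))"
    if "\<eta> \<in> lin_span E ?G" for \<eta>
    using that
  proof induction
    case 1
    have "diff_of E (?T k (zero_of E)) (zero_of E) = zero_of E" if "good {} k" for k
    proof -
      have "?T k (scale_of E 0 (zero_of E)) = scale_of E 0 (?T k (zero_of E))"
        by (rule scaleE[OF goodF[OF that] E.zero_closed])
      then show ?thesis
        using cl[OF goodF[OF that] E.zero_closed] E.zero_closed
        by (simp add: E.scale_zero E.diff_self)
    qed
    then show ?case using E.zero_closed E.norm_zero by (auto intro!: exI[of _ "{}"])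
  next
    case (2 \<eta>)
    then obtain b \<zeta> where b: "b \<in> carr (F \<phi> u)" and \<zeta>: "\<zeta> \<in> carr E" and \<eta>: "\<eta> = \<psi> b \<zeta>" by blast
    have "\<exists>K. compact K \<and> (\<forall>k. good K k \<longrightarrow> norm_of E (diff_of E (?T k \<eta>) \<eta>) \<le> e)" if e: "0 < e" for e
    proof -
      have "0 < e / (norm_of E \<zeta> + 1)" using e E.norm_nonneg[OF \<zeta>] by simp
      then obtain K where K: "compact K" and close: "\<And>k. \<lbrakk>(\<lambda>x. complex_of_real (k x)) \<in> C0; \<And>x. 0 \<le> k x; \<And>x. k x \<le> 1;
        \<And>x. x \<in> K \<Longrightarrow> k x = 1\<rbrakk> \<Longrightarrow> norm_of (F \<phi> u) (\<lambda>s x. of_real (k x) * b s x - b s x) \<le> e / (norm_of E \<zeta> + 1)"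
        by (rule cutoff_close[OF b]) blast
      have "norm_of E (diff_of E (?T k \<eta>) \<eta>) \<le> e" if k: "good K k" for k
      proof -
        have k': "(\<lambda>x. complex_of_real (k x)) \<in> C0" "\<And>x. 0 \<le> k x" "\<And>x. k x \<le> 1" "\<And>x. x \<in> K \<Longrightarrow> k x = 1"
          using k by (auto simp: good_def)
        let ?kb = "\<lambda>s x. complex_of_real (k x) * b s x" and ?nb = "\<lambda>s x. (-1) * b s x"
        have kb: "?kb \<in> carr (F \<phi> u)" by (rule cutoff_mult_closed[OF k'(1-3) b])
        have nb: "?nb \<in> carr (F \<phi> u)" by (rule F_scale_closed[OF b])
        have Y: "(\<lambda>s x. ?kb s x + ?nb s x) \<in> carr (F \<phi> u)" by (rule F_add_closed[OF kb nb])
        have "?T k \<eta> = \<psi> (mult_of (F \<phi> u) (point_mass (\<lambda>x. complex_of_real (k x)) 0) b) \<zeta>"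
          using rep goodF[OF k] b \<zeta> by (simp add: representation_def \<eta>)
        then have "?T k \<eta> = \<psi> ?kb \<zeta>" by (simp add: point_mass_mult_zero)
        moreover have "\<psi> ?nb \<zeta> = scale_of E (-1) \<eta>"
        proof -
          have "\<psi> (scale_of (F \<phi> u) (-1) b) \<zeta> = scale_of E (-1) (\<psi> b \<zeta>)"
            using rep b \<zeta> unfolding representation_def by blast
          then show ?thesis by (simp add: F_simps \<eta>)
        qed
        moreover have "\<psi> (\<lambda>s x. ?kb s x + ?nb s x) \<zeta> = add_of E (\<psi> ?kb \<zeta>) (\<psi> ?nb \<zeta>)"
        proof -
          have "\<psi> (add_of (F \<phi> u) ?kb ?nb) \<zeta> = add_of E (\<psi> ?kb \<zeta>) (\<psi> ?nb \<zeta>)"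
            using rep kb nb \<zeta> unfolding representation_def by blast
          then show ?thesis by (simp add: F_simps)
        qed
        ultimately have "diff_of E (?T k \<eta>) \<eta> = \<psi> (\<lambda>s x. ?kb s x + ?nb s x) \<zeta>" by (simp add: diff_of_def)
        then have "norm_of E (diff_of E (?T k \<eta>) \<eta>) \<le> norm_of (F \<phi> u) (\<lambda>s x. ?kb s x + ?nb s x) * norm_of E \<zeta>"
          using bd[OF Y \<zeta>] by simp
        also have "\<dots> \<le> e / (norm_of E \<zeta> + 1) * norm_of E \<zeta>"
          using close[OF k'] E.norm_nonneg[OF \<zeta>] by (intro mult_right_mono) auto
        also have "\<dots> \<le> e / (norm_of E \<zeta> + 1) * (norm_of E \<zeta> + 1)"
          using e E.norm_nonneg[OF \<zeta>] by (intro mult_left_mono) auto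
        also have "\<dots> = e" using E.norm_nonneg[OF \<zeta>] by simp
        finally show ?thesis .
      qed
      then show ?thesis using K by blast
    qed
    then show ?case using cl[OF b \<zeta>] \<eta> by blast
  next
    case (3 \<eta> \<zeta>)
    then have \<eta>: "\<eta> \<in> carr E" and \<zeta>: "\<zeta> \<in> carr E" by auto
    have "\<exists>K. compact K \<and> (\<forall>k. good K k \<longrightarrow> norm_of E (diff_of E (?T k (add_of E \<eta> \<zeta>)) (add_of E \<eta> \<zeta>)) \<le> e)"
      if "0 < e" for e
    proof -
      have e2: "0 < e / 2" using that by simp
      obtain K where K: "compact K" "\<forall>k. good K k \<longrightarrow> norm_of E (diff_of E (?T k \<eta>) \<eta>) \<le> e / 2"
        using "3.IH"(1) e2 by blast
      obtain L where L: "compact L" "\<forall>k. good L k \<longrightarrow> norm_of E (diff_of E (?T k \<zeta>) \<zeta>) \<le> e / 2"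
        using "3.IH"(2) e2 by blast
      have "norm_of E (diff_of E (?T k (add_of E \<eta> \<zeta>)) (add_of E \<eta> \<zeta>)) \<le> e" if k: "good (K \<union> L) k" for k
      proof -
        have "norm_of E (diff_of E (?T k \<eta>) \<eta>) \<le> e / 2" "norm_of E (diff_of E (?T k \<zeta>) \<zeta>) \<le> e / 2"
          using K(2) L(2) mono[OF k] by auto
        moreover have "diff_of E (?T k (add_of E \<eta> \<zeta>)) (add_of E \<eta> \<zeta>)
            = add_of E (diff_of E (?T k \<eta>) \<eta>) (diff_of E (?T k \<zeta>) \<zeta>)"
          using addE[OF goodF[OF k] \<eta> \<zeta>]
            E.diff_add_add[OF cl[OF goodF[OF k] \<eta>] cl[OF goodF[OF k] \<zeta>] \<eta> \<zeta>] by simp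
        ultimately show ?thesis
          using E.norm_triangle[OF E.diff_closed[OF cl[OF goodF[OF k] \<eta>] \<eta>] E.diff_closed[OF cl[OF goodF[OF k] \<zeta>] \<zeta>]]
          by simp
      qed
      then show ?thesis using compact_Un[OF K(1) L(1)] by blast
    qed
    then show ?case using E.add_closed[OF \<eta> \<zeta>] by blast
  next
    case (4 \<eta> c)
    then have \<eta>: "\<eta> \<in> carr E" by auto
    have "\<exists>K. compact K \<and> (\<forall>k. good K k \<longrightarrow> norm_of E (diff_of E (?T k (scale_of E c \<eta>)) (scale_of E c \<eta>)) \<le> e)"
      if "0 < e" for e
    proof -
      have pos: "0 < norm c + 1" by (simp add: add_nonneg_pos)
      have e2: "0 < e / (norm c + 1)" using that pos by simp
      obtain K where K: "compact K" "\<forall>k. good K k \<longrightarrow> norm_of E (diff_of E (?T k \<eta>) \<eta>) \<le> e / (norm c + 1)"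
        using "4.IH" e2 by blast
      have "norm_of E (diff_of E (?T k (scale_of E c \<eta>)) (scale_of E c \<eta>)) \<le> e" if k: "good K k" for k
      proof -
        have "norm_of E (diff_of E (?T k (scale_of E c \<eta>)) (scale_of E c \<eta>)) = norm c * norm_of E (diff_of E (?T k \<eta>) \<eta>)"
          using scaleE[OF goodF[OF k] \<eta>] cl[OF goodF[OF k] \<eta>] \<eta>
          by (simp add: E.scale_diff E.norm_scale E.diff_closed)
        also have "\<dots> \<le> (norm c + 1) * (e / (norm c + 1))"
          using K(2) k E.norm_nonneg[OF E.diff_closed[OF cl[OF goodF[OF k] \<eta>] \<eta>]] by (intro mult_mono) auto
        also have "\<dots> = e" using pos by simp
        finally show ?thesis .
      qed
      then show ?thesis using K(1) by blast
    qed
    then show ?case using E.scale_closed[OF \<eta>] by blast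
  qed
  \<comment> \<open>Three distances, from \<open>?T k \<xi>\<close> to \<open>?T k \<eta>\<close>,
    to \<eta> and to \<xi>, contribute at most \<open>e / 4\<close> each.\<close>
  have e4: "0 < e / 4" using e by simp
  then obtain \<eta> where \<eta>: "\<eta> \<in> lin_span E ?G" "norm_of E (diff_of E \<eta> \<xi>) < e / 4"
    using nd \<xi> unfolding nondegenerate_def by blast
  have \<eta>E: "\<eta> \<in> carr E" using span[OF \<eta>(1)] by blast
  obtain K where K: "compact K" and close: "\<forall>k. good K k \<longrightarrow> norm_of E (diff_of E (?T k \<eta>) \<eta>) \<le> e / 4"
    using span[OF \<eta>(1)] e4 by blast
  obtain k :: "'x \<Rightarrow> real" and K' where k: "continuous_on UNIV k" "\<And>x. 0 \<le> k x" "\<And>x. k x \<le> 1"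
    "\<And>x. x \<in> K \<Longrightarrow> k x = 1" "compact K'" "\<And>x. x \<notin> K' \<Longrightarrow> k x = 0"
    by (rule amenable_cutoff[OF amen K]) blast
  have kC: "(\<lambda>x. complex_of_real (k x)) \<in> C0"
    using k by (intro C0_compact_support[of _ K'] continuous_on_of_real) auto
  have gk: "good K k" using k kC by (simp add: good_def)
  note kF = goodF[OF gk]
  have T\<xi>: "?T k \<xi> \<in> carr E" "?T k \<eta> \<in> carr E" by (intro cl kF \<xi> \<eta>E)+
  have "diff_of E (?T k \<xi>) (?T k \<eta>) = ?T k (diff_of E \<xi> \<eta>)"
    using addE[OF kF \<xi> E.scale_closed[OF \<eta>E, of "-1"]] scaleE[OF kF \<eta>E, of "-1"]
    by (simp add: diff_of_def)
  then have "norm_of E (diff_of E (?T k \<xi>) (?T k \<eta>)) \<le> sup_norm (\<lambda>x. complex_of_real (k x)) * norm_of E (diff_of E \<xi> \<eta>)"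
    using bd[OF kF E.diff_closed[OF \<xi> \<eta>E]] by (simp add: point_mass_norm)
  also have "\<dots> \<le> 1 * norm_of E (diff_of E \<xi> \<eta>)"
    using k(2,3) E.norm_nonneg[OF E.diff_closed[OF \<xi> \<eta>E]] by (intro mult_right_mono sup_norm_least) auto
  finally have "norm_of E (diff_of E (?T k \<xi>) (?T k \<eta>)) < e / 4"
    using \<eta>(2) E.norm_diff_comm[OF \<xi> \<eta>E] by simp
  moreover have "norm_of E (diff_of E (?T k \<eta>) \<eta>) \<le> e / 4" using close gk by blast
  ultimately have "norm_of E (diff_of E (?T k \<xi>) \<xi>) < e"
    using E.norm_diff_triangle[OF T\<xi>(1) T\<xi>(2) \<xi>] E.norm_diff_triangle[OF T\<xi>(2) \<eta>E \<xi>] \<eta>(2) e by linarith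
  then show ?thesis using k kC by blast
qed

text \<open>The estimates are pointwise, so \<psi> is transported along the isometry
  \<open>J\<close> to functions. Representatives are chosen, and the algebraic identities survive
  almost everywhere, as \<open>lp_representation\<close> requires.\<close>

lemma operator_norm_le_reduced_norm:
  fixes E :: "('n \<Rightarrow> complex) set cspace"
  assumes amen: "amenable_action TYPE('i) \<phi>" and p: "1 < p" and E: "Lp_space TYPE('n) p E"
    and rep: "representation (F \<phi> u) E \<psi>" and nd: "nondegenerate (F \<phi> u) E \<psi>"
    and b: "b \<in> carr (F \<phi> u)"
  shows "operator_norm E (\<psi> b) \<le> reduced_norm p \<phi> u b"
proof -
  have p1: "1 \<le> p" using p by simp
  obtain M :: "'n measure" and J where ban: "complex_banach_space E"
    and bij: "bij_betw J (carr E) (carr (Lp p M))" and iso: "linear_isometry E (Lp p M) J"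
    using E unfolding Lp_space_def by blast
  interpret E: complex_banach_space E by (rule ban)
  define V where "V = Lp_functions p M"
  interpret V: complex_seminormed_space V unfolding V_def by (rule Lp_functions_seminormed[OF p1])
  have Q: "Lp p M = separated_quotient V" by (simp add: Lp_def V_def)
  note Qs = V.separated_quotient_simps[folded Q]
  have opV [simp]: "add_of V f g = (\<lambda>x. f x + g x)" "scale_of V c f = (\<lambda>x. c * f x)"
    "diff_of V f g = (\<lambda>x. f x - g x)" for f g c
    by (simp_all add: V_def)
  have nc_AE: "null_class V f = null_class V g \<longleftrightarrow> (AE x in M. f x = g x)"
    if "f \<in> carr V" "g \<in> carr V" for f g
    using V.null_class_eq_iff[OF that] Lp_functions_norm_eq_0_iff[of p "\<lambda>x. f x - g x" M]
      V.diff_closed[OF that] p by (simp add: V_def)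
  have J_add: "J (add_of E \<zeta> \<eta>) = add_of (Lp p M) (J \<zeta>) (J \<eta>)"
    and J_scale: "J (scale_of E c \<zeta>) = scale_of (Lp p M) c (J \<zeta>)"
    and J_norm: "norm_of (Lp p M) (J \<zeta>) = norm_of E \<zeta>"
    if "\<zeta> \<in> carr E" "\<eta> \<in> carr E" for \<zeta> \<eta> c
    using iso that by (auto simp: linear_isometry_def linear_map_def)
  have J_inj: "\<zeta> = \<eta>" if "\<zeta> \<in> carr E" "\<eta> \<in> carr E" "J \<zeta> = J \<eta>" for \<zeta> \<eta>
    using bij that by (auto simp: bij_betw_def inj_on_def)
  define rp where "rp = (\<lambda>\<zeta>. SOME f. f \<in> carr V \<and> J \<zeta> = null_class V f)"
  have rp: "rp \<zeta> \<in> carr V" "J \<zeta> = null_class V (rp \<zeta>)" if "\<zeta> \<in> carr E" for \<zeta>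
  proof -
    have "J \<zeta> \<in> carr (Lp p M)" using bij that by (auto simp: bij_betw_def)
    then have "\<exists>f. f \<in> carr V \<and> J \<zeta> = null_class V f" by (auto simp: Qs)
    then have "rp \<zeta> \<in> carr V \<and> J \<zeta> = null_class V (rp \<zeta>)" unfolding rp_def by (rule someI_ex)
    then show "rp \<zeta> \<in> carr V" "J \<zeta> = null_class V (rp \<zeta>)" by auto
  qed
  \<comment> \<open>\<open>lf\<close> sends a function to the vector of its class and is exactly
    linear; \<open>rp\<close> chooses a function for a vector and is linear almost everywhere. Thus
    \<open>lf\<close> after \<open>rp\<close> is the identity, the converse only almost
    everywhere.\<close>
  define lf where "lf = (\<lambda>f. inv_into (carr E) J (null_class V f))"
  have lf: "lf f \<in> carr E" "J (lf f) = null_class V f" if "f \<in> carr V" for f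
  proof -
    have "null_class V f \<in> J ` carr E" using bij that by (simp add: bij_betw_def Qs)
    then show "lf f \<in> carr E" "J (lf f) = null_class V f"
      unfolding lf_def by (rule inv_into_into, rule f_inv_into_f)
  qed
  have rp_norm: "norm_of V (rp \<zeta>) = norm_of E \<zeta>" if "\<zeta> \<in> carr E" for \<zeta>
    using J_norm[OF that that] rp[OF that] by (simp add: Qs)
  have lf_norm: "norm_of E (lf f) = norm_of V f" if "f \<in> carr V" for f
    using J_norm[OF lf(1)[OF that] lf(1)[OF that]] lf(2)[OF that] that by (simp add: Qs)
  have rp_add: "AE x in M. rp (add_of E \<zeta> \<eta>) x = rp \<zeta> x + rp \<eta> x" if "\<zeta> \<in> carr E" "\<eta> \<in> carr E" for \<zeta> \<eta>
    using J_add[OF that] rp[OF that(1)] rp[OF that(2)] rp[OF E.add_closed[OF that]]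
      V.add_closed[OF rp(1)[OF that(1)] rp(1)[OF that(2)]]
    by (simp add: Qs nc_AE)
  have rp_scale: "AE x in M. rp (scale_of E c \<zeta>) x = c * rp \<zeta> x" if "\<zeta> \<in> carr E" for \<zeta> c
    using J_scale[OF that that, of c] rp[OF that] rp[OF E.scale_closed[OF that, of c]]
      V.scale_closed[OF rp(1)[OF that], of c]
      nc_AE[OF rp(1)[OF E.scale_closed[OF that, of c]], of "\<lambda>x. c * rp \<zeta> x"]
    by (simp add: Qs)
  have lf_add: "lf (\<lambda>x. f x + g x) = add_of E (lf f) (lf g)" if "f \<in> carr V" "g \<in> carr V" for f g
  proof (rule J_inj)
    have fg: "(\<lambda>x. f x + g x) \<in> carr V" using V.add_closed[OF that] by simp
    show "lf (\<lambda>x. f x + g x) \<in> carr E" by (rule lf(1)[OF fg])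
    show "add_of E (lf f) (lf g) \<in> carr E" by (intro E.add_closed lf that)
    show "J (lf (\<lambda>x. f x + g x)) = J (add_of E (lf f) (lf g))"
      unfolding lf(2)[OF fg] J_add[OF lf(1)[OF that(1)] lf(1)[OF that(2)]] lf(2)[OF that(1)] lf(2)[OF that(2)]
        Qs(3)[OF that] opV ..
  qed
  have lf_scale: "lf (\<lambda>x. c * f x) = scale_of E c (lf f)" if "f \<in> carr V" for f c
  proof (rule J_inj)
    have cf: "(\<lambda>x. c * f x) \<in> carr V" using V.scale_closed[OF that, of c] by simp
    show "lf (\<lambda>x. c * f x) \<in> carr E" by (rule lf(1)[OF cf])
    show "scale_of E c (lf f) \<in> carr E" by (intro E.scale_closed lf that)
    show "J (lf (\<lambda>x. c * f x)) = J (scale_of E c (lf f))"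
      unfolding lf(2)[OF cf] J_scale[OF lf(1)[OF that] lf(1)[OF that]] lf(2)[OF that] Qs(4)[OF that] opV ..
  qed
  have lf_rp: "lf (rp \<zeta>) = \<zeta>" if "\<zeta> \<in> carr E" for \<zeta>
    by (rule J_inj[OF lf(1)[OF rp(1)[OF that]] that]) (simp only: lf(2)[OF rp(1)[OF that]] rp(2)[OF that])
  have rp_lf: "AE x in M. rp (lf f) x = f x" if "f \<in> carr V" for f
    using nc_AE[OF rp(1)[OF lf(1)[OF that]] that] rp(2)[OF lf(1)[OF that]] lf(2)[OF that] by simp
  note cl = representation_closed[OF rep] and addE = representation_linear(1)[OF rep]
    and scaleE = representation_linear(2)[OF rep] and bd = E.representation_norm_le[OF rep]
  define \<Psi> where "\<Psi> = (\<lambda>a f. rp (\<psi> a (lf f)))"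
  have "lp_representation \<phi> u p M \<Psi>"
  proof (unfold_locales, unfold V_def[symmetric])
    show "1 < p" by (rule p)
    fix a and f assume a: "a \<in> carr (F \<phi> u)" and f: "f \<in> carr V"
    note lff = lf(1)[OF f]
    show "\<Psi> a f \<in> carr V" unfolding \<Psi>_def by (intro rp cl a lff)
    show "norm_of V (\<Psi> a f) \<le> norm_of (F \<phi> u) a * norm_of V f"
      using bd[OF a lff] by (simp add: \<Psi>_def rp_norm[OF cl[OF a lff]] lf_norm[OF f])
    show "AE x in M. \<Psi> (\<lambda>g x. c * a g x) f x = c * \<Psi> a f x" for c
    proof -
      have "\<psi> (scale_of (F \<phi> u) c a) (lf f) = scale_of E c (\<psi> a (lf f))"
        using rep a lff unfolding representation_def by blast
      then show ?thesis using rp_scale[OF cl[OF a lff], of c] by (simp add: \<Psi>_def F_simps)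
    qed
    show "AE x in M. \<Psi> a (\<lambda>x. c * f x) x = c * \<Psi> a f x" for c
      using rp_scale[OF cl[OF a lff], of c] scaleE[OF a lff, of c] by (simp add: \<Psi>_def lf_scale[OF f])
    show "AE x in M. \<Psi> a (\<lambda>x. f x + g x) x = \<Psi> a f x + \<Psi> a g x" if g: "g \<in> carr V" for g
      using rp_add[OF cl[OF a lff] cl[OF a lf(1)[OF g]]] addE[OF a lff lf(1)[OF g]]
      by (simp add: \<Psi>_def lf_add[OF f g])
    fix c assume c: "c \<in> carr (F \<phi> u)"
    show "AE x in M. \<Psi> (\<lambda>g x. a g x + c g x) f x = \<Psi> a f x + \<Psi> c f x"
    proof -
      have "\<psi> (add_of (F \<phi> u) a c) (lf f) = add_of E (\<psi> a (lf f)) (\<psi> c (lf f))"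
        using rep a c lff unfolding representation_def by blast
      then show ?thesis using rp_add[OF cl[OF a lff] cl[OF c lff]] by (simp add: \<Psi>_def F_simps)
    qed
    show "AE x in M. \<Psi> (mult_of (F \<phi> u) a c) f x = \<Psi> a (\<Psi> c f) x"
    proof -
      have "\<psi> (mult_of (F \<phi> u) a c) (lf f) = \<psi> a (\<psi> c (lf f))"
        using rep a c lff unfolding representation_def by blast
      then show ?thesis by (simp add: \<Psi>_def lf_rp[OF cl[OF c lff]])
    qed
  next
    fix f :: "'n \<Rightarrow> complex" and e :: real assume f: "f \<in> carr V" and e: "0 < e"
    note lff = lf(1)[OF f]
    obtain k :: "'x \<Rightarrow> real" where k: "(\<lambda>x. complex_of_real (k x)) \<in> C0" "\<forall>x. 0 \<le> k x \<and> k x \<le> 1"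
      and close: "norm_of E (diff_of E (\<psi> (point_mass (\<lambda>x. of_real (k x)) 0) (lf f)) (lf f)) < e"
      using nondegenerate_approximate_unit[OF amen E.complex_normed_space_axioms rep nd lff e] by blast
    let ?k = "point_mass (\<lambda>x. complex_of_real (k x)) (0 :: 'g)"
    note kl = cl[OF point_mass_closed[OF k(1), of 0] lff]
    have kV: "rp (\<psi> ?k (lf f)) \<in> carr V" by (rule rp(1)[OF kl])
    have d: "diff_of E (\<psi> ?k (lf f)) (lf f) \<in> carr E" by (rule E.diff_closed[OF kl lff])
    have "AE x in M. rp (diff_of E (\<psi> ?k (lf f)) (lf f)) x = \<Psi> ?k f x - f x"
      using rp_add[OF kl E.scale_closed[OF lff, of "-1"]] rp_scale[OF lff, of "-1"] rp_lf[OF f]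
      unfolding diff_of_def \<Psi>_def by eventually_elim simp
    then have "norm_of V (rp (diff_of E (\<psi> ?k (lf f)) (lf f))) = norm_of V (\<lambda>x. \<Psi> ?k f x - f x)"
      using rp(1)[OF d] V.diff_closed[OF kV f] unfolding V_def
      by (intro Lp_functions_norm_cong_AE) (auto simp: \<Psi>_def V_def dest: Lp_functions_measurable)
    then show "\<exists>k :: 'x \<Rightarrow> real. (\<lambda>x. complex_of_real (k x)) \<in> C0 \<and> (\<forall>x. 0 \<le> k x \<and> k x \<le> 1) \<and>
        norm_of V (\<lambda>x. \<Psi> (point_mass (\<lambda>x. of_real (k x)) 0) f x - f x) < e"
      using k close rp_norm[OF d] by (intro exI[of _ k]) simp
  qed
  then interpret R: lp_representation \<phi> u p M \<Psi> V
    unfolding V_def .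
  show ?thesis
  proof (rule E.operator_norm_le)
    show "0 \<le> reduced_norm p \<phi> u b" by (rule reduced_norm_nonneg[OF p1 b])
    fix \<zeta> assume \<zeta>: "\<zeta> \<in> carr E"
    show "norm_of E (\<psi> b \<zeta>) \<le> reduced_norm p \<phi> u b * norm_of E \<zeta>"
      using R.rep_le_reduced_norm[OF amen b rp(1)[OF \<zeta>]]
      by (simp add: \<Psi>_def lf_rp[OF \<zeta>] rp_norm[OF \<zeta>] rp_norm[OF cl[OF b \<zeta>]])
  qed
qed

text \<open>The supremum is a maximum, attained at the copy of \<Lambda> on the left summand of the
  index type.\<close>

lemma full_norm_eq_reduced_norm:
  assumes amen: "amenable_action TYPE('i) \<phi>" and p: "1 < p" and b: "b \<in> carr (F \<phi> u)"
  shows "full_norm TYPE('x \<times> 'g + 'm) p \<phi> u b = reduced_norm p \<phi> u b"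
  unfolding full_norm_def
proof (rule cSup_eq_maximum)
  obtain E :: "('x \<times> 'g + 'm \<Rightarrow> complex) set cspace" and \<psi> where
    "Lp_space TYPE('x \<times> 'g + 'm) p E" "representation (F \<phi> u) E \<psi>" "nondegenerate (F \<phi> u) E \<psi>"
    "operator_norm E (\<psi> b) = reduced_norm p \<phi> u b"
    by (rule regular_representation_on_Lp[OF amen less_imp_le[OF p]]) (use b in blast)
  then show "reduced_norm p \<phi> u b \<in> {operator_norm E (\<psi> b) |(E :: ('x \<times> 'g + 'm \<Rightarrow> complex) set cspace) \<psi>.
     Lp_space TYPE('x \<times> 'g + 'm) p E \<and> representation (F \<phi> u) E \<psi> \<and> nondegenerate (F \<phi> u) E \<psi>}"
    by (metis (mono_tags, lifting) mem_Collect_eq)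
qed (use operator_norm_le_reduced_norm[OF amen p _ _ _ b] in blast)

end

theorem theorem3p5:
  fixes \<phi> :: "'g::group_add \<Rightarrow> 'x::t2_space \<Rightarrow> 'x"
    and u :: "'g \<Rightarrow> 'g \<Rightarrow> 'x \<Rightarrow> complex"
    and p :: real
  assumes "locally_compact_space (euclidean :: 'x topology)"
    and "homeo_action \<phi>"
    and "normalised_2cocycle \<phi> u"
    and "amenable_action TYPE('i) \<phi>"
    and "1 < p"
  shows "linear_isometry (Fp TYPE('x \<times> 'g + 'm) p \<phi> u) (Fp_red p \<phi> u)
           (regular_representation TYPE('x \<times> 'g + 'm) p \<phi> u)"
proof -
  interpret twisted_action \<phi> u by unfold_locales (fact assms)+
  show ?thesis
    unfolding Fp_def Fp_red_def regular_representation_def F_full_def F_red_def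
    using F_red_seminormed[of p] full_norm_eq_reduced_norm[OF assms(4,5)] assms(5)
    by (intro linear_isometry_continuous_extension_id) (auto simp: F_red_def)
qed

end
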